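(* Let $\varphi$ be a free holomorphic self-map of the noncommutative ball $[B(\mathcal H)^n]_1$ such that its scalar representation has a fixed point $\xi\in\mathbb B_n$, and let $C_\varphi$ be the associated composition operator on $H^2_{\bf ball}$. Then $$\sigma_p(C_\varphi)\subseteq\{1\}\cup\mathcal P_{eig}\subseteq\sigma(C_\varphi),$$ where $\mathcal P_{eig}$ is the set of all possible products of eigenvalues of the matrix $[\langle\psi_i,e_j\rangle]_{n\times n}$, where $\psi=(\psi_1,\ldots,\psi_n):=\Phi_\xi\circ\varphi\circ\Phi_\xi$ and $\Phi_\xi$ is the involutive free holomorphic automorphism of $[B(\mathcal H)^n]_1$ associated with $\xi\in\mathbb B_n$.
   Context: $n\ge1$; $\mathcal H$ is a separable infinite dimensional complex Hilbert space. $\mathbb F_n^+$ is the free semigroup with generators $g_1,\ldots,g_n$ and identity $g_0$; $|g_0|=0$, $|\alpha|=k$ if $\alpha=g_{i_1}\cdots g_{i_k}$; $X_\alpha:=X_{i_1}\cdots X_{i_k}$, $X_{g_0}:=I$. $[B(\mathcal H)^n]_1:=\{(X_1,\ldots,X_n)\in B(\mathcal H)^n:\ \|X_1X_1^*+\cdots+X_nX_n^*\|^{1/2}<1\}$. A free holomorphic function $f:[B(\mathcal H)^n]_1\to B(\mathcal H)$ is a map $f(X)=\sum_{k=0}^\infty\sum_{|\alpha|=k}a_\alpha X_\alpha$ (series over $k$ converging in operator norm) with $a_\alpha\in\mathbb C$ and $\limsup_{k\to\infty}(\sum_{|\alpha|=k}|a_\alpha|^2)^{1/2k}\le1$. A free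 holomorphic self-map $\varphi=(\varphi_1,\ldots,\varphi_n)$ of $[B(\mathcal H)^n]_1$ has each $\varphi_i$ free holomorphic and maps $[B(\mathcal H)^n]_1$ into itself. With $\varphi_\alpha:=\varphi_{i_1}\cdots\varphi_{i_k}$, the composition is $(f\circ\varphi)(X)=\sum_{k=0}^\infty\sum_{|\alpha|=k}a_\alpha\varphi_\alpha(X)$. $H^2_{\bf ball}$ is the Hilbert space of free holomorphic functions $f=\sum_\alpha a_\alpha X_\alpha$ on $[B(\mathcal H)^n]_1$ with $\|f\|_2^2:=\sum_\alpha|a_\alpha|^2<\infty$; $C_\varphi f:=f\circ\varphi$ is a bounded operator on $H^2_{\bf ball}$; $\sigma$ and $\sigma_p$ denote spectrum and point spectrum. $H^2_{\bf ball}$ is identified with the full Fock space $F^2(H_n)=\mathbb C1\oplus\bigoplus_{k\ge1}H_n^{\otimes k}$ ($H_n$ with orthonormal basis $e_1,\ldots,e_n$) via $\sum a_\alpha X_\alpha\mapsto\sum a_\alpha e_\alpha$, $e_\alpha=e_{i_1}\otimes\cdots\otimes e_{i_k}$; thus $\langle\psi_i,e_j\rangle$ is the coefficient of $X_j$ in $\psi_i$. $\mathbb B_n$ is the open Euclidean unit ball of $\mathbb C^n$; identifying $\lambda\in\mathbb B_n$ with $(\lambda_1I,\ldots,\lambda_nI)$, the scalar representation of $\varphi$ is $\mathbb B_n\ni\lambda\mapsto\varphi(\lambda)\in\mathbb B_n$. For $\lambda=(\lambda_1,\ldots,\lambda_n)\in\mathbb B_n$ (a row), $\Phi_\lambda(X):=\lambda-\Delta_\lambda\big(I-\sum_{i=1}^n\overline\lambda_iX_i\big)^{-1}[X_1,\ldots,X_n]\Delta_{\lambda^*}$,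 where $\Delta_\lambda=(1-\|\lambda\|_2^2)^{1/2}$ and $\Delta_{\lambda^*}=(I_{\mathbb C^n}-\lambda^*\lambda)^{1/2}\in M_{n\times n}(\mathbb C)$; it is an involutive free holomorphic automorphism of $[B(\mathcal H)^n]_1$ with $\Phi_\lambda(0)=\lambda$, $\Phi_\lambda(\lambda)=0$. Products of eigenvalues are finite nonempty products of not necessarily distinct eigenvalues. *)

theory Defs
  imports "HOL-Analysis.Analysis"
begin

class scaleC =
  fixes scaleC :: "complex \<Rightarrow> 'a \<Rightarrow> 'a"  (infixr "*\<^sub>C" 75)

class complex_vector = real_vector + scaleC +
  assumes scaleC_add_right: "c *\<^sub>C (x + y) = c *\<^sub>C x + c *\<^sub>C y"
    and scaleC_add_left: "(c + d) *\<^sub>C x = c *\<^sub>C x + d *\<^sub>C x"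
    and scaleC_scaleC: "c *\<^sub>C d *\<^sub>C x = (c * d) *\<^sub>C x"
    and scaleR_conv_scaleC: "r *\<^sub>R x = complex_of_real r *\<^sub>C x"

text \<open>The norm and the metric come from \<^class>\<open>real_inner\<close>; the last axiom says that they
  are those of the complex inner product, which is linear in its first argument.\<close>

class complex_hilbert_space = complex_vector + real_inner + complete_space +
  fixes cinner :: "'a \<Rightarrow> 'a \<Rightarrow> complex"
  assumes cinner_commute: "cinner x y = cnj (cinner y x)"
    and cinner_add_left: "cinner (x + y) z = cinner x z + cinner y z"
    and cinner_scaleC_left: "cinner (c *\<^sub>C x) y = c * cinner x y"
    and inner_conv_cinner: "inner x y = Re (cinner x y)"

lemma norm_scaleC: "norm (c *\<^sub>C x) = cmod c * norm (x :: 'h::complex_hilbert_space)"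
proof -
  have r: "Im (cinner x x) = 0"
    using cinner_commute[of x x] by (metis Reals_cnj_iff complex_is_Real_iff)
  have "cinner (c *\<^sub>C x) (c *\<^sub>C x) = c * cnj c * cinner x x"
    by (metis cinner_scaleC_left cinner_commute complex_cnj_mult mult.assoc)
  then have "inner (c *\<^sub>C x) (c *\<^sub>C x) = (cmod c)\<^sup>2 * inner x x"
    using r by (simp add: inner_conv_cinner complex_norm_square[symmetric] del: of_real_power)
  then show ?thesis
    by (simp add: norm_eq_sqrt_inner real_sqrt_mult)
qed

lemma scaleC_scaleR_commute: "c *\<^sub>C r *\<^sub>R x = r *\<^sub>R c *\<^sub>C (x :: 'a::complex_vector)"
  by (simp add: scaleR_conv_scaleC scaleC_scaleC mult.commute)

lemma bounded_linear_scaleC: "bounded_linear (\<lambda>x. c *\<^sub>C (x :: 'h::complex_hilbert_space))"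
  by (rule bounded_linear_intro[where K = "cmod c"])
    (simp_all add: scaleC_add_right scaleC_scaleR_commute norm_scaleC mult.commute)

text \<open>\<open>'h bounded_op\<close> is $B(\mathcal H)$: the complex linear elements of the space of bounded
  real linear operators, with the operator norm and with composition as product.\<close>

typedef (overloaded) ('h::complex_hilbert_space) bounded_op =
  "{T :: 'h \<Rightarrow>\<^sub>L 'h. \<forall>c x. blinfun_apply T (c *\<^sub>C x) = c *\<^sub>C blinfun_apply T x}"
  morphisms blinfun_of_op op_of_blinfun
proof (intro exI CollectI allI)
  fix c :: complex and x :: 'h
  show "blinfun_apply id_blinfun (c *\<^sub>C x) = c *\<^sub>C blinfun_apply id_blinfun x" by simp
qed

setup_lifting type_definition_bounded_op

definition op_apply :: "'h::complex_hilbert_space bounded_op \<Rightarrow> 'h \<Rightarrow> 'h"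
  where "op_apply T = blinfun_apply (blinfun_of_op T)"

lemma scaleC_zero_right: "c *\<^sub>C (0 :: 'a::complex_vector) = 0"
  using scaleC_add_right[of c "0 :: 'a" 0] by simp

lemma scaleC_minus_right: "c *\<^sub>C (- x) = - (c *\<^sub>C (x :: 'a::complex_vector))"
  by (metis add.right_inverse add_eq_0_iff2 scaleC_add_right scaleC_zero_right)

lemma scaleC_diff_right: "c *\<^sub>C (x - y) = c *\<^sub>C x - c *\<^sub>C (y :: 'a::complex_vector)"
  using scaleC_add_right[of c x "- y"] by (simp add: scaleC_minus_right)

instantiation bounded_op :: (complex_hilbert_space)
  "{complex_vector, real_normed_algebra, monoid_mult}"
begin

lift_definition zero_bounded_op :: "'a bounded_op" is "0"
  by (simp add: scaleC_zero_right)

lift_definition one_bounded_op :: "'a bounded_op" is "id_blinfun"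
  by simp

lift_definition plus_bounded_op :: "'a bounded_op \<Rightarrow> 'a bounded_op \<Rightarrow> 'a bounded_op" is "(+)"
  by (simp add: blinfun.add_left scaleC_add_right)

lift_definition minus_bounded_op :: "'a bounded_op \<Rightarrow> 'a bounded_op \<Rightarrow> 'a bounded_op" is "(-)"
  by (simp add: blinfun.diff_left scaleC_diff_right)

lift_definition uminus_bounded_op :: "'a bounded_op \<Rightarrow> 'a bounded_op" is "uminus"
  by (simp add: blinfun.minus_left scaleC_minus_right)

lift_definition times_bounded_op :: "'a bounded_op \<Rightarrow> 'a bounded_op \<Rightarrow> 'a bounded_op"
  is "(o\<^sub>L)"
  by simp

lift_definition scaleR_bounded_op :: "real \<Rightarrow> 'a bounded_op \<Rightarrow> 'a bounded_op" is "(*\<^sub>R)"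
  by (simp add: blinfun.scaleR_left scaleC_scaleR_commute)

lift_definition scaleC_bounded_op :: "complex \<Rightarrow> 'a bounded_op \<Rightarrow> 'a bounded_op"
  is "\<lambda>c T. blinfun_compose (Blinfun (\<lambda>x. c *\<^sub>C x)) T"
  by (simp add: bounded_linear_Blinfun_apply[OF bounded_linear_scaleC] scaleC_scaleC mult.commute)

lift_definition norm_bounded_op :: "'a bounded_op \<Rightarrow> real" is "norm" .

definition dist_bounded_op :: "'a bounded_op \<Rightarrow> 'a bounded_op \<Rightarrow> real"
  where "dist_bounded_op S T = norm (S - T)"

definition sgn_bounded_op :: "'a bounded_op \<Rightarrow> 'a bounded_op"
  where "sgn_bounded_op T = inverse (norm T) *\<^sub>R T"

definition uniformity_bounded_op :: "('a bounded_op \<times> 'a bounded_op) filter"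
  where "uniformity_bounded_op =
    (INF e\<in>{0<..}. principal {(S :: 'a bounded_op, T). dist S T < e})"

definition open_bounded_op :: "'a bounded_op set \<Rightarrow> bool"
  where "open_bounded_op U =
    (\<forall>S\<in>U. eventually (\<lambda>(S', T). S' = S \<longrightarrow> T \<in> U) uniformity)"

instance
proof
  fix S T R :: "'a bounded_op" and a b :: real and c d :: complex
  note bl = bounded_linear_Blinfun_apply[OF bounded_linear_scaleC]
  show "S + T + R = S + (T + R)" "S + T = T + S" "0 + S = S" "- S + S = 0" "S - T = S + - T"
    by (transfer, simp)+
  show "a *\<^sub>R (S + T) = a *\<^sub>R S + a *\<^sub>R T" "(a + b) *\<^sub>R S = a *\<^sub>R S + b *\<^sub>R S"
    "a *\<^sub>R b *\<^sub>R S = (a * b) *\<^sub>R S" "1 *\<^sub>R S = S"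
    by (transfer, simp add: scaleR_add_right scaleR_add_left)+
  show "c *\<^sub>C (S + T) = c *\<^sub>C S + c *\<^sub>C T" "(c + d) *\<^sub>C S = c *\<^sub>C S + d *\<^sub>C S"
    "c *\<^sub>C d *\<^sub>C S = (c * d) *\<^sub>C S" "a *\<^sub>R S = complex_of_real a *\<^sub>C S"
    by (transfer, rule blinfun_eqI,
        simp add: blinfun.add_left blinfun.add_right blinfun.scaleR_left bl
          scaleC_add_right scaleC_add_left scaleC_scaleC scaleR_conv_scaleC)+
  show "S * T * R = S * (T * R)" "1 * S = S" "S * 1 = S"
    "(S + T) * R = S * R + T * R" "S * (T + R) = S * T + S * R"
    "a *\<^sub>R S * T = a *\<^sub>R (S * T)" "S * a *\<^sub>R T = a *\<^sub>R (S * T)"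
    by (transfer, rule blinfun_eqI,
        simp add: blinfun.add_left blinfun.add_right blinfun.scaleR_left blinfun.scaleR_right)+
  show "dist S T = norm (S - T)" by (rule dist_bounded_op_def)
  show "sgn S = inverse (norm S) *\<^sub>R S" by (rule sgn_bounded_op_def)
  show "uniformity = (INF e\<in>{0<..}. principal {(S :: 'a bounded_op, T). dist S T < e})"
    by (rule uniformity_bounded_op_def)
  show "open U = (\<forall>S\<in>U. eventually (\<lambda>(S', T). S' = S \<longrightarrow> T \<in> U) uniformity)"
    for U :: "'a bounded_op set"
    by (rule open_bounded_op_def)
  show "(norm S = 0) = (S = 0)" by transfer simp
  show "norm (S + T) \<le> norm S + norm T" by transfer (rule norm_triangle_ineq)
  show "norm (a *\<^sub>R S) = \<bar>a\<bar> * norm S" by transfer simp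
  show "norm (S * T) \<le> norm S * norm T" by transfer (rule norm_blinfun_compose)
qed

end

lemma op_apply_simps:
  "op_apply 0 x = 0" "op_apply 1 x = x"
  "op_apply (S + T) x = op_apply S x + op_apply T x"
  "op_apply (S - T) x = op_apply S x - op_apply T x"
  "op_apply (S * T) x = op_apply S (op_apply T x)"
  "op_apply (c *\<^sub>C T) x = c *\<^sub>C op_apply T x"
  unfolding op_apply_def
  by (transfer, simp add: blinfun.add_left blinfun.diff_left
        bounded_linear_Blinfun_apply[OF bounded_linear_scaleC])+

lemma norm_op_eq_onorm: "norm T = onorm (op_apply T)"
  unfolding op_apply_def by transfer (rule norm_blinfun.rep_eq)

definition op_adj :: "'h::complex_hilbert_space bounded_op \<Rightarrow> 'h bounded_op"
  where "op_adj T = (THE S. \<forall>x y. cinner (op_apply T x) y = cinner x (op_apply S y))"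

definition op_inv :: "'h::complex_hilbert_space bounded_op \<Rightarrow> 'h bounded_op"
  where "op_inv T = (THE S. S * T = 1 \<and> T * S = 1)"

text \<open>The index set of the generators is a finite type \<open>'n\<close>, so $n$ is \<open>CARD('n)\<close>, and the free
  semigroup is \<open>'n list\<close> with \<open>[]\<close> as identity.\<close>

definition nc_ball :: "('n::finite \<Rightarrow> 'h::complex_hilbert_space bounded_op) set"
  where "nc_ball = {X. sqrt (norm (\<Sum>i\<in>UNIV. X i * op_adj (X i))) < 1}"

definition word_eval :: "('n \<Rightarrow> 'h::complex_hilbert_space bounded_op) \<Rightarrow> 'n list \<Rightarrow> 'h bounded_op"
  where "word_eval X \<alpha> = prod_list (map X \<alpha>)"

text \<open>Functions on the ball are represented by total functions; their values outside the ball
  are irrelevant here. For \<open>k = 0\<close> the root is \<open>0\<close> by convention, which does not affect the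
  limit superior.\<close>

definition free_expansion ::
    "('n::finite list \<Rightarrow> complex) \<Rightarrow>
     (('n \<Rightarrow> 'h::complex_hilbert_space bounded_op) \<Rightarrow> 'h bounded_op) \<Rightarrow> bool"
  where "free_expansion a f \<longleftrightarrow>
    limsup (\<lambda>k. ereal (root (2 * k) (\<Sum>\<alpha> | length \<alpha> = k. (cmod (a \<alpha>))\<^sup>2))) \<le> 1 \<and>
    (\<forall>X\<in>nc_ball. (\<lambda>k. \<Sum>\<alpha> | length \<alpha> = k. a \<alpha> *\<^sub>C word_eval X \<alpha>) sums f X)"

definition free_holomorphic ::
    "(('n::finite \<Rightarrow> 'h::complex_hilbert_space bounded_op) \<Rightarrow> 'h bounded_op) \<Rightarrow> bool"
  where "free_holomorphic f \<longleftrightarrow> (\<exists>a. free_expansion a f)"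

text \<open>The coefficients of a free holomorphic function; they are unique when the Hilbert space is
  infinite dimensional.\<close>

definition free_coeff ::
    "(('n::finite \<Rightarrow> 'h::complex_hilbert_space bounded_op) \<Rightarrow> 'h bounded_op) \<Rightarrow> 'n list \<Rightarrow> complex"
  where "free_coeff f = (THE a. free_expansion a f)"

definition free_holomorphic_self_map ::
    "(('n::finite \<Rightarrow> 'h::complex_hilbert_space bounded_op) \<Rightarrow> 'n \<Rightarrow> 'h bounded_op) \<Rightarrow> bool"
  where "free_holomorphic_self_map \<phi> \<longleftrightarrow>
    (\<forall>i. free_holomorphic (\<lambda>X. \<phi> X i)) \<and> (\<forall>X\<in>nc_ball. \<phi> X \<in> nc_ball)"

definition scalar_tuple :: "complex ^ 'n \<Rightarrow> 'n \<Rightarrow> 'h::complex_hilbert_space bounded_op"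
  where "scalar_tuple \<xi> = (\<lambda>i. (\<xi> $ i) *\<^sub>C 1)"

text \<open>Elements of the Hardy space are normalized to vanish outside the ball, so that equality of
  elements is equality of functions and the vector space operations are pointwise.\<close>

definition H2_ball ::
    "(('n::finite \<Rightarrow> 'h::complex_hilbert_space bounded_op) \<Rightarrow> 'h bounded_op) set"
  where "H2_ball = {f. free_holomorphic f \<and> (\<forall>X. X \<notin> nc_ball \<longrightarrow> f X = 0) \<and>
    (\<lambda>\<alpha>. (cmod (free_coeff f \<alpha>))\<^sup>2) summable_on UNIV}"

definition H2_norm ::
    "(('n::finite \<Rightarrow> 'h::complex_hilbert_space bounded_op) \<Rightarrow> 'h bounded_op) \<Rightarrow> real"
  where "H2_norm f = sqrt (\<Sum>\<^sub>\<infinity>\<alpha>. (cmod (free_coeff f \<alpha>))\<^sup>2)"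

type_synonym ('n, 'h) H2_operator =
  "(('n \<Rightarrow> 'h bounded_op) \<Rightarrow> 'h bounded_op) \<Rightarrow> (('n \<Rightarrow> 'h bounded_op) \<Rightarrow> 'h bounded_op)"

definition H2_bounded_operator ::
    "('n::finite, 'h::complex_hilbert_space) H2_operator \<Rightarrow> bool"
  where "H2_bounded_operator T \<longleftrightarrow>
    (\<forall>f\<in>H2_ball. T f \<in> H2_ball) \<and>
    (\<forall>f\<in>H2_ball. \<forall>g\<in>H2_ball. T (\<lambda>X. f X + g X) = (\<lambda>X. T f X + T g X)) \<and>
    (\<forall>c. \<forall>f\<in>H2_ball. T (\<lambda>X. c *\<^sub>C f X) = (\<lambda>X. c *\<^sub>C T f X)) \<and>
    (\<exists>K. \<forall>f\<in>H2_ball. H2_norm (T f) \<le> K * H2_norm f)"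

text \<open>For a bounded \<open>T\<close> on the Hardy space: \<open>c\<close> is in the spectrum iff $T - cI$ has no bounded
  two-sided inverse \<open>S\<close>. Only the values of \<open>T\<close> and \<open>S\<close> on the Hardy space matter.\<close>

definition H2_spectrum ::
    "('n::finite, 'h::complex_hilbert_space) H2_operator \<Rightarrow> complex set"
  where "H2_spectrum T = {c. \<not> (\<exists>S. H2_bounded_operator S \<and>
    (\<forall>f\<in>H2_ball. S (\<lambda>X. T f X - c *\<^sub>C f X) = f \<and> (\<lambda>X. T (S f) X - c *\<^sub>C S f X) = f))}"

definition H2_point_spectrum ::
    "('n::finite, 'h::complex_hilbert_space) H2_operator \<Rightarrow> complex set"
  where "H2_point_spectrum T =
    {c. \<exists>f\<in>H2_ball. f \<noteq> (\<lambda>X. 0) \<and> T f = (\<lambda>X. c *\<^sub>C f X)}"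

text \<open>For a self-map \<open>\<phi>\<close> of the ball, the series $\sum_k \sum_{|\alpha|=k} a_\alpha \varphi_\alpha(X)$
  that defines the composition is the expansion of \<open>f\<close> at the point \<open>\<phi> X\<close> of the ball, that
  is \<open>f (\<phi> X)\<close>.\<close>

definition composition_operator ::
    "(('n::finite \<Rightarrow> 'h::complex_hilbert_space bounded_op) \<Rightarrow> 'n \<Rightarrow> 'h bounded_op) \<Rightarrow>
     ('n, 'h) H2_operator"
  where "composition_operator \<phi> f = (\<lambda>X. if X \<in> nc_ball then f (\<phi> X) else 0)"

definition psd_matrix :: "complex ^ 'n ^ 'n \<Rightarrow> bool"
  where "psd_matrix A \<longleftrightarrow> (\<forall>i j. A $ i $ j = cnj (A $ j $ i)) \<and>
    (\<forall>v. 0 \<le> Re (\<Sum>i\<in>UNIV. cnj (v $ i) * (A *v v) $ i))"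

definition psd_sqrt :: "complex ^ 'n ^ 'n \<Rightarrow> complex ^ 'n ^ 'n"
  where "psd_sqrt A = (THE R. psd_matrix R \<and> R ** R = A)"

definition defect :: "complex ^ 'n \<Rightarrow> real"
  where "defect \<xi> = sqrt (1 - (norm \<xi>)\<^sup>2)"

text \<open>Vectors are rows, hence $\lambda^*\lambda$ is the matrix with entries
  $\overline{\lambda_i}\lambda_j$.\<close>

definition defect_adj :: "complex ^ 'n \<Rightarrow> complex ^ 'n ^ 'n"
  where "defect_adj \<xi> = psd_sqrt (mat 1 - (\<chi> i j. cnj (\<xi> $ i) * \<xi> $ j))"

definition ball_automorphism ::
    "complex ^ 'n \<Rightarrow> ('n::finite \<Rightarrow> 'h::complex_hilbert_space bounded_op) \<Rightarrow> 'n \<Rightarrow> 'h bounded_op"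
  where "ball_automorphism \<xi> X = (\<lambda>j. (\<xi> $ j) *\<^sub>C 1 -
    defect \<xi> *\<^sub>R (op_inv (1 - (\<Sum>i\<in>UNIV. cnj (\<xi> $ i) *\<^sub>C X i)) *
      (\<Sum>i\<in>UNIV. (defect_adj \<xi> $ i $ j) *\<^sub>C X i)))"

definition linear_part_matrix ::
    "(('n::finite \<Rightarrow> 'h::complex_hilbert_space bounded_op) \<Rightarrow> 'n \<Rightarrow> 'h bounded_op) \<Rightarrow>
     complex ^ 'n ^ 'n"
  where "linear_part_matrix \<psi> = (\<chi> i j. free_coeff (\<lambda>X. \<psi> X i) [j])"

definition eigenvalues :: "complex ^ 'n ^ 'n \<Rightarrow> complex set"
  where "eigenvalues A = {c. \<exists>v. v \<noteq> 0 \<and> A *v v = c *s v}"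

definition eigenvalue_products :: "complex ^ 'n ^ 'n \<Rightarrow> complex set"
  where "eigenvalue_products A = {prod_list cs | cs. cs \<noteq> [] \<and> set cs \<subseteq> eigenvalues A}"

end

theory Submission
  imports Defs "HOL-Computational_Algebra.Fundamental_Theorem_Algebra"
begin

text \<open>Conjugating by the automorphism $\Phi_\xi$ moves the fixed point to \<open>0\<close>: if
  $f \circ \varphi - c f = g$, then $h = f \circ \Phi_\xi$ satisfies
  $h \circ \psi - c h = g \circ \Phi_\xi$, where $\psi(0) = 0$. The lowest homogeneous part of
  $h \circ \psi$ is that of \<open>h\<close> with each variable $X_i$ replaced by the linear part of
  $\psi_i$, so on coefficients of order \<open>m\<close> it acts as the \<open>m\<close>-th tensor power of the matrix
  \<open>A\<close> of linear parts, whose eigenvalues are the products of \<open>m\<close> eigenvalues of \<open>A\<close>. For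
  \<open>g = 0\<close> this gives the first inclusion. For the second take \<open>m\<close> minimal such that \<open>c\<close> is a
  product of \<open>m\<close> eigenvalues; then \<open>h\<close> has no part of order below \<open>m\<close>, and in order \<open>m\<close> the
  equation has no solution for a suitable homogeneous polynomial $g \circ \Phi_\xi$. Coefficients
  are read off by evaluating at truncated creation operators, and a function is free holomorphic
  iff it is a locally uniform limit of free polynomials, which makes the compositions free
  holomorphic.\<close>

subsection \<open>Complex Hilbert spaces\<close>

text \<open>No estimate is available that \<open>\<phi>\<close> sends a smaller closed ball into a
  smaller closed ball, and this shapes the argument. An inner map needs such control to preserve
  approximability; the only inner map ever used is \<open>ball_automorphism \<xi>\<close>, where the
  control is explicit. As outer map it is handled by a Neumann series whose ratio
  \<open>norm \<xi>\<close> is uniform on the ball. The composite of \<open>h\<close> with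
  \<open>\<psi>\<close> is never expanded again: the series of \<open>h\<close> at
  \<open>\<psi> X\<close> is applied to a vector of the truncated model, where only finitely many
  terms survive. The value \<open>c\<close> enters the spectrum because subtracting \<open>c\<close>
  leaves an operator that is not onto. The obstruction is dual: a right eigenvector \<open>w\<close>
  of the tensor power, paired bilinearly with the coefficients of order \<open>m\<close>,
  annihilates what is attained there, so the conjugate of \<open>w\<close> is missed. Minimality of
  \<open>m\<close> matters since parts of \<open>h\<close> below order \<open>m\<close> would reach
  order \<open>m\<close> through the higher coefficients of \<open>\<psi>\<close>. The test
  polynomial, transported back, is no longer a polynomial but is still bounded; hence the lemma that
  bounded functions lie in the Hardy space.\<close>

lemma cinner_scaleC_right: "cinner x (c *\<^sub>C y) = cnj c * cinner x (y :: 'h::complex_hilbert_space)"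
  by (metis cinner_commute cinner_scaleC_left complex_cnj_mult)

lemma cinner_add_right: "cinner x (y + z) = cinner x y + cinner x (z :: 'h::complex_hilbert_space)"
  by (metis cinner_commute cinner_add_left complex_cnj_add)

lemma scaleC_zero_left [simp]: "0 *\<^sub>C x = (0 :: 'a::complex_vector)"
  using scaleC_add_left[of 0 0 x] by simp

lemma scaleC_one [simp]: "1 *\<^sub>C x = (x :: 'a::complex_vector)"
  using scaleR_conv_scaleC[of 1 x] by simp

lemma scaleC_minus_left: "(- c) *\<^sub>C x = - (c *\<^sub>C (x :: 'a::complex_vector))"
  using scaleC_add_left[of "- c" c x] by (simp add: eq_neg_iff_add_eq_0)

lemma scaleC_diff_left: "(c - d) *\<^sub>C x = c *\<^sub>C x - d *\<^sub>C (x :: 'a::complex_vector)"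
  using scaleC_add_left[of c "- d" x] by (simp add: scaleC_minus_left)

lemma scaleC_sum_right: "c *\<^sub>C (\<Sum>i\<in>I. f i) = (\<Sum>i\<in>I. c *\<^sub>C (f i :: 'a::complex_vector))"
  by (induction I rule: infinite_finite_induct) (simp_all add: scaleC_zero_right scaleC_add_right)

lemma scaleC_sum_left: "(\<Sum>i\<in>I. c i) *\<^sub>C x = (\<Sum>i\<in>I. c i *\<^sub>C (x :: 'a::complex_vector))"
  by (induction I rule: infinite_finite_induct) (simp_all add: scaleC_add_left)

lemma cinner_zero_left [simp]: "cinner 0 y = (0 :: complex)" for y :: "'h::complex_hilbert_space"
  using cinner_add_left[of 0 0 y] by simp

lemma cinner_zero_right [simp]: "cinner y 0 = (0 :: complex)" for y :: "'h::complex_hilbert_space"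
  using cinner_add_right[of y 0 0] by simp

lemma cinner_minus_left: "cinner (- x) y = - cinner x (y :: 'h::complex_hilbert_space)"
  using cinner_add_left[of "- x" x y] by (simp add: eq_neg_iff_add_eq_0)

lemma cinner_diff_left: "cinner (x - z) y = cinner x y - cinner z (y :: 'h::complex_hilbert_space)"
  using cinner_add_left[of x "- z" y] by (simp add: cinner_minus_left)

lemma cinner_diff_right: "cinner y (x - z) = cinner y x - cinner y (z :: 'h::complex_hilbert_space)"
  by (metis cinner_commute cinner_diff_left complex_cnj_diff)

lemma cinner_sum_left: "cinner (\<Sum>i\<in>I. f i) y = (\<Sum>i\<in>I. cinner (f i) (y :: 'h::complex_hilbert_space))"
  by (induction I rule: infinite_finite_induct) (simp_all add: cinner_add_left)

lemma cinner_sum_right: "cinner y (\<Sum>i\<in>I. f i) = (\<Sum>i\<in>I. cinner y (f i :: 'h::complex_hilbert_space))"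
  by (induction I rule: infinite_finite_induct) (simp_all add: cinner_add_right)

lemma cinner_self: "cinner x x = complex_of_real ((norm (x :: 'h::complex_hilbert_space))\<^sup>2)"
proof (rule complex_eqI)
  show "Re (cinner x x) = Re (complex_of_real ((norm x)\<^sup>2))"
    by (simp add: inner_conv_cinner[symmetric] power2_norm_eq_inner)
  show "Im (cinner x x) = Im (complex_of_real ((norm x)\<^sup>2))"
    using cinner_commute[of x x] by (metis Im_complex_of_real Reals_cnj_iff complex_is_Real_iff)
qed

text \<open>The real Cauchy-Schwarz inequality applies once \<open>x\<close> is rotated by the
  unimodular \<open>u\<close> that makes the inner product real and nonnegative.\<close>

lemma norm_cinner_le: "cmod (cinner x y) \<le> norm x * norm (y :: 'h::complex_hilbert_space)"
proof (cases "cinner x y = 0")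
  case False
  define u where "u = cnj (cinner x y) / cmod (cinner x y)"
  have u: "cmod u = 1" using False by (simp add: u_def norm_divide)
  have "complex_of_real (cmod (cinner x y)) = u * cinner x y"
    using False complex_norm_square[of "cinner x y"]
    by (simp add: u_def field_simps power2_eq_square)
  then have "cmod (cinner x y) = inner (u *\<^sub>C x) y"
    by (metis Re_complex_of_real cinner_scaleC_left inner_conv_cinner)
  also have "\<dots> \<le> norm (u *\<^sub>C x) * norm y" by (rule norm_cauchy_schwarz)
  finally show ?thesis by (simp add: norm_scaleC u)
qed simp

lemma cinner_ext:
  fixes x y :: "'h::complex_hilbert_space"
  assumes "\<And>z. cinner z x = cinner z y"
  shows "x = y"
proof -
  have "inner (x - y) (x - y) = 0"
    using assms by (simp add: inner_conv_cinner cinner_diff_right)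
  then show ?thesis by simp
qed

subclass (in complex_hilbert_space) banach ..

text \<open>The representing vector minimises $\|x\|^2 - 2 g(x)$; a minimising sequence is Cauchy by
  the parallelogram law.\<close>

lemma riesz_real:
  fixes g :: "'h::{real_inner, complete_space} \<Rightarrow> real"
  assumes g: "bounded_linear g"
  obtains y where "\<And>x. g x = inner x y"
proof -
  interpret g: bounded_linear g by (rule g)
  define Q where "Q = (\<lambda>x. (norm x)\<^sup>2 - 2 * g x)"
  obtain K where K: "\<And>x. norm (g x) \<le> norm x * K" using g.bounded by blast
  have "- K\<^sup>2 \<le> Q x" for x
  proof -
    have "2 * g x \<le> 2 * (norm x * K)" using K[of x] by simp
    moreover have "0 \<le> (norm x - K)\<^sup>2" by simp
    ultimately show ?thesis unfolding Q_def by (simp add: power2_diff algebra_simps)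
  qed
  then have bdd: "bdd_below (range Q)" by (meson bdd_belowI2)
  define q where "q = Inf (range Q)"
  have q: "q \<le> Q x" for x unfolding q_def by (simp add: bdd cInf_lower)
  have "\<exists>x. Q x < q + 1 / Suc n" for n
    using cInf_lessD[of "range Q" "q + 1 / Suc n"] unfolding q_def by auto
  then obtain x where x: "\<And>n. Q (x n) < q + 1 / Suc n" by metis
  have par: "(norm (u - v))\<^sup>2 / 2 = Q u + Q v - 2 * Q ((1/2) *\<^sub>R (u + v))" for u v
  proof -
    have "(norm ((1/2) *\<^sub>R (u + v)))\<^sup>2 = ((norm u)\<^sup>2 + (norm v)\<^sup>2 + 2 * inner u v) / 4"
      unfolding norm_scaleR by (simp add: power_divide dot_norm field_simps)
    moreover have "(norm (u - v))\<^sup>2 = (norm u)\<^sup>2 + (norm v)\<^sup>2 - 2 * inner u v"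
      by (simp add: dot_norm_neg field_simps)
    moreover have "g ((1/2) *\<^sub>R (u + v)) = (g u + g v) / 2" by (simp add: g.scaleR g.add)
    ultimately show ?thesis
      unfolding Q_def by (simp only: add_divide_distrib diff_divide_distrib) simp
  qed
  have dist: "(dist u v)\<^sup>2 \<le> 2 * (Q u + Q v - 2 * q)" for u v
    using par[of u v] q[of "(1/2) *\<^sub>R (u + v)"] by (simp add: dist_norm)
  have "Cauchy x"
  proof (rule metric_CauchyI)
    fix e :: real assume e: "0 < e"
    obtain N :: nat where N: "4 / e\<^sup>2 < real N" using reals_Archimedean2 by blast
    have "dist (x m) (x n) < e" if "m \<ge> N" "n \<ge> N" for m n
    proof -
      have Npos: "0 < real N" using N e by (smt (verit) divide_nonneg_pos zero_less_power)
      have a: "1 / real (Suc k) \<le> 1 / real N" if "k \<ge> N" for k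
        using that Npos by (simp add: frac_le)
      have "(dist (x m) (x n))\<^sup>2 < 4 / N"
        using dist[of "x m" "x n"] x[of m] x[of n] a[OF that(1)] a[OF that(2)] by simp
      also have "\<dots> < e\<^sup>2" using N e Npos by (simp add: field_simps)
      finally show ?thesis using e by (simp add: power_less_imp_less_base)
    qed
    then show "\<exists>M. \<forall>m\<ge>M. \<forall>n\<ge>M. dist (x m) (x n) < e" by blast
  qed
  then obtain y where y: "x \<longlonglongrightarrow> y" using Cauchy_convergent_iff convergent_def by blast
  have "(\<lambda>n. Q (x n)) \<longlonglongrightarrow> Q y"
    unfolding Q_def
    by (intro tendsto_diff tendsto_power tendsto_norm tendsto_mult tendsto_const g.tendsto y)
  moreover have "(\<lambda>n. q + 1 / real (Suc n)) \<longlonglongrightarrow> q + 0"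
    by (intro tendsto_intros LIMSEQ_Suc[OF lim_inverse_n'])
  ultimately have "Q y \<le> q + 0"
    by (rule LIMSEQ_le) (use x less_imp_le in blast)
  then have Qy: "Q y \<le> q" by simp
  have "g z = inner z y" for z
  proof (rule ccontr)
    define d where "d = inner z y - g z"
    assume "g z \<noteq> inner z y"
    then have d: "d \<noteq> 0" by (simp add: d_def)
    have *: "0 \<le> 2 * t * d + t\<^sup>2 * (norm z)\<^sup>2" for t
    proof -
      have "Q y \<le> Q (y + t *\<^sub>R z)" using Qy q order_trans by blast
      then show ?thesis
        unfolding Q_def d_def power2_norm_eq_inner
        by (simp add: g.scaleR g.add inner_add_left inner_add_right inner_commute
            algebra_simps power2_eq_square)
    qed
    \<comment> \<open>The quadratic in \<open>t\<close> is minimal at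
      \<open>- d / (norm z)\<^sup>2\<close>; adding 1 to the denominator admits \<open>z = 0\<close>
      and still gives a negative value.\<close>
    define s where "s = (norm z)\<^sup>2 + 1"
    have s: "s > 0" by (simp add: s_def add_nonneg_pos)
    have "0 \<le> 2 * (- d / s) * d + (- d / s)\<^sup>2 * (norm z)\<^sup>2" by (rule *)
    also have "\<dots> \<le> 2 * (- d / s) * d + (- d / s)\<^sup>2 * s"
      by (intro add_left_mono mult_left_mono) (simp_all add: s_def)
    also have "\<dots> = - d\<^sup>2 / s" using s by (simp add: field_simps power2_eq_square)
    also have "\<dots> < 0" using s d by simp
    finally show False by simp
  qed
  then show thesis by (rule that)
qed

subsection \<open>Bounded operators\<close>

lemma op_apply_scaleC: "op_apply T (c *\<^sub>C x) = c *\<^sub>C op_apply T x"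
  unfolding op_apply_def using blinfun_of_op by auto

lemma bounded_linear_op_apply: "bounded_linear (op_apply T)"
  unfolding op_apply_def by (rule blinfun.bounded_linear_right)

lemmas op_apply_linear = bounded_linear.linear[OF bounded_linear_op_apply]

lemma op_apply_zero [simp]: "op_apply T 0 = 0"
  by (rule linear_0[OF op_apply_linear])

lemma op_apply_sum: "op_apply T (\<Sum>i\<in>I. f i) = (\<Sum>i\<in>I. op_apply T (f i))"
  by (rule linear_sum[OF op_apply_linear])

lemma op_sum_apply: "op_apply (\<Sum>i\<in>I. F i) x = (\<Sum>i\<in>I. op_apply (F i) x)"
  by (induction I rule: infinite_finite_induct) (simp_all add: op_apply_simps)

lemma op_scaleR_apply: "op_apply (r *\<^sub>R T) x = r *\<^sub>R op_apply T x"
  by (simp add: scaleR_conv_scaleC op_apply_simps)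

lemma norm_op_apply_le: "norm (op_apply T x) \<le> norm T * norm x"
  unfolding norm_op_eq_onorm by (rule onorm[OF bounded_linear_op_apply])

lemma norm_op_le: "0 \<le> K \<Longrightarrow> (\<And>x. norm (op_apply T x) \<le> K * norm x) \<Longrightarrow> norm T \<le> K"
  unfolding norm_op_eq_onorm by (rule onorm_bound)

lemma op_eqI: "(\<And>x. op_apply S x = op_apply T x) \<Longrightarrow> S = T"
  unfolding op_apply_def by (metis blinfun_eqI blinfun_of_op_inject)

lemma op_exists:
  fixes f :: "'h::complex_hilbert_space \<Rightarrow> 'h"
  assumes add: "\<And>x y. f (x + y) = f x + f y" and scale: "\<And>c x. f (c *\<^sub>C x) = c *\<^sub>C f x"
    and bound: "\<And>x. norm (f x) \<le> K * norm x"
  obtains T where "\<And>x. op_apply T x = f x"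
proof -
  have f: "bounded_linear f"
    by (rule bounded_linear_intro[where K = K])
      (simp_all add: add scale scaleR_conv_scaleC bound mult.commute)
  have "Blinfun f \<in> {T. \<forall>c x. blinfun_apply T (c *\<^sub>C x) = c *\<^sub>C blinfun_apply T x}"
    by (simp add: bounded_linear_Blinfun_apply[OF f] scale)
  then have "op_apply (op_of_blinfun (Blinfun f)) x = f x" for x
    unfolding op_apply_def by (simp add: op_of_blinfun_inverse bounded_linear_Blinfun_apply[OF f])
  then show thesis by (rule that)
qed

section \<open>Adjoints of bounded operators\<close>

lemma op_adj_exists:
  "\<exists>S. \<forall>x y. cinner (op_apply T x) y = cinner x (op_apply S (y :: 'h::complex_hilbert_space))"
proof -
  have "\<exists>s. \<forall>x. inner (op_apply T x) y = inner x s" for y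
  proof -
    have "bounded_linear (\<lambda>x. inner (op_apply T x) y)"
      by (rule bounded_linear_compose[OF bounded_linear_inner_left bounded_linear_op_apply])
    then show ?thesis by (metis riesz_real)
  qed
  then obtain s where s: "\<And>x y. inner (op_apply T x) y = inner x (s y)" by metis
  have cs: "cinner (op_apply T x) y = cinner x (s y)" for x y
  proof (rule complex_eqI)
    show "Re (cinner (op_apply T x) y) = Re (cinner x (s y))"
      using s[of x y] by (simp add: inner_conv_cinner)
    \<comment> \<open>Riesz yields only real parts; up to sign, the imaginary part is the real part
      at \<open>\<i> *\<^sub>C x\<close>.\<close>
    have "Re (cinner (op_apply T (\<i> *\<^sub>C x)) y) = Re (cinner (\<i> *\<^sub>C x) (s y))"
      using s[of "\<i> *\<^sub>C x" y] by (simp add: inner_conv_cinner)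
    then show "Im (cinner (op_apply T x) y) = Im (cinner x (s y))"
      by (simp add: op_apply_scaleC cinner_scaleC_left)
  qed
  have bound: "norm (s y) \<le> norm T * norm y" for y
  proof (cases "s y = 0")
    case False
    have "(norm (s y))\<^sup>2 = inner (op_apply T (s y)) y" by (simp add: s power2_norm_eq_inner)
    also have "\<dots> \<le> norm (op_apply T (s y)) * norm y" by (rule norm_cauchy_schwarz)
    also have "\<dots> \<le> (norm T * norm (s y)) * norm y"
      by (intro mult_right_mono norm_op_apply_le) simp
    finally show ?thesis using False by (simp add: power2_eq_square mult.assoc mult.left_commute)
  qed simp
  have "s (x + y) = s x + s y" for x y
    by (rule cinner_ext) (simp add: cs[symmetric] cinner_add_right)
  moreover have "s (c *\<^sub>C x) = c *\<^sub>C s x" for c x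
    by (rule cinner_ext) (simp add: cs[symmetric] cinner_scaleC_right)
  ultimately obtain S where "\<And>y. op_apply S y = s y"
    using op_exists[of s "norm T"] bound by blast
  then show ?thesis using cs by metis
qed

lemma op_adj: "cinner (op_apply T x) y = cinner x (op_apply (op_adj T) y)"
proof -
  have "\<exists>!S. \<forall>x y. cinner (op_apply T x) y = cinner x (op_apply S y)"
    using op_adj_exists[of T] by (metis cinner_ext op_eqI)
  then show ?thesis unfolding op_adj_def by (rule the1I2) blast
qed

lemma op_adj_eqI:
  assumes "\<And>x y. cinner (op_apply T x) y = cinner x (op_apply S y)"
  shows "op_adj T = S"
  using assms by (metis cinner_ext op_eqI op_adj)

lemma op_adj_mult: "op_adj (S * T) = op_adj T * op_adj S"
  by (rule op_adj_eqI) (simp add: op_apply_simps op_adj)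

lemma op_adj_add: "op_adj (S + T) = op_adj S + op_adj T"
  by (rule op_adj_eqI) (simp add: op_apply_simps op_adj cinner_add_left cinner_add_right)

lemma op_adj_diff: "op_adj (S - T) = op_adj S - op_adj T"
  by (rule op_adj_eqI) (simp add: op_apply_simps op_adj cinner_diff_left cinner_diff_right)

lemma op_adj_scaleC: "op_adj (c *\<^sub>C T) = cnj c *\<^sub>C op_adj T"
  by (rule op_adj_eqI) (simp add: op_apply_simps op_adj cinner_scaleC_left cinner_scaleC_right)

lemma op_adj_one [simp]: "op_adj 1 = 1"
  by (rule op_adj_eqI) (simp add: op_apply_simps)

lemma op_adj_zero [simp]: "op_adj 0 = 0"
  by (rule op_adj_eqI) (simp add: op_apply_simps)

lemma op_adj_sum: "op_adj (\<Sum>i\<in>I. F i) = (\<Sum>i\<in>I. op_adj (F i))"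
  by (induction I rule: infinite_finite_induct) (simp_all add: op_adj_add)

lemma op_mult_scaleC_left: "(c *\<^sub>C S) * T = c *\<^sub>C (S * (T :: 'h::complex_hilbert_space bounded_op))"
  by (rule op_eqI) (simp add: op_apply_simps)

lemma op_mult_scaleC_right: "S * (c *\<^sub>C T) = c *\<^sub>C (S * (T :: 'h::complex_hilbert_space bounded_op))"
  by (rule op_eqI) (simp add: op_apply_simps op_apply_scaleC)

section \<open>Norm estimates, completeness and the Neumann series\<close>

lemma norm_op_one_le: "norm (1 :: 'h::complex_hilbert_space bounded_op) \<le> 1"
  by (rule norm_op_le) (simp_all add: op_apply_simps)

lemma norm_op_power_le: "norm (T ^ k) \<le> norm (T :: 'h::complex_hilbert_space bounded_op) ^ k"
proof (induction k)
  case (Suc k)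
  have "norm (T ^ Suc k) \<le> norm T * norm (T ^ k)" by (simp add: norm_mult_ineq)
  also have "\<dots> \<le> norm T * norm T ^ k" by (intro mult_left_mono Suc) simp
  finally show ?case by simp
qed (simp add: norm_op_one_le)

text \<open>Row contractions are controlled through adjoints, so bounds arrive on that side. They
  transfer because the squared norm of \<open>T x\<close> is the inner product of \<open>x\<close>
  with the adjoint applied to \<open>T x\<close>.\<close>

lemma norm_op_le_adj:
  assumes K: "0 \<le> K" and "\<And>x. norm (op_apply (op_adj T) x) \<le> K * norm x"
  shows "norm T \<le> K"
proof (rule norm_op_le[OF K])
  fix x
  let ?y = "op_apply T x"
  show "norm ?y \<le> K * norm x"
  proof (cases "?y = 0")
    case True
    then show ?thesis using K by simp
  next
    case False
    have "(norm ?y)\<^sup>2 = cmod (cinner ?y ?y)" by (simp add: cinner_self norm_power)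
    also have "\<dots> \<le> norm x * norm (op_apply (op_adj T) ?y)"
      unfolding op_adj by (rule norm_cinner_le)
    also have "\<dots> \<le> norm x * (K * norm ?y)" by (intro mult_left_mono assms(2)) simp
    finally show ?thesis using False by (simp add: power2_eq_square mult.commute mult.left_commute)
  qed
qed

text \<open>The limit exists among bounded real linear operators, and complex linearity survives
  pointwise limits.\<close>

instance bounded_op :: (complex_hilbert_space) banach
proof
  fix F :: "nat \<Rightarrow> 'a bounded_op"
  assume F: "Cauchy F"
  have n: "norm (blinfun_of_op S - blinfun_of_op T) = norm (S - T)" for S T :: "'a bounded_op"
    by transfer simp
  have "Cauchy (\<lambda>k. blinfun_of_op (F k))"
    using F unfolding Cauchy_def dist_norm n .
  then obtain L where L: "(\<lambda>k. blinfun_of_op (F k)) \<longlonglongrightarrow> L"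
    using Cauchy_convergent_iff convergent_def by blast
  have ptw: "(\<lambda>k. op_apply (F k) x) \<longlonglongrightarrow> blinfun_apply L x" for x
    unfolding op_apply_def by (intro tendsto_intros L)
  have "blinfun_apply L (c *\<^sub>C x) = c *\<^sub>C blinfun_apply L x" for c x
  proof (rule LIMSEQ_unique)
    show "(\<lambda>k. op_apply (F k) (c *\<^sub>C x)) \<longlonglongrightarrow> blinfun_apply L (c *\<^sub>C x)" by (rule ptw)
    show "(\<lambda>k. op_apply (F k) (c *\<^sub>C x)) \<longlonglongrightarrow> c *\<^sub>C blinfun_apply L x"
      unfolding op_apply_scaleC
      by (rule bounded_linear.tendsto[OF bounded_linear_scaleC ptw])
  qed
  then have "blinfun_of_op (op_of_blinfun L) = L" by (simp add: op_of_blinfun_inverse)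
  then have "F \<longlonglongrightarrow> op_of_blinfun L"
    using L by (simp add: LIMSEQ_def dist_norm n[symmetric])
  then show "convergent F" by (rule convergentI)
qed

text \<open>The tail estimate depends on \<open>q\<close> alone, so it is uniform over all
  \<open>Z\<close> with that bound; this is what makes resolvents approximable.\<close>

lemma neumann:
  fixes Z :: "'h::complex_hilbert_space bounded_op"
  assumes Z: "norm Z \<le> q" and q: "q < 1"
  shows "op_inv (1 - Z) * (1 - Z) = 1" and "(1 - Z) * op_inv (1 - Z) = 1"
    and "norm (op_inv (1 - Z) - (\<Sum>k<K. Z ^ k)) \<le> q ^ K / (1 - q)"
proof -
  have q0: "0 \<le> q" using Z norm_ge_zero order_trans by blast
  have le: "norm (Z ^ k) \<le> q ^ k" for k
    using norm_op_power_le[of Z k] power_mono[OF Z, of k] by simp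
  have summ: "summable (\<lambda>k. Z ^ k)"
    by (rule summable_comparison_test'[of "\<lambda>k. q ^ k" 0]) (use q0 q le in auto)
  define V where "V = (\<Sum>k. Z ^ k)"
  have lim: "(\<lambda>N. \<Sum>k<N. Z ^ k) \<longlonglongrightarrow> V" unfolding V_def by (rule summable_LIMSEQ[OF summ])
  have Z0: "(\<lambda>N. Z ^ N) \<longlonglongrightarrow> 0" by (rule summable_LIMSEQ_zero[OF summ])
  have tele: "(1 - Z) * (\<Sum>k<N. Z ^ k) = 1 - Z ^ N" for N
    by (induction N) (simp_all add: distrib_left left_diff_distrib)
  have tele': "(\<Sum>k<N. Z ^ k) * (1 - Z) = 1 - Z ^ N" for N
  proof (induction N)
    case (Suc N)
    have "(\<Sum>k<Suc N. Z ^ k) * (1 - Z) = (\<Sum>k<N. Z ^ k) * (1 - Z) + (Z ^ N - Z ^ N * Z)"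
      by (simp add: distrib_right right_diff_distrib)
    then show ?case unfolding Suc by (simp add: power_commutes)
  qed simp
  have "(\<lambda>N. 1 - Z ^ N) \<longlonglongrightarrow> 1 - 0" by (intro tendsto_intros Z0)
  then have V1: "(1 - Z) * V = 1" "V * (1 - Z) = 1"
    using tendsto_mult_left[OF lim, of "1 - Z"] tendsto_mult_right[OF lim, of "1 - Z"]
    unfolding tele tele' by (auto intro: LIMSEQ_unique)
  have "op_inv (1 - Z) = V"
    unfolding op_inv_def
  proof (rule the_equality)
    fix S assume "S * (1 - Z) = 1 \<and> (1 - Z) * S = 1"
    then show "S = V" using V1 by (metis mult.assoc mult_1_left mult_1_right)
  qed (use V1 in simp)
  then show "op_inv (1 - Z) * (1 - Z) = 1" "(1 - Z) * op_inv (1 - Z) = 1"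
    using V1 by simp_all
  have "V - (\<Sum>k<K. Z ^ k) = (\<Sum>k. Z ^ (k + K))"
    unfolding V_def using suminf_minus_initial_segment[OF summ, of K] by simp
  also have "norm \<dots> \<le> (\<Sum>k. q ^ (k + K))"
    by (rule norm_suminf_le) (use le q0 q in \<open>auto intro: summable_ignore_initial_segment\<close>)
  also have "\<dots> = q ^ K / (1 - q)"
    using q0 q by (simp add: power_add suminf_mult2[symmetric] suminf_geometric)
  finally show "norm (op_inv (1 - Z) - (\<Sum>k<K. Z ^ k)) \<le> q ^ K / (1 - q)"
    using \<open>op_inv (1 - Z) = V\<close> by simp
qed

lemma op_inv_eqI:
  assumes "S * T = 1" "T * S = 1"
  shows "op_inv T = S"
  unfolding op_inv_def
  by (rule the_equality) (use assms in \<open>auto, metis mult.assoc mult_1_left mult_1_right\<close>)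

subsection \<open>Closed balls\<close>

lemma finite_words [simp]: "finite {\<alpha> :: 'n::finite list. length \<alpha> = k}"
  using finite_lists_length_eq[of "UNIV :: 'n set" k] by simp

lemma finite_words_le [simp]: "finite {\<alpha> :: 'n::finite list. length \<alpha> \<le> k}"
  using finite_lists_length_le[of "UNIV :: 'n set" k] by simp

lemma sum_words_Suc:
  "(\<Sum>\<alpha> | length \<alpha> = Suc k. f \<alpha>) = (\<Sum>i\<in>UNIV. \<Sum>\<alpha> | length \<alpha> = k. f (i # \<alpha>))"
  for f :: "'n::finite list \<Rightarrow> 'a::comm_monoid_add"
proof -
  have "(\<Sum>\<alpha> | length \<alpha> = Suc k. f \<alpha>) = (\<Sum>(i, \<alpha>)\<in>UNIV \<times> {\<alpha>. length \<alpha> = k}. f (i # \<alpha>))"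
    by (rule sum.reindex_bij_witness[of _ "\<lambda>(i, \<alpha>). i # \<alpha>" "\<lambda>\<alpha>. (hd \<alpha>, tl \<alpha>)"])
      (auto simp: length_Suc_conv)
  then show ?thesis by (simp add: sum.cartesian_product)
qed

lemma sum_words_le:
  "(\<Sum>\<alpha> | length \<alpha> \<le> m. f \<alpha>) = (\<Sum>k\<le>m. \<Sum>\<alpha> | length \<alpha> = k. f \<alpha>)"
  for f :: "'n::finite list \<Rightarrow> 'a::comm_monoid_add"
proof (induction m)
  case (Suc m)
  have "{\<alpha> :: 'n list. length \<alpha> \<le> Suc m} = {\<alpha>. length \<alpha> \<le> m} \<union> {\<alpha>. length \<alpha> = Suc m}" by auto
  then show ?case using Suc by (simp add: sum.union_disjoint disjoint_iff)
qed simp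

lemma Cauchy_Schwarz_sum:
  "(\<Sum>i\<in>I. a i * b i) \<le> sqrt (\<Sum>i\<in>I. (a i)\<^sup>2) * sqrt (\<Sum>i\<in>I. (b i :: real)\<^sup>2)"
proof -
  have "(\<Sum>i\<in>I. a i * b i) \<le> sqrt ((\<Sum>i\<in>I. a i * b i)\<^sup>2)" by simp
  also have "\<dots> \<le> sqrt ((\<Sum>i\<in>I. (a i)\<^sup>2) * (\<Sum>i\<in>I. (b i)\<^sup>2))"
    by (intro real_sqrt_le_mono Cauchy_Schwarz_ineq_sum)
  finally show ?thesis by (simp add: real_sqrt_mult)
qed

lemma sums_op_apply:
  assumes "F sums T"
  shows "(\<lambda>k. op_apply (F k) x) sums op_apply T x"
proof -
  have "bounded_linear (\<lambda>T. op_apply T x)"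
    by (rule bounded_linear_intro[where K = "norm x"])
      (simp_all add: op_apply_simps op_scaleR_apply norm_op_apply_le)
  then show ?thesis using assms by (rule bounded_linear.sums)
qed

text \<open>For \<open>0 \<le> r\<close> this says that the column of adjoints, hence the row with
  entries \<open>X i\<close>, has norm at most \<open>r\<close>. Tested on vectors, the condition
  iterates letter by letter.\<close>

definition nc_cball :: "real \<Rightarrow> ('n::finite \<Rightarrow> 'h::complex_hilbert_space bounded_op) set"
  where "nc_cball r =
    {X. \<forall>h. (\<Sum>i\<in>UNIV. (norm (op_apply (op_adj (X i)) h))\<^sup>2) \<le> r\<^sup>2 * (norm h)\<^sup>2}"

lemma row_apply_cinner:
  "cinner (op_apply (\<Sum>i\<in>UNIV. X i * op_adj (X i)) h) g =
    (\<Sum>i\<in>UNIV. cinner (op_apply (op_adj (X i)) h) (op_apply (op_adj (X i)) g))"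
  by (simp add: op_sum_apply op_apply_simps cinner_sum_left op_adj)

text \<open>The form \<open>cinner (op_apply T h) g\<close> is a sum of inner products of adjoint
  images. Cauchy-Schwarz at \<open>g = op_apply T h\<close> turns the bound on the quadratic form
  into a bound on the norm of \<open>T\<close>.\<close>

lemma nc_cball_subset_nc_ball:
  assumes r: "r < 1" and X: "X \<in> nc_cball r" and r0: "0 \<le> r"
  shows "X \<in> nc_ball"
proof -
  define T where "T = (\<Sum>i\<in>UNIV. X i * op_adj (X i))"
  have X': "sqrt (\<Sum>i\<in>UNIV. (norm (op_apply (op_adj (X i)) h))\<^sup>2) \<le> r * norm h" for h
    using X r0 by (intro real_le_lsqrt) (auto simp: nc_cball_def power_mult_distrib)
  have "norm T \<le> r\<^sup>2"
  proof (rule norm_op_le)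
    fix h
    let ?g = "op_apply T h"
    have "(norm ?g)\<^sup>2 = cmod (cinner (op_apply T h) ?g)" by (simp add: cinner_self norm_power)
    also have "\<dots> \<le> (\<Sum>i\<in>UNIV. cmod (cinner (op_apply (op_adj (X i)) h) (op_apply (op_adj (X i)) ?g)))"
      unfolding T_def row_apply_cinner by (rule norm_sum)
    also have "\<dots> \<le> (\<Sum>i\<in>UNIV. norm (op_apply (op_adj (X i)) h) * norm (op_apply (op_adj (X i)) ?g))"
      by (intro sum_mono norm_cinner_le)
    also have "\<dots> \<le> sqrt (\<Sum>i\<in>UNIV. (norm (op_apply (op_adj (X i)) h))\<^sup>2) *
        sqrt (\<Sum>i\<in>UNIV. (norm (op_apply (op_adj (X i)) ?g))\<^sup>2)"
      by (rule Cauchy_Schwarz_sum)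
    also have "\<dots> \<le> (r * norm h) * (r * norm ?g)"
      by (intro mult_mono X') (auto simp: r0 intro: sum_nonneg)
    finally have "norm ?g * norm ?g \<le> (r\<^sup>2 * norm h) * norm ?g"
      by (simp add: power2_eq_square mult_ac)
    then show "norm ?g \<le> r\<^sup>2 * norm h"
      by (cases "norm ?g = 0") (use r0 in \<open>auto simp: mult_le_cancel_right\<close>)
  qed simp
  then have "sqrt (norm T) \<le> r" using r0 by (simp add: real_le_lsqrt)
  then have "sqrt (norm T) < 1" using r by linarith
  then show ?thesis unfolding nc_ball_def T_def by simp
qed

lemma nc_ball_imp_nc_cball:
  assumes "X \<in> nc_ball"
  obtains r where "0 \<le> r" "r < 1" "X \<in> nc_cball r"
proof -
  define T where "T = (\<Sum>i\<in>UNIV. X i * op_adj (X i))"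
  have "X \<in> nc_cball (sqrt (norm T))"
    unfolding nc_cball_def
  proof (intro CollectI allI)
    fix h
    have "complex_of_real (\<Sum>i\<in>UNIV. (norm (op_apply (op_adj (X i)) h))\<^sup>2) = cinner (op_apply T h) h"
      unfolding T_def row_apply_cinner by (simp add: cinner_self)
    then have "(\<Sum>i\<in>UNIV. (norm (op_apply (op_adj (X i)) h))\<^sup>2) \<le> cmod (cinner (op_apply T h) h)"
      by (metis abs_ge_self norm_of_real)
    also have "\<dots> \<le> norm (op_apply T h) * norm h" by (rule norm_cinner_le)
    also have "\<dots> \<le> (norm T * norm h) * norm h" by (intro mult_right_mono norm_op_apply_le) simp
    finally show "(\<Sum>i\<in>UNIV. (norm (op_apply (op_adj (X i)) h))\<^sup>2) \<le> (sqrt (norm T))\<^sup>2 * (norm h)\<^sup>2"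
      by (simp add: power2_eq_square mult_ac)
  qed
  moreover have "sqrt (norm T) < 1" using assms by (simp add: nc_ball_def T_def)
  ultimately show thesis using that[of "sqrt (norm T)"] by simp
qed

lemma word_eval_simps [simp]:
  "word_eval X [] = 1" "word_eval X (i # \<alpha>) = X i * word_eval X \<alpha>"
  by (simp_all add: word_eval_def)

lemma word_eval_append: "word_eval X (\<alpha> @ \<beta>) = word_eval X \<alpha> * word_eval X \<beta>"
  by (simp add: word_eval_def)

text \<open>Adjoints reverse products, so the first letter acts first on \<open>h\<close>; the
  induction hypothesis is used at the image of \<open>h\<close> under the adjoint of that letter and
  must therefore hold for every vector.\<close>

lemma sum_word_eval_adj_le:
  assumes X: "X \<in> nc_cball r"
  shows "(\<Sum>\<alpha> | length \<alpha> = k. (norm (op_apply (op_adj (word_eval X \<alpha>)) h))\<^sup>2) \<le> r ^ (2 * k) * (norm h)\<^sup>2"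
proof (induction k arbitrary: h)
  case (Suc k)
  have "(\<Sum>\<alpha> | length \<alpha> = Suc k. (norm (op_apply (op_adj (word_eval X \<alpha>)) h))\<^sup>2) =
      (\<Sum>i\<in>UNIV. \<Sum>\<alpha> | length \<alpha> = k. (norm (op_apply (op_adj (word_eval X \<alpha>)) (op_apply (op_adj (X i)) h)))\<^sup>2)"
    by (simp add: sum_words_Suc op_adj_mult op_apply_simps)
  also have "\<dots> \<le> (\<Sum>i\<in>UNIV. r ^ (2 * k) * (norm (op_apply (op_adj (X i)) h))\<^sup>2)"
    by (intro sum_mono Suc)
  also have "\<dots> = r ^ (2 * k) * (\<Sum>i\<in>UNIV. (norm (op_apply (op_adj (X i)) h))\<^sup>2)"
    by (simp add: sum_distrib_left)
  also have "\<dots> \<le> r ^ (2 * k) * (r\<^sup>2 * (norm h)\<^sup>2)"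
    using X by (intro mult_left_mono) (auto simp: nc_cball_def)
  finally show ?case by (simp add: power2_eq_square mult_ac)
qed (simp add: op_apply_simps)

definition homog :: "('n::finite list \<Rightarrow> complex) \<Rightarrow> nat \<Rightarrow>
    ('n \<Rightarrow> 'h::complex_hilbert_space bounded_op) \<Rightarrow> 'h bounded_op"
  where "homog a k X = (\<Sum>\<alpha> | length \<alpha> = k. a \<alpha> *\<^sub>C word_eval X \<alpha>)"

lemma homog_add: "homog (\<lambda>\<alpha>. a \<alpha> + b \<alpha>) k X = homog a k X + homog b k X"
  by (simp add: homog_def scaleC_add_left sum.distrib)

lemma homog_diff: "homog (\<lambda>\<alpha>. a \<alpha> - b \<alpha>) k X = homog a k X - homog b k X"
  by (simp add: homog_def scaleC_diff_left sum_subtractf)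

text \<open>The words of length \<open>k\<close> in a row contraction again form a row contraction.\<close>

lemma norm_homog_le:
  assumes X: "X \<in> nc_cball r" and r: "0 \<le> r"
  shows "norm (homog a k X) \<le> sqrt (\<Sum>\<alpha> | length \<alpha> = k. (cmod (a \<alpha>))\<^sup>2) * r ^ k"
proof (rule norm_op_le)
  let ?A = "sqrt (\<Sum>\<alpha> | length \<alpha> = k. (cmod (a \<alpha>))\<^sup>2)"
  show "0 \<le> ?A * r ^ k" using r by (simp add: sum_nonneg)
  fix x
  let ?y = "op_apply (homog a k X) x"
  have "(norm ?y)\<^sup>2 = cmod (cinner ?y ?y)" by (simp add: cinner_self norm_power)
  also have "cinner ?y ?y = (\<Sum>\<alpha> | length \<alpha> = k. a \<alpha> * cinner x (op_apply (op_adj (word_eval X \<alpha>)) ?y))"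
    by (simp add: homog_def op_sum_apply op_apply_simps cinner_sum_left cinner_scaleC_left op_adj)
  also have "cmod \<dots> \<le> (\<Sum>\<alpha> | length \<alpha> = k. cmod (a \<alpha>) * (norm x * norm (op_apply (op_adj (word_eval X \<alpha>)) ?y)))"
    by (rule sum_norm_le) (simp add: norm_mult mult_left_mono norm_cinner_le)
  also have "\<dots> = norm x * (\<Sum>\<alpha> | length \<alpha> = k. cmod (a \<alpha>) * norm (op_apply (op_adj (word_eval X \<alpha>)) ?y))"
    by (simp add: sum_distrib_left mult_ac)
  also have "\<dots> \<le> norm x * (?A * sqrt (\<Sum>\<alpha> | length \<alpha> = k. (norm (op_apply (op_adj (word_eval X \<alpha>)) ?y))\<^sup>2))"
    by (intro mult_left_mono Cauchy_Schwarz_sum) simp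
  also have "\<dots> \<le> norm x * (?A * sqrt (r ^ (2 * k) * (norm ?y)\<^sup>2))"
    by (intro mult_left_mono real_sqrt_le_mono sum_word_eval_adj_le X) (auto intro: sum_nonneg)
  also have "sqrt (r ^ (2 * k) * (norm ?y)\<^sup>2) = r ^ k * norm ?y"
    using r by (simp add: real_sqrt_mult power_mult[of r 2 k, unfolded mult.commute[of 2 k]] power_mult mult.commute[of 2 k])
  finally have "norm ?y * norm ?y \<le> (?A * r ^ k * norm x) * norm ?y"
    by (simp add: power2_eq_square mult_ac)
  moreover have "0 \<le> ?A * r ^ k * norm x" using r by (simp add: sum_nonneg)
  ultimately show "norm ?y \<le> ?A * r ^ k * norm x"
    by (cases "norm ?y = 0") (auto simp: mult_le_cancel_right)
qed

subsection \<open>Truncated creation operators\<close>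

definition infinite_dim :: "'h::complex_hilbert_space itself \<Rightarrow> bool"
  where "infinite_dim _ \<longleftrightarrow>
    \<not> (\<exists>B :: 'h set. finite B \<and> (\<forall>x. \<exists>c. x = (\<Sum>b\<in>B. c b *\<^sub>C b)))"

text \<open>One Gram-Schmidt step at a time: infinite dimension supplies a vector outside the span
  of those already chosen. Finite families suffice because the Fock space will be truncated.\<close>

lemma orthonormal_family_exists:
  assumes inf: "infinite_dim TYPE('h::complex_hilbert_space)"
  shows "\<exists>e :: nat \<Rightarrow> 'h. \<forall>i<N. \<forall>j<N. cinner (e i) (e j) = (if i = j then 1 else 0)"
proof (induction N)
  case (Suc N)
  then obtain e :: "nat \<Rightarrow> 'h"
    where e: "\<And>i j. i < N \<Longrightarrow> j < N \<Longrightarrow> cinner (e i) (e j) = (if i = j then 1 else 0)" by blast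
  have inj: "inj_on e {..<N}"
    by (rule inj_onI) (metis e lessThan_iff zero_neq_one)
  have "finite (e ` {..<N})" by simp
  with inf have "\<not> (\<forall>x. \<exists>c. x = (\<Sum>b\<in>e ` {..<N}. c b *\<^sub>C b))"
    unfolding infinite_dim_def by blast
  then obtain x where x: "\<And>c. x \<noteq> (\<Sum>b\<in>e ` {..<N}. c b *\<^sub>C b)" by blast
  define y where "y = x - (\<Sum>i<N. cinner x (e i) *\<^sub>C e i)"
  have "y \<noteq> 0"
  proof
    assume "y = 0"
    then have "x = (\<Sum>b\<in>e ` {..<N}. cinner x b *\<^sub>C b)"
      by (simp add: y_def sum.reindex[OF inj])
    then show False using x by blast
  qed
  define z where "z = complex_of_real (1 / norm y) *\<^sub>C y"
  have ye: "cinner y (e j) = 0" if "j < N" for j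
  proof -
    have "(\<Sum>i<N. cinner x (e i) * cinner (e i) (e j)) = (\<Sum>i<N. if i = j then cinner x (e j) else 0)"
      by (rule sum.cong) (use that in \<open>auto simp: e\<close>)
    then show ?thesis
      using that by (simp add: y_def cinner_diff_left cinner_sum_left cinner_scaleC_left)
  qed
  have zz: "cinner z z = 1"
    using \<open>y \<noteq> 0\<close> by (simp add: z_def cinner_self norm_scaleC norm_divide)
  have ze: "cinner z (e j) = 0" "cinner (e j) z = 0" if "j < N" for j
    using ye[OF that] cinner_commute[of "e j" y]
    by (simp_all add: z_def cinner_scaleC_left cinner_scaleC_right)
  have "\<forall>i<Suc N. \<forall>j<Suc N. cinner ((e(N := z)) i) ((e(N := z)) j) = (if i = j then 1 else 0)"
    using e ze zz by (auto simp: less_Suc_eq)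
  then show ?case by blast
qed simp

lemma norm_sum_orthonormal:
  fixes e :: "'i \<Rightarrow> 'h::complex_hilbert_space"
  assumes I: "finite I" and e: "\<And>i j. i \<in> I \<Longrightarrow> j \<in> I \<Longrightarrow> cinner (e i) (e j) = (if i = j then 1 else 0)"
  shows "(norm (\<Sum>i\<in>I. u i *\<^sub>C e i))\<^sup>2 = (\<Sum>i\<in>I. (cmod (u i))\<^sup>2)"
proof -
  have "complex_of_real ((norm (\<Sum>i\<in>I. u i *\<^sub>C e i))\<^sup>2) = (\<Sum>i\<in>I. \<Sum>j\<in>I. u i * (cnj (u j) * cinner (e i) (e j)))"
    unfolding cinner_self[symmetric]
    by (subst cinner_sum_left)
      (simp add: cinner_sum_right cinner_scaleC_left cinner_scaleC_right sum_distrib_left mult.left_commute)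
  also have "\<dots> = (\<Sum>i\<in>I. \<Sum>j\<in>I. if j = i then u i * cnj (u i) else 0)"
    by (intro sum.cong) (auto simp: e)
  also have "\<dots> = complex_of_real (\<Sum>i\<in>I. (cmod (u i))\<^sup>2)"
    using I by (simp add: complex_norm_square[symmetric] del: of_real_power)
  finally show ?thesis using of_real_eq_iff by blast
qed

lemma bessel:
  fixes e :: "'i \<Rightarrow> 'h::complex_hilbert_space"
  assumes I: "finite I" and e: "\<And>i j. i \<in> I \<Longrightarrow> j \<in> I \<Longrightarrow> cinner (e i) (e j) = (if i = j then 1 else 0)"
  shows "(\<Sum>i\<in>I. (cmod (cinner x (e i)))\<^sup>2) \<le> (norm x)\<^sup>2"
proof -
  define p where "p = (\<Sum>i\<in>I. cinner x (e i) *\<^sub>C e i)"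
  define s where "s = (\<Sum>i\<in>I. (cmod (cinner x (e i)))\<^sup>2)"
  have pp: "(norm p)\<^sup>2 = s" unfolding p_def s_def by (rule norm_sum_orthonormal[OF I e])
  have "cinner x p = (\<Sum>i\<in>I. cnj (cinner x (e i)) * cinner x (e i))"
    by (simp add: p_def cinner_sum_right cinner_scaleC_right)
  also have "\<dots> = complex_of_real s"
    unfolding s_def of_real_sum by (intro sum.cong refl) (metis complex_norm_square mult.commute)
  finally have "inner x p = s" by (simp add: inner_conv_cinner)
  moreover have "0 \<le> (norm (x - p))\<^sup>2" by simp
  ultimately have "0 \<le> (norm x)\<^sup>2 + s - 2 * s"
    using pp by (simp add: power2_norm_eq_inner inner_diff_left inner_diff_right inner_commute)
  then show ?thesis by (simp add: s_def)
qed

text \<open>The operators \<open>X i\<close> are \<open>r\<close> times the left creation operators of the Fock space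
  truncated at level \<open>m\<close>, and \<open>g \<alpha>\<close> is \<open>r ^ length \<alpha>\<close> times the basis vector of \<open>\<alpha>\<close>.\<close>

definition fock_model :: "nat \<Rightarrow> real \<Rightarrow> ('n::finite \<Rightarrow> 'h::complex_hilbert_space bounded_op) \<Rightarrow>
    ('n list \<Rightarrow> 'h) \<Rightarrow> bool"
  where "fock_model m r X g \<longleftrightarrow> X \<in> nc_cball r \<and> (\<forall>i \<alpha>. op_apply (X i) (g \<alpha>) = g (i # \<alpha>)) \<and>
    (\<forall>\<alpha>. m < length \<alpha> \<longrightarrow> g \<alpha> = 0) \<and>
    (\<forall>u. (norm (\<Sum>\<alpha> | length \<alpha> \<le> m. u \<alpha> *\<^sub>C g \<alpha>))\<^sup>2 = (\<Sum>\<alpha> | length \<alpha> \<le> m. (cmod (u \<alpha>))\<^sup>2 * r ^ (2 * length \<alpha>)))"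

lemma fock_model_exists:
  assumes inf: "infinite_dim TYPE('h::complex_hilbert_space)"
    and r: "0 \<le> r"
  obtains X :: "'n::finite \<Rightarrow> 'h::complex_hilbert_space bounded_op" and g where "fock_model m r X g"
proof -
  define W where "W = {\<alpha> :: 'n list. length \<alpha> \<le> m}"
  have W: "finite W" by (simp add: W_def)
  obtain n :: "'n list \<Rightarrow> nat" where n: "bij_betw n W {..<card W}"
    using ex_bij_betw_finite_nat[OF W] by (auto simp: atLeast0LessThan)
  obtain e' :: "nat \<Rightarrow> 'h" where e': "\<forall>i<card W. \<forall>j<card W. cinner (e' i) (e' j) = (if i = j then 1 else 0)"
    using orthonormal_family_exists[OF inf] by blast
  define e where "e = (\<lambda>\<alpha>. e' (n \<alpha>))"
  have e: "cinner (e \<alpha>) (e \<beta>) = (if \<alpha> = \<beta> then 1 else 0)" if "\<alpha> \<in> W" "\<beta> \<in> W" for \<alpha> \<beta>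
  proof -
    have "n \<alpha> < card W" "n \<beta> < card W" "n \<alpha> = n \<beta> \<longleftrightarrow> \<alpha> = \<beta>"
      using n that by (auto simp: bij_betw_def inj_on_def)
    then show ?thesis using e' by (simp add: e_def)
  qed
  \<comment> \<open>Only words shorter than \<open>m\<close> can be prefixed by a letter inside the
    truncation; the shift kills the top level.\<close>
  define V where "V = {\<alpha> :: 'n list. length \<alpha> < m}"
  have V: "finite V" "V \<subseteq> W" unfolding V_def W_def
    by (rule finite_subset[OF _ finite_words_le[of m]]) auto
  have eV: "cinner (e \<alpha>) (e \<beta>) = (if \<alpha> = \<beta> then 1 else 0)" if "\<alpha> \<in> V" "\<beta> \<in> V" for \<alpha> \<beta>
    using e[of \<alpha> \<beta>] that V(2) by blast
  have VW: "i # \<alpha> \<in> W" if "\<alpha> \<in> V" for i \<alpha> using that by (auto simp: V_def W_def)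
  define s where "s = (\<lambda>i x. \<Sum>\<alpha>\<in>V. (complex_of_real r * cinner x (e \<alpha>)) *\<^sub>C e (i # \<alpha>))"
  have "\<exists>T. \<forall>x. op_apply T x = s i x" for i
  proof -
    have "norm (s i x) \<le> r * norm x" for x
    proof -
      have "(norm (s i x))\<^sup>2 = (\<Sum>\<alpha>\<in>V. (cmod (complex_of_real r * cinner x (e \<alpha>)))\<^sup>2)"
        unfolding s_def by (rule norm_sum_orthonormal[OF V(1)]) (simp add: e VW)
      also have "\<dots> = r\<^sup>2 * (\<Sum>\<alpha>\<in>V. (cmod (cinner x (e \<alpha>)))\<^sup>2)"
        by (simp add: norm_mult power_mult_distrib sum_distrib_left)
      also have "\<dots> \<le> r\<^sup>2 * (norm x)\<^sup>2"
        by (intro mult_left_mono bessel V) (simp_all add: eV)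
      finally show ?thesis using r by (simp add: power_mult_distrib[symmetric] power_mono_iff)
    qed
    moreover have "s i (x + y) = s i x + s i y" for x y
      by (simp add: s_def cinner_add_left distrib_left scaleC_add_left sum.distrib)
    moreover have "s i (c *\<^sub>C x) = c *\<^sub>C s i x" for c x
      by (simp add: s_def cinner_scaleC_left scaleC_sum_right scaleC_scaleC mult_ac)
    ultimately show ?thesis using op_exists[of "s i" r] by metis
  qed
  then obtain X where X: "\<And>i x. op_apply (X i) x = s i x" by metis
  define t where "t = (\<lambda>i y. \<Sum>\<alpha>\<in>V. (complex_of_real r * cinner y (e (i # \<alpha>))) *\<^sub>C e \<alpha>)"
  have adj: "op_apply (op_adj (X i)) y = t i y" for i y
  proof (rule cinner_ext)
    fix x
    have "cinner x (op_apply (op_adj (X i)) y) = cinner (s i x) y" by (simp add: op_adj[symmetric] X)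
    also have "\<dots> = cinner x (t i y)"
      unfolding s_def t_def cinner_sum_left cinner_sum_right cinner_scaleC_left cinner_scaleC_right
    proof (intro sum.cong refl)
      fix \<alpha>
      show "complex_of_real r * cinner x (e \<alpha>) * cinner (e (i # \<alpha>)) y =
          cnj (complex_of_real r * cinner y (e (i # \<alpha>))) * cinner x (e \<alpha>)"
        using cinner_commute[of "e (i # \<alpha>)" y] by simp
    qed
    finally show "cinner x (op_apply (op_adj (X i)) y) = cinner x (t i y)" .
  qed
  have "X \<in> nc_cball r"
    unfolding nc_cball_def
  proof (intro CollectI allI)
    fix h
    have "(norm (t i h))\<^sup>2 = r\<^sup>2 * (\<Sum>\<alpha>\<in>V. (cmod (cinner h (e (i # \<alpha>))))\<^sup>2)" for i
    proof -
      have "(norm (t i h))\<^sup>2 = (\<Sum>\<alpha>\<in>V. (cmod (complex_of_real r * cinner h (e (i # \<alpha>))))\<^sup>2)"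
        unfolding t_def by (rule norm_sum_orthonormal[OF V(1)]) (simp add: eV)
      then show ?thesis by (simp add: norm_mult power_mult_distrib sum_distrib_left)
    qed
    then have "(\<Sum>i\<in>UNIV. (norm (op_apply (op_adj (X i)) h))\<^sup>2) =
        r\<^sup>2 * (\<Sum>i\<in>UNIV. \<Sum>\<alpha>\<in>V. (cmod (cinner h (e (i # \<alpha>))))\<^sup>2)"
      by (simp add: adj sum_distrib_left)
    also have "(\<Sum>i\<in>UNIV. \<Sum>\<alpha>\<in>V. (cmod (cinner h (e (i # \<alpha>))))\<^sup>2) =
        (\<Sum>(i, \<alpha>)\<in>UNIV \<times> V. (cmod (cinner h (e (i # \<alpha>))))\<^sup>2)"
      by (simp add: sum.cartesian_product)
    \<comment> \<open>A pair \<open>(i, \<alpha>)\<close> is determined by the word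
      \<open>i # \<alpha>\<close>, so these basis vectors are orthonormal over all letters at once
      and Bessel bounds the whole row, not just each entry.\<close>
    also have "\<dots> \<le> (norm h)\<^sup>2"
      using bessel[of "UNIV \<times> V" "\<lambda>(i, \<alpha>). e (i # \<alpha>)" h] V(1) VW
      by (auto simp: e case_prod_unfold)
    finally show "(\<Sum>i\<in>UNIV. (norm (op_apply (op_adj (X i)) h))\<^sup>2) \<le> r\<^sup>2 * (norm h)\<^sup>2"
      by (simp add: mult_left_mono)
  qed
  \<comment> \<open>The weight \<open>r ^ length \<alpha>\<close> absorbs the factor
    \<open>r\<close> of each operator, so that on the family \<open>g\<close> every letter acts as
    an exact shift.\<close>
  moreover define g where "g = (\<lambda>\<alpha>. if \<alpha> \<in> W then complex_of_real (r ^ length \<alpha>) *\<^sub>C e \<alpha> else 0)"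
  have "op_apply (X i) (g \<alpha>) = g (i # \<alpha>)" for i \<alpha>
  proof (cases "\<alpha> \<in> W")
    case True
    have "(\<Sum>\<beta>\<in>V. (complex_of_real r * cinner (g \<alpha>) (e \<beta>)) *\<^sub>C e (i # \<beta>)) =
        (\<Sum>\<beta>\<in>V. if \<beta> = \<alpha> then complex_of_real (r ^ length (i # \<alpha>)) *\<^sub>C e (i # \<alpha>) else 0)"
      by (rule sum.cong) (use True V in \<open>auto simp: g_def cinner_scaleC_left e\<close>)
    then show ?thesis
      using V VW True by (auto simp: X s_def g_def V_def W_def)
  next
    case False
    then show ?thesis by (simp add: g_def W_def)
  qed
  moreover have "\<forall>\<alpha>. m < length \<alpha> \<longrightarrow> g \<alpha> = 0" by (simp add: g_def W_def)
  moreover have "(norm (\<Sum>\<alpha> | length \<alpha> \<le> m. u \<alpha> *\<^sub>C g \<alpha>))\<^sup>2 =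
      (\<Sum>\<alpha> | length \<alpha> \<le> m. (cmod (u \<alpha>))\<^sup>2 * r ^ (2 * length \<alpha>))" for u
  proof -
    have "(\<Sum>\<alpha> | length \<alpha> \<le> m. u \<alpha> *\<^sub>C g \<alpha>) = (\<Sum>\<alpha>\<in>W. (u \<alpha> * complex_of_real (r ^ length \<alpha>)) *\<^sub>C e \<alpha>)"
      unfolding W_def[symmetric] by (rule sum.cong) (auto simp: g_def scaleC_scaleC)
    also have "(norm \<dots>)\<^sup>2 = (\<Sum>\<alpha>\<in>W. (cmod (u \<alpha> * complex_of_real (r ^ length \<alpha>)))\<^sup>2)"
      by (rule norm_sum_orthonormal[OF W e])
    also have "\<dots> = (\<Sum>\<alpha>\<in>W. (cmod (u \<alpha>))\<^sup>2 * r ^ (2 * length \<alpha>))"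
      by (rule sum.cong) (simp_all add: norm_mult norm_power power_mult_distrib power_mult[symmetric] mult.commute r)
    finally show ?thesis by (simp only: W_def)
  qed
  ultimately have "fock_model m r X g" unfolding fock_model_def by blast
  then show thesis by (rule that)
qed

lemma fock_model_unique:
  assumes g: "fock_model m r X g" and r: "0 < r"
    and eq: "(\<Sum>\<alpha> | length \<alpha> \<le> m. u \<alpha> *\<^sub>C g \<alpha>) = (\<Sum>\<alpha> | length \<alpha> \<le> m. v \<alpha> *\<^sub>C g \<alpha>)"
    and \<alpha>: "length \<alpha> \<le> m"
  shows "u \<alpha> = v \<alpha>"
proof -
  have "(\<Sum>\<alpha> | length \<alpha> \<le> m. (u \<alpha> - v \<alpha>) *\<^sub>C g \<alpha>) = 0"
    using eq by (simp add: scaleC_diff_left sum_subtractf)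
  then have "(\<Sum>\<alpha> | length \<alpha> \<le> m. (cmod (u \<alpha> - v \<alpha>))\<^sup>2 * r ^ (2 * length \<alpha>)) = 0"
    using g unfolding fock_model_def by (metis norm_zero power_zero_numeral)
  then have "\<forall>\<alpha>\<in>{\<alpha>. length \<alpha> \<le> m}. (cmod (u \<alpha> - v \<alpha>))\<^sup>2 * r ^ (2 * length \<alpha>) = 0"
    by (subst (asm) sum_nonneg_eq_0_iff) (use r in auto)
  then show ?thesis using \<alpha> r by simp
qed

lemma fock_model_word_eval:
  "fock_model m r X g \<Longrightarrow> op_apply (word_eval X \<alpha>) (g \<beta>) = g (\<alpha> @ \<beta>)"
  by (induction \<alpha>) (simp_all add: op_apply_simps fock_model_def)

text \<open>The series stops at order \<open>m\<close> because \<open>g\<close> vanishes on longer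
  words. At \<open>\<beta> = []\<close> the image lists all coefficients up to order
  \<open>m\<close>.\<close>

lemma fock_model_sums:
  assumes g: "fock_model m r X g" and F: "(\<lambda>k. homog a k X) sums T"
  shows "op_apply T (g \<beta>) = (\<Sum>\<alpha> | length \<alpha> \<le> m. a \<alpha> *\<^sub>C g (\<alpha> @ \<beta>))"
proof -
  have h: "op_apply (homog a k X) (g \<beta>) = (\<Sum>\<alpha> | length \<alpha> = k. a \<alpha> *\<^sub>C g (\<alpha> @ \<beta>))" for k
    by (simp add: homog_def op_sum_apply op_apply_simps fock_model_word_eval[OF g])
  from sums_op_apply[OF F, of "g \<beta>"]
  have "(\<lambda>k. \<Sum>\<alpha> | length \<alpha> = k. a \<alpha> *\<^sub>C g (\<alpha> @ \<beta>)) sums op_apply T (g \<beta>)" by (simp add: h)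
  moreover have "(\<lambda>k. \<Sum>\<alpha> | length \<alpha> = k. a \<alpha> *\<^sub>C g (\<alpha> @ \<beta>)) sums
      (\<Sum>k\<le>m. \<Sum>\<alpha> | length \<alpha> = k. a \<alpha> *\<^sub>C g (\<alpha> @ \<beta>))"
    by (rule sums_finite) (use g in \<open>auto simp: fock_model_def scaleC_zero_right\<close>)
  ultimately show ?thesis using sums_unique2 by (simp add: sum_words_le)
qed

text \<open>A Cauchy estimate in square-summable form: in the model, \<open>F X\<close> maps the
  unit vector \<open>g []\<close> to a vector whose squared norm is exactly the left-hand
  side.\<close>

lemma coeff_bound:
  fixes F :: "('n::finite \<Rightarrow> 'h::complex_hilbert_space bounded_op) \<Rightarrow> 'h bounded_op"
  assumes inf: "infinite_dim TYPE('h::complex_hilbert_space)"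
    and r: "0 \<le> r"
    and F: "\<And>X. X \<in> nc_cball r \<Longrightarrow> (\<lambda>k. homog a k X) sums F X"
    and M: "\<And>X. X \<in> nc_cball r \<Longrightarrow> norm (F X) \<le> M"
  shows "(\<Sum>\<alpha> | length \<alpha> \<le> m. (cmod (a \<alpha>))\<^sup>2 * r ^ (2 * length \<alpha>)) \<le> M\<^sup>2"
proof -
  obtain X :: "'n \<Rightarrow> 'h bounded_op" and g where g: "fock_model m r X g"
    using fock_model_exists[OF inf r] .
  have X: "X \<in> nc_cball r" using g by (simp add: fock_model_def)
  have nrm: "(norm (\<Sum>\<alpha> | length \<alpha> \<le> m. u \<alpha> *\<^sub>C g \<alpha>))\<^sup>2 =
      (\<Sum>\<alpha> | length \<alpha> \<le> m. (cmod (u \<alpha>))\<^sup>2 * r ^ (2 * length \<alpha>))" for u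
    using g by (simp add: fock_model_def)
  have "(\<Sum>\<alpha> | length \<alpha> \<le> m. (if \<alpha> = [] then 1 else 0) *\<^sub>C g \<alpha>) = g []"
    by (simp add: if_distrib[of "\<lambda>c. c *\<^sub>C _"] cong: if_cong)
  then have "(norm (g []))\<^sup>2 = (\<Sum>\<alpha> :: 'n list | length \<alpha> \<le> m. if \<alpha> = [] then 1 else 0)"
    using nrm[of "\<lambda>\<alpha>. if \<alpha> = [] then 1 else 0"] by (simp add: if_distrib[of "\<lambda>c. c * _"] if_distrib[of cmod] if_distrib[of "\<lambda>c. c\<^sup>2"] cong: if_cong)
  then have "norm (g []) = 1" by (simp add: power2_eq_1_iff) (smt (verit) norm_ge_zero)
  then have "(norm (op_apply (F X) (g [])))\<^sup>2 \<le> M\<^sup>2"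
    using norm_op_apply_le[of "F X" "g []"] M[OF X] by (intro power_mono) auto
  then show ?thesis using fock_model_sums[OF g F[OF X], of "[]"] nrm[of a] by simp
qed

subsection \<open>Free holomorphic functions as locally uniform limits of free polynomials\<close>

inductive_set free_poly :: "(('n::finite \<Rightarrow> 'h::complex_hilbert_space bounded_op) \<Rightarrow> 'h bounded_op) set"
  where
    monomial: "(\<lambda>X. c *\<^sub>C word_eval X \<alpha>) \<in> free_poly"
  | add: "P \<in> free_poly \<Longrightarrow> Q \<in> free_poly \<Longrightarrow> (\<lambda>X. P X + Q X) \<in> free_poly"

lemma free_poly_zero: "(\<lambda>X. 0) \<in> free_poly"
  using free_poly.monomial[of 0 "[]"] by simp

lemma free_poly_const: "(\<lambda>X. c *\<^sub>C 1) \<in> free_poly"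
  using free_poly.monomial[of c "[]"] by simp

lemma free_poly_coord: "(\<lambda>X. X i) \<in> free_poly"
  using free_poly.monomial[of 1 "[i]"] by simp

lemma free_poly_sum: "(\<And>i. i \<in> I \<Longrightarrow> P i \<in> free_poly) \<Longrightarrow> (\<lambda>X. \<Sum>i\<in>I. P i X) \<in> free_poly"
  by (induction I rule: infinite_finite_induct) (simp_all add: free_poly_zero free_poly.add)

lemma free_poly_homog: "homog a k \<in> free_poly"
  unfolding homog_def [abs_def] by (intro free_poly_sum free_poly.monomial)

lemma free_poly_mult:
  assumes "P \<in> free_poly" "Q \<in> free_poly"
  shows "(\<lambda>X. P X * Q X) \<in> free_poly"
  using assms(1)
proof induction
  case (monomial c \<alpha>)
  show ?case
    using assms(2)
  proof induction
    case (monomial d \<beta>)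
    show ?case
      using free_poly.monomial[of "c * d" "\<alpha> @ \<beta>"]
      by (simp add: word_eval_append op_mult_scaleC_left op_mult_scaleC_right scaleC_scaleC mult.commute)
  qed (simp add: distrib_left free_poly.add)
qed (simp add: distrib_right free_poly.add)

lemma free_poly_expand:
  assumes "P \<in> free_poly"
  shows "\<exists>a N. \<forall>K\<ge>N. \<forall>X. P X = (\<Sum>k<K. homog a k X)"
  using assms
proof induction
  case (monomial c \<alpha>)
  define a where "a = (\<lambda>\<beta>. if \<beta> = \<alpha> then c else 0)"
  have "homog a k X = (if k = length \<alpha> then c *\<^sub>C word_eval X \<alpha> else 0)" for k and X :: "'a \<Rightarrow> 'b bounded_op"
    by (auto simp: homog_def a_def if_distrib[of "\<lambda>c. c *\<^sub>C _"] cong: if_cong)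
  then have "c *\<^sub>C word_eval X \<alpha> = (\<Sum>k<K. homog a k X)" if "K \<ge> Suc (length \<alpha>)"
    for K and X :: "'a \<Rightarrow> 'b bounded_op"
    using that by simp
  then show ?case by blast
next
  case (add P Q)
  then obtain a N b M where a: "\<And>K X. K \<ge> N \<Longrightarrow> P X = (\<Sum>k<K. homog a k X)"
    and b: "\<And>K X. K \<ge> M \<Longrightarrow> Q X = (\<Sum>k<K. homog b k X)" by metis
  have "P X + Q X = (\<Sum>k<K. homog (\<lambda>\<alpha>. a \<alpha> + b \<alpha>) k X)" if "K \<ge> max N M" for K X
    using a[of K X] b[of K X] that by (simp add: homog_add sum.distrib)
  then show ?case by blast
qed

lemma nc_cball_mono:
  assumes "0 \<le> r" "r \<le> s"
  shows "nc_cball r \<subseteq> nc_cball s"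
  unfolding nc_cball_def
proof safe
  fix X :: "'a \<Rightarrow> 'b bounded_op" and h
  assume "\<forall>h. (\<Sum>i\<in>UNIV. (norm (op_apply (op_adj (X i)) h))\<^sup>2) \<le> r\<^sup>2 * (norm h)\<^sup>2"
  then have "(\<Sum>i\<in>UNIV. (norm (op_apply (op_adj (X i)) h))\<^sup>2) \<le> r\<^sup>2 * (norm h)\<^sup>2" by blast
  also have "\<dots> \<le> s\<^sup>2 * (norm h)\<^sup>2" using assms by (intro mult_right_mono power_mono) auto
  finally show "(\<Sum>i\<in>UNIV. (norm (op_apply (op_adj (X i)) h))\<^sup>2) \<le> s\<^sup>2 * (norm h)\<^sup>2" .
qed

lemma free_poly_bounded:
  assumes "P \<in> free_poly"
  shows "\<exists>M\<ge>0. \<forall>X\<in>nc_ball. norm (P X) \<le> M"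
  using assms
proof induction
  case (monomial c \<alpha>)
  have "norm (c *\<^sub>C word_eval X \<alpha>) \<le> cmod c" if X: "X \<in> nc_ball" for X :: "'a \<Rightarrow> 'b bounded_op"
  proof -
    obtain r where r: "0 \<le> r" "r < 1" "X \<in> nc_cball r" using nc_ball_imp_nc_cball[OF X] .
    define a where "a = (\<lambda>\<beta>. if \<beta> = \<alpha> then c else 0)"
    have "homog a (length \<alpha>) X = c *\<^sub>C word_eval X \<alpha>"
      by (auto simp: homog_def a_def if_distrib[of "\<lambda>c. c *\<^sub>C _"] cong: if_cong)
    moreover have "(\<Sum>\<beta> | length \<beta> = length \<alpha>. (cmod (a \<beta>))\<^sup>2) = (cmod c)\<^sup>2"
      by (auto simp: a_def if_distrib[of cmod] if_distrib[of "\<lambda>c. c\<^sup>2"] cong: if_cong)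
    ultimately have "norm (c *\<^sub>C word_eval X \<alpha>) \<le> cmod c * r ^ length \<alpha>"
      using norm_homog_le[OF r(3,1), of a "length \<alpha>"] by simp
    also have "\<dots> \<le> cmod c" using r by (simp add: mult_left_le power_le_one)
    finally show ?thesis .
  qed
  then show ?case by (metis norm_ge_zero)
next
  case (add P Q)
  then obtain M N where "M \<ge> 0" "N \<ge> 0" "\<forall>X\<in>nc_ball. norm (P X) \<le> M" "\<forall>X\<in>nc_ball. norm (Q X) \<le> N"
    by blast
  then show ?case
    by (intro exI[of _ "M + N"]) (auto intro: order_trans[OF norm_triangle_ineq] add_mono)
qed

section \<open>Closure properties of locally uniform limits of free polynomials\<close>

definition approximable ::
    "(('n::finite \<Rightarrow> 'h::complex_hilbert_space bounded_op) \<Rightarrow> 'h bounded_op) \<Rightarrow> bool"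
  where "approximable F \<longleftrightarrow>
    (\<forall>r e. 0 \<le> r \<longrightarrow> r < 1 \<longrightarrow> 0 < e \<longrightarrow> (\<exists>P\<in>free_poly. \<forall>X\<in>nc_cball r. norm (F X - P X) \<le> e))"

lemma approximableD:
  assumes "approximable F" "0 \<le> r" "r < 1" "0 < e"
  obtains P where "P \<in> free_poly" "\<And>X. X \<in> nc_cball r \<Longrightarrow> norm (F X - P X) \<le> e"
  using assms unfolding approximable_def by blast

lemma approximable_limit:
  assumes "\<And>r e. 0 \<le> r \<Longrightarrow> r < 1 \<Longrightarrow> 0 < e \<Longrightarrow>
    \<exists>G. approximable G \<and> (\<forall>X\<in>nc_cball r. norm (F X - G X) \<le> e)"
  shows "approximable F"
  unfolding approximable_def
proof (intro allI impI)
  fix r e :: real assume r: "0 \<le> r" "r < 1" and e: "0 < e"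
  obtain G where G: "approximable G" "\<forall>X\<in>nc_cball r. norm (F X - G X) \<le> e / 2"
    using assms[of r "e / 2"] r e by auto
  obtain P where P: "P \<in> free_poly" "\<And>X. X \<in> nc_cball r \<Longrightarrow> norm (G X - P X) \<le> e / 2"
    using approximableD[OF G(1) r, of "e / 2"] e by auto
  have "norm (F X - P X) \<le> e" if "X \<in> nc_cball r" for X
    using norm_triangle_ineq[of "F X - G X" "G X - P X"] G(2) P(2)[OF that] that by fastforce
  then show "\<exists>P\<in>free_poly. \<forall>X\<in>nc_cball r. norm (F X - P X) \<le> e" using P(1) by blast
qed

lemma approximable_cong:
  assumes "approximable F" "\<And>X. X \<in> nc_ball \<Longrightarrow> F X = G X"
  shows "approximable G"
proof (rule approximable_limit)
  fix r e :: real assume "0 \<le> r" "r < 1" "0 < e"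
  then show "\<exists>H. approximable H \<and> (\<forall>X\<in>nc_cball r. norm (G X - H X) \<le> e)"
    using assms nc_cball_subset_nc_ball by (intro exI[of _ F]) fastforce
qed

lemma approximable_free_poly: "P \<in> free_poly \<Longrightarrow> approximable P"
  unfolding approximable_def by (metis diff_self norm_zero less_imp_le)

lemma approximable_bounded:
  assumes "approximable F" "0 \<le> r" "r < 1"
  shows "\<exists>M\<ge>0. \<forall>X\<in>nc_cball r. norm (F X) \<le> M"
proof -
  obtain P where P: "P \<in> free_poly" "\<And>X. X \<in> nc_cball r \<Longrightarrow> norm (F X - P X) \<le> 1"
    using approximableD[OF assms zero_less_one] by blast
  obtain M where M: "M \<ge> 0" "\<forall>X\<in>nc_ball. norm (P X) \<le> M" using free_poly_bounded[OF P(1)] by blast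
  have "norm (F X) \<le> M + 1" if X: "X \<in> nc_cball r" for X
    using norm_triangle_ineq2[of "F X" "P X"] P(2)[OF X] M(2) nc_cball_subset_nc_ball[OF assms(3) X assms(2)]
    by fastforce
  then show ?thesis using M(1) by (intro exI[of _ "M + 1"]) auto
qed

lemma approximable_add:
  assumes F: "approximable F" and G: "approximable G"
  shows "approximable (\<lambda>X. F X + G X)"
  unfolding approximable_def
proof (intro allI impI)
  fix r e :: real assume r: "0 \<le> r" "r < 1" and e: "0 < e"
  then have e2: "0 < e / 2" by simp
  obtain P where P: "P \<in> free_poly" "\<And>X. X \<in> nc_cball r \<Longrightarrow> norm (F X - P X) \<le> e / 2"
    using approximableD[OF F r e2] by blast
  obtain Q where Q: "Q \<in> free_poly" "\<And>X. X \<in> nc_cball r \<Longrightarrow> norm (G X - Q X) \<le> e / 2"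
    using approximableD[OF G r e2] by blast
  have "norm (F X + G X - (P X + Q X)) \<le> e" if "X \<in> nc_cball r" for X
    using norm_diff_triangle_ineq[of "F X" "G X" "P X" "Q X"] P(2)[OF that] Q(2)[OF that] by simp
  then show "\<exists>P\<in>free_poly. \<forall>X\<in>nc_cball r. norm (F X + G X - P X) \<le> e"
    by (intro bexI[OF _ free_poly.add[OF P(1) Q(1)]] ballI)
qed

lemma approximable_mult:
  assumes F: "approximable F" and G: "approximable G"
  shows "approximable (\<lambda>X. F X * G X)"
  unfolding approximable_def
proof (intro allI impI)
  fix r e :: real assume r: "0 \<le> r" "r < 1" and e: "0 < e"
  obtain M where M: "M \<ge> 0" "\<And>X. X \<in> nc_cball r \<Longrightarrow> norm (F X) \<le> M"
    using approximable_bounded[OF F r] by blast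
  obtain N where N: "N \<ge> 0" "\<And>X. X \<in> nc_cball r \<Longrightarrow> norm (G X) \<le> N"
    using approximable_bounded[OF G r] by blast
  \<comment> \<open>The product error will be at most \<open>M * d + d * (N + 1)\<close>, where
    \<open>N + 1\<close> bounds \<open>Q X\<close> because \<open>d \<le> 1\<close>.\<close>
  define d where "d = min 1 (e / (M + N + 1))"
  have d: "0 < d" "d \<le> 1" "d * (M + N + 1) \<le> e"
  proof -
    show "0 < d" "d \<le> 1" using M(1) N(1) e by (simp_all add: d_def)
    have "d * (M + N + 1) \<le> e / (M + N + 1) * (M + N + 1)"
      using M(1) N(1) by (intro mult_right_mono) (simp_all add: d_def)
    also have "\<dots> = e" using M(1) N(1) by simp
    finally show "d * (M + N + 1) \<le> e" .
  qed
  obtain P where P: "P \<in> free_poly" "\<And>X. X \<in> nc_cball r \<Longrightarrow> norm (F X - P X) \<le> d"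
    using approximableD[OF F r d(1)] by blast
  obtain Q where Q: "Q \<in> free_poly" "\<And>X. X \<in> nc_cball r \<Longrightarrow> norm (G X - Q X) \<le> d"
    using approximableD[OF G r d(1)] by blast
  have "norm (F X * G X - P X * Q X) \<le> e" if X: "X \<in> nc_cball r" for X
  proof -
    have nQ: "norm (Q X) \<le> N + 1"
      using norm_triangle_ineq2[of "Q X" "G X"] Q(2)[OF X] N(2)[OF X] d(2)
      by (simp add: norm_minus_commute)
    have "F X * G X - P X * Q X = F X * (G X - Q X) + (F X - P X) * Q X"
      by (simp add: right_diff_distrib left_diff_distrib)
    also have "norm \<dots> \<le> norm (F X) * norm (G X - Q X) + norm (F X - P X) * norm (Q X)"
      by (intro order_trans[OF norm_triangle_ineq] add_mono norm_mult_ineq)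
    also have "\<dots> \<le> M * d + d * (N + 1)"
      by (intro add_mono mult_mono M N P(2)[OF X] Q(2)[OF X] nQ X) (use M N d in auto)
    also have "\<dots> \<le> e" using d(3) by (simp add: algebra_simps)
    finally show ?thesis .
  qed
  then show "\<exists>P\<in>free_poly. \<forall>X\<in>nc_cball r. norm (F X * G X - P X) \<le> e"
    by (intro bexI[OF _ free_poly_mult[OF P(1) Q(1)]] ballI)
qed

lemma approximable_const: "approximable (\<lambda>X. c *\<^sub>C 1)"
  by (rule approximable_free_poly[OF free_poly_const])

lemma approximable_scaleC: "approximable F \<Longrightarrow> approximable (\<lambda>X. c *\<^sub>C F X)"
  using approximable_mult[OF approximable_const, of F c] by (simp add: op_mult_scaleC_left)

lemma approximable_diff: "approximable F \<Longrightarrow> approximable G \<Longrightarrow> approximable (\<lambda>X. F X - G X)"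
  using approximable_add[OF _ approximable_scaleC, of F G "-1"] by (simp add: scaleC_minus_left)

lemma approximable_sum: "(\<And>i. i \<in> I \<Longrightarrow> approximable (F i)) \<Longrightarrow> approximable (\<lambda>X. \<Sum>i\<in>I. F i X)"
  by (induction I rule: infinite_finite_induct)
    (simp_all add: approximable_free_poly free_poly_zero approximable_add)

lemma approximable_power: "approximable F \<Longrightarrow> approximable (\<lambda>X. F X ^ k)"
proof (induction k)
  case (Suc k)
  then show ?case using approximable_mult[of F "\<lambda>X. F X ^ k"] by simp
qed (use approximable_const[of 1] in simp)

lemma approximable_word_eval:
  assumes "\<And>i. approximable (\<lambda>X. \<Psi> X i)"
  shows "approximable (\<lambda>X. word_eval (\<Psi> X) \<alpha>)"
proof (induction \<alpha>)
  case (Cons i \<alpha>)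
  then show ?case using approximable_mult[OF assms, of "\<lambda>X. word_eval (\<Psi> X) \<alpha>" i] by simp
qed (use approximable_const[of 1] in simp)

lemma approximable_free_poly_compose:
  assumes "P \<in> free_poly" "\<And>i. approximable (\<lambda>X. \<Psi> X i)"
  shows "approximable (\<lambda>X. P (\<Psi> X))"
  using assms(1)
  by induction (simp_all add: approximable_add approximable_scaleC approximable_word_eval assms(2))

text \<open>A polynomial approximates \<open>F\<close> only on a closed ball of radius below 1, so
  the images of \<open>nc_cball r\<close> must stay in one such ball.\<close>

lemma approximable_compose:
  assumes F: "approximable F" and \<Psi>: "\<And>i. approximable (\<lambda>X. \<Psi> X i)"
    and ball: "\<And>r. 0 \<le> r \<Longrightarrow> r < 1 \<Longrightarrow> \<exists>s. 0 \<le> s \<and> s < 1 \<and> (\<forall>X\<in>nc_cball r. \<Psi> X \<in> nc_cball s)"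
  shows "approximable (\<lambda>X. F (\<Psi> X))"
proof (rule approximable_limit)
  fix r e :: real assume r: "0 \<le> r" "r < 1" and e: "0 < e"
  obtain s where s: "0 \<le> s" "s < 1" "\<forall>X\<in>nc_cball r. \<Psi> X \<in> nc_cball s" using ball[OF r] by blast
  obtain P where P: "P \<in> free_poly" "\<And>X. X \<in> nc_cball s \<Longrightarrow> norm (F X - P X) \<le> e"
    using approximableD[OF F s(1,2) e] by blast
  then show "\<exists>G. approximable G \<and> (\<forall>X\<in>nc_cball r. norm (F (\<Psi> X) - G X) \<le> e)"
    using approximable_free_poly_compose[OF P(1) \<Psi>] s(3) by (intro exI[of _ "\<lambda>X. P (\<Psi> X)"]) simp
qed

lemma approximable_neumann:
  assumes Z: "approximable Z" and q: "\<And>X. X \<in> nc_ball \<Longrightarrow> norm (Z X) \<le> q" "q < 1" "0 \<le> q"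
  shows "approximable (\<lambda>X. op_inv (1 - Z X))"
proof (rule approximable_limit)
  fix r e :: real assume r: "0 \<le> r" "r < 1" and e: "0 < e"
  have "(\<lambda>K. q ^ K / (1 - q)) \<longlonglongrightarrow> 0 / (1 - q)"
    using q by (intro tendsto_intros LIMSEQ_realpow_zero) auto
  then obtain K where K: "q ^ K / (1 - q) < e"
    using order_tendstoD(2)[of _ "0 / (1 - q)" sequentially e] e
    by (auto simp: eventually_sequentially)
  have "approximable (\<lambda>X. \<Sum>k<K. Z X ^ k)" by (intro approximable_sum approximable_power Z)
  moreover have "norm (op_inv (1 - Z X) - (\<Sum>k<K. Z X ^ k)) \<le> e" if "X \<in> nc_cball r" for X
    using neumann(3)[OF q(1,2), of X K] nc_cball_subset_nc_ball[OF r(2) that r(1)] K by simp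
  ultimately show "\<exists>G. approximable G \<and> (\<forall>X\<in>nc_cball r. norm (op_inv (1 - Z X) - G X) \<le> e)"
    by blast
qed

section \<open>From power series to polynomial limits and back\<close>

lemma limsup_root_le_one_iff:
  fixes s :: "nat \<Rightarrow> real"
  assumes s: "\<And>k. 0 \<le> s k"
  shows "limsup (\<lambda>k. ereal (root (2 * k) (s k))) \<le> 1 \<longleftrightarrow>
    (\<forall>\<rho>>1. \<forall>\<^sub>F k in sequentially. s k \<le> \<rho> ^ (2 * k))"
proof
  assume L: "limsup (\<lambda>k. ereal (root (2 * k) (s k))) \<le> 1"
  show "\<forall>\<rho>>1. \<forall>\<^sub>F k in sequentially. s k \<le> \<rho> ^ (2 * k)"
  proof (intro allI impI)
    fix \<rho> :: real assume "1 < \<rho>"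
    then have "1 < ereal \<rho>" by simp
    then have "\<forall>\<^sub>F k in sequentially. ereal (root (2 * k) (s k)) < ereal \<rho>"
      by (rule L[unfolded Limsup_le_iff, rule_format])
    then show "\<forall>\<^sub>F k in sequentially. s k \<le> \<rho> ^ (2 * k)"
      using eventually_gt_at_top[of 0]
    proof eventually_elim
      case (elim k)
      \<comment> \<open>\<open>elim\<close> also contains \<open>0 < k\<close>; at
        \<open>k = 0\<close> the root is 0 and its power would not give back
        \<open>s k\<close>.\<close>
      have "s k = root (2 * k) (s k) ^ (2 * k)" using elim s[of k] by simp
      also have "\<dots> \<le> \<rho> ^ (2 * k)" using elim s[of k] by (intro power_mono) auto
      finally show ?case .
    qed
  qed
next
  assume R: "\<forall>\<rho>>1. \<forall>\<^sub>F k in sequentially. s k \<le> \<rho> ^ (2 * k)"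
  show "limsup (\<lambda>k. ereal (root (2 * k) (s k))) \<le> 1"
    unfolding Limsup_le_iff
  proof (intro allI impI)
    fix y :: ereal assume "1 < y"
    then obtain \<rho> where \<rho>: "1 < ereal \<rho>" "ereal \<rho> < y" using ereal_dense2 by blast
    then have "1 < \<rho>" by simp
    with R have "\<forall>\<^sub>F k in sequentially. s k \<le> \<rho> ^ (2 * k)" by blast
    then show "\<forall>\<^sub>F k in sequentially. ereal (root (2 * k) (s k)) < y"
      using eventually_gt_at_top[of 0]
    proof eventually_elim
      case (elim k)
      have "root (2 * k) (s k) \<le> root (2 * k) (\<rho> ^ (2 * k))" using elim by (intro real_root_le_mono) auto
      also have "\<dots> = \<rho>" using elim \<open>1 < \<rho>\<close> by (intro real_root_power_cancel) auto
      finally show ?case using \<rho>(2) by (meson ereal_less_eq(3) order_le_less_trans)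
    qed
  qed
qed

lemma free_expansion_iff:
  "free_expansion a F \<longleftrightarrow>
    (\<forall>\<rho>>1. \<forall>\<^sub>F k in sequentially. (\<Sum>\<alpha> | length \<alpha> = k. (cmod (a \<alpha>))\<^sup>2) \<le> \<rho> ^ (2 * k)) \<and>
    (\<forall>X\<in>nc_ball. (\<lambda>k. homog a k X) sums F X)"
  unfolding free_expansion_def homog_def
  by (subst limsup_root_le_one_iff) (simp_all add: sum_nonneg)

lemma free_expansion_sums:
  "free_expansion a F \<Longrightarrow> X \<in> nc_ball \<Longrightarrow> (\<lambda>k. homog a k X) sums F X"
  by (simp add: free_expansion_iff)

lemma free_expansion_approximable:
  fixes F :: "('n::finite \<Rightarrow> 'h::complex_hilbert_space bounded_op) \<Rightarrow> 'h bounded_op"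
  assumes F: "free_expansion a F"
  shows "approximable F"
proof (rule approximable_limit)
  fix r e :: real assume r: "0 \<le> r" "r < 1" and e: "0 < e"
  \<comment> \<open>Chosen so that \<open>1 < \<rho>\<close> while \<open>\<rho> * r < 1\<close>:
    the coefficients grow more slowly than the powers of \<open>\<rho>\<close>, and the homogeneous
    parts are dominated by a geometric series uniformly on \<open>nc_cball r\<close>.\<close>
  define \<rho> where "\<rho> = 2 / (1 + r)"
  define q where "q = \<rho> * r"
  have \<rho>: "1 < \<rho>" using r by (simp add: \<rho>_def)
  have q: "0 \<le> q" "q < 1" using r by (simp_all add: q_def \<rho>_def field_simps)
  obtain N where N: "\<And>k. k \<ge> N \<Longrightarrow> (\<Sum>\<alpha> | length \<alpha> = k. (cmod (a \<alpha>))\<^sup>2) \<le> \<rho> ^ (2 * k)"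
    using F \<rho> unfolding free_expansion_iff eventually_sequentially by blast
  have h: "norm (homog a k X) \<le> q ^ k" if "k \<ge> N" "X \<in> nc_cball r" for k and X :: "'n \<Rightarrow> 'h bounded_op"
  proof -
    have "norm (homog a k X) \<le> sqrt (\<Sum>\<alpha> | length \<alpha> = k. (cmod (a \<alpha>))\<^sup>2) * r ^ k"
      by (rule norm_homog_le[OF that(2) r(1)])
    also have "\<dots> \<le> \<rho> ^ k * r ^ k"
      using N[OF that(1)] \<rho> r by (intro mult_right_mono real_le_lsqrt)
        (auto simp: power_mult[symmetric] mult.commute)
    finally show ?thesis by (simp add: q_def power_mult_distrib)
  qed
  have "(\<lambda>K. q ^ K / (1 - q)) \<longlonglongrightarrow> 0 / (1 - q)"
    using q by (intro tendsto_intros LIMSEQ_realpow_zero) auto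
  then have "\<forall>\<^sub>F K in sequentially. q ^ K / (1 - q) < e"
    using order_tendstoD(2)[of _ "0 / (1 - q)" sequentially e] e by simp
  then have "\<forall>\<^sub>F K in sequentially. q ^ K / (1 - q) < e \<and> N \<le> K"
    by (intro eventually_conj eventually_ge_at_top)
  then obtain K where K: "q ^ K / (1 - q) < e" "K \<ge> N"
    by (auto simp: eventually_sequentially)
  have "norm (F X - (\<Sum>k<K. homog a k X)) \<le> e" if X: "X \<in> nc_cball r" for X
  proof -
    have s: "(\<lambda>k. homog a k X) sums F X"
      by (rule free_expansion_sums[OF F nc_cball_subset_nc_ball[OF r(2) X r(1)]])
    have "F X - (\<Sum>k<K. homog a k X) = (\<Sum>k. homog a (k + K) X)"
      using suminf_minus_initial_segment[OF sums_summable[OF s], of K] sums_unique[OF s] by simp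
    also have "norm \<dots> \<le> (\<Sum>k. q ^ (k + K))"
      by (rule norm_suminf_le) (use h[OF _ X] K q in \<open>auto intro: summable_ignore_initial_segment\<close>)
    also have "\<dots> = q ^ K / (1 - q)"
      using q by (simp add: power_add suminf_mult2[symmetric] suminf_geometric)
    finally show ?thesis using K by simp
  qed
  moreover have "approximable (\<lambda>X :: 'n \<Rightarrow> 'h bounded_op. \<Sum>k<K. homog a k X)"
    by (intro approximable_sum approximable_free_poly free_poly_homog)
  ultimately show "\<exists>G. approximable G \<and> (\<forall>X\<in>nc_cball r. norm (F X - G X) \<le> e)" by blast
qed

text \<open>A model truncated at the length of one word already reads off its coefficient. The
  radius 1/2 is an arbitrary choice in the open unit interval.\<close>

lemma free_expansion_unique:
  fixes F :: "('n::finite \<Rightarrow> 'h::complex_hilbert_space bounded_op) \<Rightarrow> 'h bounded_op"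
  assumes inf: "infinite_dim TYPE('h)"
    and a: "free_expansion a F" and b: "free_expansion b F"
  shows "a = b"
proof
  fix \<alpha> :: "'n list"
  obtain X :: "'n \<Rightarrow> 'h bounded_op" and g where g: "fock_model (length \<alpha>) (1/2) X g"
    using fock_model_exists[OF inf, of "1/2"] by auto
  have X: "X \<in> nc_ball" using g by (auto simp: fock_model_def intro: nc_cball_subset_nc_ball[of "1/2"])
  show "a \<alpha> = b \<alpha>"
    using fock_model_sums[OF g free_expansion_sums[OF a X], of "[]"]
      fock_model_sums[OF g free_expansion_sums[OF b X], of "[]"]
    by (intro fock_model_unique[OF g]) auto
qed

lemma free_coeff_eq:
  fixes F :: "('n::finite \<Rightarrow> 'h::complex_hilbert_space bounded_op) \<Rightarrow> 'h bounded_op"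
  assumes "infinite_dim TYPE('h)" "free_expansion a F"
  shows "free_coeff F = a"
  unfolding free_coeff_def using assms free_expansion_unique by blast

text \<open>The coefficients are the limits of those of approximating polynomials: on each smaller ball
  \<open>coeff_bound\<close> turns uniform convergence into weighted $\ell^2$ convergence of
  the coefficients.\<close>

lemma approximable_free_expansion:
  fixes F :: "('n::finite \<Rightarrow> 'h::complex_hilbert_space bounded_op) \<Rightarrow> 'h bounded_op"
  assumes inf: "infinite_dim TYPE('h)" and F: "approximable F"
  shows "\<exists>a. free_expansion a F \<and> (\<forall>r m M. 0 \<le> r \<longrightarrow> r < 1 \<longrightarrow> (\<forall>X\<in>nc_cball r. norm (F X) \<le> M) \<longrightarrow>
    (\<Sum>\<alpha> | length \<alpha> \<le> m. (cmod (a \<alpha>))\<^sup>2 * r ^ (2 * length \<alpha>)) \<le> M\<^sup>2)"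
proof -
  \<comment> \<open>The radii \<open>R N\<close> tend to 1 while the errors \<open>e N\<close> tend
    to 0, so one sequence of polynomials serves every smaller ball.\<close>
  define R where "R = (\<lambda>N. 1 - 1 / real (N + 2))"
  define e where "e = (\<lambda>N. 1 / real (N + 1))"
  have R: "0 \<le> R N" "R N < 1" for N by (simp_all add: R_def)
  have e: "0 < e N" for N by (simp add: e_def)
  have e0: "e \<longlonglongrightarrow> 0" using LIMSEQ_Suc[OF lim_inverse_n'] by (simp add: e_def)
  have "\<exists>P\<in>free_poly. \<forall>X\<in>nc_cball (R N). norm (F X - P X) \<le> e N" for N
    using F R[of N] e[of N] unfolding approximable_def by blast
  then obtain P where P: "\<And>N. P N \<in> free_poly"
    and FP: "\<And>N X. X \<in> nc_cball (R N) \<Longrightarrow> norm (F X - P N X) \<le> e N" by metis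
  have "\<exists>a D. \<forall>K\<ge>D. \<forall>X. P N X = (\<Sum>k<K. homog a k X)" for N by (rule free_poly_expand[OF P])
  then obtain A D where A: "\<And>N K X. K \<ge> D N \<Longrightarrow> P N X = (\<Sum>k<K. homog (A N) k X)" by metis
  have A_sums: "(\<lambda>k. homog (A N) k X) sums P N X" for N X
  proof -
    have "\<forall>\<^sub>F K in sequentially. (\<Sum>k<K. homog (A N) k X) = P N X"
      unfolding eventually_sequentially using A[of N _ X, symmetric] by blast
    then show ?thesis unfolding sums_def by (rule tendsto_eventually)
  qed
  have near: "\<exists>N0. \<forall>N\<ge>N0. r \<le> R N" if "r < 1" for r
  proof -
    obtain N0 :: nat where N0: "1 / (1 - r) < real N0" using reals_Archimedean2 by blast
    have "r \<le> R N" if "N \<ge> N0" for N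
    proof -
      have "1 / (1 - r) < real (N + 2)" using N0 that by simp
      then have "1 < real (N + 2) * (1 - r)" using \<open>r < 1\<close> by (simp add: pos_divide_less_eq)
      then show ?thesis by (simp add: R_def field_simps)
    qed
    then show ?thesis by blast
  qed
  have FP': "norm (F X - P N X) \<le> e N" if "0 \<le> r" "r \<le> R N" "X \<in> nc_cball r" for r N X
    using FP nc_cball_mono[OF that(1,2)] that(3) by blast
  have diff: "(\<Sum>\<alpha> | length \<alpha> \<le> m. (cmod (A N \<alpha> - A M \<alpha>))\<^sup>2 * r ^ (2 * length \<alpha>)) \<le> (e N + e M)\<^sup>2"
    if r: "0 \<le> r" "r \<le> R N" "r \<le> R M" for r m N M
  proof (rule coeff_bound[OF inf r(1)])
    fix X :: "'n \<Rightarrow> 'h bounded_op" assume X: "X \<in> nc_cball r"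
    show "(\<lambda>k. homog (\<lambda>\<alpha>. A N \<alpha> - A M \<alpha>) k X) sums (P N X - P M X)"
      unfolding homog_diff by (intro sums_diff A_sums)
    show "norm (P N X - P M X) \<le> e N + e M"
      using norm_triangle_ineq4[of "F X - P M X" "F X - P N X"] FP'[OF r(1,2) X] FP'[OF r(1,3) X] by simp
  qed
  have "Cauchy (\<lambda>N. A N \<alpha>)" for \<alpha>
  proof (rule metric_CauchyI)
    fix d :: real assume d: "0 < d"
    \<comment> \<open>The square root of the weight of the word \<open>\<alpha>\<close> at radius
      1/2; one fixed radius is enough to isolate a single coefficient.\<close>
    define c where "c = (1/2 :: real) ^ length \<alpha>"
    have c: "0 < c" by (simp add: c_def)
    have "\<forall>\<^sub>F N in sequentially. e N < c * d / 2"
      by (rule order_tendstoD(2)[OF e0]) (use c d in simp)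
    moreover have "\<forall>\<^sub>F N in sequentially. 1/2 \<le> R N"
      using near[of "1/2"] by (simp add: eventually_sequentially)
    ultimately have "\<forall>\<^sub>F N in sequentially. e N < c * d / 2 \<and> 1/2 \<le> R N" by eventually_elim simp
    then obtain N0 where N0: "\<And>N. N \<ge> N0 \<Longrightarrow> e N < c * d / 2 \<and> 1/2 \<le> R N"
      by (auto simp: eventually_sequentially)
    have "dist (A M \<alpha>) (A N \<alpha>) < d" if "M \<ge> N0" "N \<ge> N0" for M N
    proof -
      have "(cmod (A M \<alpha> - A N \<alpha>))\<^sup>2 * (1/2) ^ (2 * length \<alpha>) \<le>
          (\<Sum>\<alpha>' | length \<alpha>' \<le> length \<alpha>. (cmod (A M \<alpha>' - A N \<alpha>'))\<^sup>2 * (1/2) ^ (2 * length \<alpha>'))"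
        by (rule member_le_sum) auto
      also have "\<dots> \<le> (e M + e N)\<^sup>2" using N0[OF that(1)] N0[OF that(2)] by (intro diff) auto
      finally have "(cmod (A M \<alpha> - A N \<alpha>) * c)\<^sup>2 \<le> (e M + e N)\<^sup>2"
        by (simp add: c_def power_mult_distrib power_mult[symmetric] mult.commute)
      then have "cmod (A M \<alpha> - A N \<alpha>) * c \<le> e M + e N"
        by (rule power2_le_imp_le) (use e[of M] e[of N] in simp)
      also have "\<dots> < d * c" using N0[OF that(1)] N0[OF that(2)] by (simp add: mult.commute)
      finally show ?thesis using c by (simp add: dist_norm)
    qed
    then show "\<exists>N0. \<forall>M\<ge>N0. \<forall>N\<ge>N0. dist (A M \<alpha>) (A N \<alpha>) < d" by blast
  qed
  then have "\<exists>l. (\<lambda>N. A N \<alpha>) \<longlonglongrightarrow> l" for \<alpha>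
    using Cauchy_convergent_iff convergent_def by blast
  then obtain a where a: "\<And>\<alpha>. (\<lambda>N. A N \<alpha>) \<longlonglongrightarrow> a \<alpha>" by metis
  \<comment> \<open>For a fixed truncation \<open>m\<close> the sum is finite, so the second index
    of \<open>diff\<close> may go to infinity; \<open>near\<close> puts \<open>r\<close> below
    \<open>R M\<close> from some point on.\<close>
  have diff_a: "(\<Sum>\<alpha> | length \<alpha> \<le> m. (cmod (A N \<alpha> - a \<alpha>))\<^sup>2 * r ^ (2 * length \<alpha>)) \<le> (e N)\<^sup>2"
    if r: "0 \<le> r" "r \<le> R N" "r < 1" for r m N
  proof (rule LIMSEQ_le)
    show "(\<lambda>M. \<Sum>\<alpha> | length \<alpha> \<le> m. (cmod (A N \<alpha> - A M \<alpha>))\<^sup>2 * r ^ (2 * length \<alpha>))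
        \<longlonglongrightarrow> (\<Sum>\<alpha> | length \<alpha> \<le> m. (cmod (A N \<alpha> - a \<alpha>))\<^sup>2 * r ^ (2 * length \<alpha>))"
      by (intro tendsto_sum tendsto_mult tendsto_power tendsto_norm tendsto_diff tendsto_const a)
    have "(\<lambda>M. (e N + e M)\<^sup>2) \<longlonglongrightarrow> (e N + 0)\<^sup>2"
      by (intro tendsto_power tendsto_add tendsto_const e0)
    then show "(\<lambda>M. (e N + e M)\<^sup>2) \<longlonglongrightarrow> (e N)\<^sup>2" by simp
    show "\<exists>N'. \<forall>M\<ge>N'. (\<Sum>\<alpha> | length \<alpha> \<le> m. (cmod (A N \<alpha> - A M \<alpha>))\<^sup>2 * r ^ (2 * length \<alpha>)) \<le> (e N + e M)\<^sup>2"
      using near[OF r(3)] diff[OF r(1,2)] by blast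
  qed
  have bound: "(\<Sum>\<alpha> | length \<alpha> \<le> m. (cmod (a \<alpha>))\<^sup>2 * r ^ (2 * length \<alpha>)) \<le> M\<^sup>2"
    if r: "0 \<le> r" "r < 1" and M: "\<And>X. X \<in> nc_cball r \<Longrightarrow> norm (F X) \<le> M" for r m M
  proof (rule LIMSEQ_le)
    show "(\<lambda>N. \<Sum>\<alpha> | length \<alpha> \<le> m. (cmod (A N \<alpha>))\<^sup>2 * r ^ (2 * length \<alpha>))
        \<longlonglongrightarrow> (\<Sum>\<alpha> | length \<alpha> \<le> m. (cmod (a \<alpha>))\<^sup>2 * r ^ (2 * length \<alpha>))"
      by (intro tendsto_sum tendsto_mult tendsto_power tendsto_norm tendsto_const a)
    have "(\<lambda>N. (M + e N)\<^sup>2) \<longlonglongrightarrow> (M + 0)\<^sup>2"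
      by (intro tendsto_power tendsto_add tendsto_const e0)
    then show "(\<lambda>N. (M + e N)\<^sup>2) \<longlonglongrightarrow> M\<^sup>2" by simp
    obtain N0 where N0: "\<And>N. N \<ge> N0 \<Longrightarrow> r \<le> R N" using near[OF r(2)] by blast
    have "(\<Sum>\<alpha> | length \<alpha> \<le> m. (cmod (A N \<alpha>))\<^sup>2 * r ^ (2 * length \<alpha>)) \<le> (M + e N)\<^sup>2" if "N \<ge> N0" for N
    proof (rule coeff_bound[OF inf r(1)])
      fix X :: "'n \<Rightarrow> 'h bounded_op" assume X: "X \<in> nc_cball r"
      show "(\<lambda>k. homog (A N) k X) sums P N X" by (rule A_sums)
      show "norm (P N X) \<le> M + e N"
        using norm_triangle_ineq2[of "P N X" "F X"] FP'[OF r(1) N0[OF that] X] M[OF X]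
        by (simp add: norm_minus_commute)
    qed
    then show "\<exists>N0. \<forall>N\<ge>N0. (\<Sum>\<alpha> | length \<alpha> \<le> m. (cmod (A N \<alpha>))\<^sup>2 * r ^ (2 * length \<alpha>)) \<le> (M + e N)\<^sup>2"
      by blast
  qed
  have level: "(\<Sum>\<alpha> | length \<alpha> = k. (cmod (b \<alpha>))\<^sup>2) * r ^ (2 * k) \<le>
      (\<Sum>\<alpha> | length \<alpha> \<le> k. (cmod (b \<alpha>))\<^sup>2 * r ^ (2 * length \<alpha>))" if "0 \<le> r"
    for b :: "'n list \<Rightarrow> complex" and k and r :: real
  proof -
    have "(\<Sum>\<alpha> | length \<alpha> = k. (cmod (b \<alpha>))\<^sup>2) * r ^ (2 * k) =
        (\<Sum>\<alpha> | length \<alpha> = k. (cmod (b \<alpha>))\<^sup>2 * r ^ (2 * length \<alpha>))"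
      by (simp add: sum_distrib_right)
    also have "\<dots> \<le> (\<Sum>\<alpha> | length \<alpha> \<le> k. (cmod (b \<alpha>))\<^sup>2 * r ^ (2 * length \<alpha>))"
      by (rule sum_mono2) (use that in auto)
    finally show ?thesis .
  qed
  have "free_expansion a F"
    unfolding free_expansion_iff
  proof (intro conjI allI impI ballI)
    fix \<rho> :: real assume \<rho>: "1 < \<rho>"
    \<comment> \<open>The midpoint of \<open>1 / \<rho>\<close> and 1: small enough for
      \<open>F\<close> to be bounded on the ball of radius \<open>r\<close>, large enough that
      \<open>(r * \<rho>) ^ k\<close> eventually exceeds that bound.\<close>
    define r where "r = (1 + 1 / \<rho>) / 2"
    have r: "0 < r" "r < 1" "1 < r * \<rho>" using \<rho> by (simp_all add: r_def field_simps)
    obtain M where M: "\<And>X. X \<in> nc_cball r \<Longrightarrow> norm (F X) \<le> M"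
      using approximable_bounded[OF F] r by (metis less_imp_le)
    obtain k0 where k0: "\<bar>M\<bar> < (r * \<rho>) ^ k0" using real_arch_pow[OF r(3)] by blast
    have "\<bar>M\<bar> \<le> (r * \<rho>) ^ k" if "k \<ge> k0" for k
      using k0 power_increasing[OF that, of "r * \<rho>"] r(3) by linarith
    then have "\<forall>\<^sub>F k in sequentially. \<bar>M\<bar> \<le> (r * \<rho>) ^ k"
      unfolding eventually_sequentially by blast
    then show "\<forall>\<^sub>F k in sequentially. (\<Sum>\<alpha> | length \<alpha> = k. (cmod (a \<alpha>))\<^sup>2) \<le> \<rho> ^ (2 * k)"
    proof eventually_elim
      case (elim k)
      have "(\<Sum>\<alpha> | length \<alpha> = k. (cmod (a \<alpha>))\<^sup>2) * r ^ (2 * k) \<le> M\<^sup>2"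
        using level[of r a k] bound[of r M k] M r by fastforce
      also have "\<dots> \<le> ((r * \<rho>) ^ k)\<^sup>2" using elim by (simp add: abs_le_square_iff[symmetric])
      also have "\<dots> = \<rho> ^ (2 * k) * r ^ (2 * k)"
        by (simp add: power_mult_distrib power_mult[symmetric] mult.commute)
      finally show ?case using r by simp
    qed
  next
    fix X :: "'n \<Rightarrow> 'h bounded_op" assume "X \<in> nc_ball"
    then obtain s where s: "0 \<le> s" "s < 1" "X \<in> nc_cball s" by (rule nc_ball_imp_nc_cball)
    \<comment> \<open>A radius strictly between \<open>s\<close> and 1: coefficient differences are
      estimated at \<open>r\<close> and evaluated at \<open>s\<close>, which gains the geometric
      factor \<open>q = s / r\<close>.\<close>
    define r where "r = (1 + s) / 2"
    have r: "0 < r" "r < 1" "s < r" using s by (simp_all add: r_def)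
    define q where "q = s / r"
    have q: "0 \<le> q" "q < 1" using s r by (simp_all add: q_def)
    \<comment> \<open>The summand \<open>1 / (1 - q)\<close> pays for the difference of the two
      expansions, the summand 1 for the distance from \<open>F\<close> to the polynomial.\<close>
    define C where "C = 1 / (1 - q) + 1"
    obtain N0 where N0: "\<And>N. N \<ge> N0 \<Longrightarrow> r \<le> R N" using near[OF r(2)] by blast
    have key: "norm ((\<Sum>k<K. homog a k X) - F X) \<le> C * e N" if N: "N \<ge> N0" and K: "K \<ge> D N" for N K
    proof -
      have h: "norm (homog (\<lambda>\<alpha>. A N \<alpha> - a \<alpha>) k X) \<le> e N * q ^ k" for k
      proof -
        let ?S = "\<Sum>\<alpha> | length \<alpha> = k. (cmod (A N \<alpha> - a \<alpha>))\<^sup>2"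
        have "?S * r ^ (2 * k) \<le> (e N)\<^sup>2"
          using level[of r "\<lambda>\<alpha>. A N \<alpha> - a \<alpha>" k] diff_a[of r N k] N0[OF N] r by simp
        then have "?S \<le> (e N)\<^sup>2 / r ^ (2 * k)" using r by (simp add: pos_le_divide_eq)
        then have "?S \<le> (e N / r ^ k)\<^sup>2"
          by (simp add: power_divide power_mult[symmetric] mult.commute)
        then have "sqrt ?S \<le> e N / r ^ k" using e[of N] r by (intro real_le_lsqrt) auto
        then have "sqrt ?S * s ^ k \<le> e N / r ^ k * s ^ k" using s by (intro mult_right_mono) auto
        then show ?thesis
          using norm_homog_le[OF s(3,1), of "\<lambda>\<alpha>. A N \<alpha> - a \<alpha>" k] by (simp add: q_def power_divide)
      qed
      have "(\<Sum>k<K. homog a k X) - F X = (P N X - F X) - (\<Sum>k<K. homog (\<lambda>\<alpha>. A N \<alpha> - a \<alpha>) k X)"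
        by (simp add: A[OF K] homog_diff sum_subtractf)
      also have "norm \<dots> \<le> norm (P N X - F X) + norm (\<Sum>k<K. homog (\<lambda>\<alpha>. A N \<alpha> - a \<alpha>) k X)"
        by (rule norm_triangle_ineq4)
      also have "norm (P N X - F X) \<le> e N"
        using FP'[OF s(1) _ s(3), of N] N0[OF N] r by (simp add: norm_minus_commute)
      also have "norm (\<Sum>k<K. homog (\<lambda>\<alpha>. A N \<alpha> - a \<alpha>) k X) \<le> (\<Sum>k<K. e N * q ^ k)"
        by (rule sum_norm_le) (rule h)
      also have "\<dots> = e N * (\<Sum>k<K. q ^ k)" by (simp add: sum_distrib_left)
      also have "(\<Sum>k<K. q ^ k) \<le> 1 / (1 - q)"
        using sum_le_suminf[of "\<lambda>k. q ^ k" "{..<K}"] q by (simp add: suminf_geometric)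
      finally show ?thesis using e[of N] by (simp add: C_def algebra_simps mult_left_mono)
    qed
    show "(\<lambda>k. homog a k X) sums F X"
      unfolding sums_def
    proof (rule LIMSEQ_I)
      fix d :: real assume d: "0 < d"
      have C: "0 < C" using q by (simp add: C_def add_pos_pos)
      have "\<forall>\<^sub>F N in sequentially. e N < d / C \<and> N \<ge> N0"
        using order_tendstoD(2)[OF e0, of "d / C"] C d by (intro eventually_conj eventually_ge_at_top) simp
      then obtain N where N: "e N < d / C" "N \<ge> N0" by (auto simp: eventually_sequentially)
      have "norm ((\<Sum>k<K. homog a k X) - F X) < d" if "K \<ge> D N" for K
        using key[OF N(2) that] N(1) C by (simp add: field_simps)
      then show "\<exists>K0. \<forall>K\<ge>K0. norm ((\<Sum>k<K. homog a k X) - F X) < d" by blast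
    qed
  qed
  then show ?thesis using bound by (intro exI[of _ a]) simp
qed

lemma free_holomorphic_iff_approximable:
  fixes F :: "('n::finite \<Rightarrow> 'h::complex_hilbert_space bounded_op) \<Rightarrow> 'h bounded_op"
  assumes "infinite_dim TYPE('h)"
  shows "free_holomorphic F \<longleftrightarrow> approximable F"
  unfolding free_holomorphic_def
proof
  show "\<exists>a. free_expansion a F" if "approximable F"
    using approximable_free_expansion[OF assms that] by blast
qed (use free_expansion_approximable in blast)

text \<open>With one bound \<open>M\<close> for all radii, the coefficient estimate holds with the
  same constant for every \<open>r < 1\<close>. Letting \<open>r\<close> tend to 1 in a finite sum
  removes the weights, and each finite set of words lies below some level.\<close>

lemma bounded_in_H2_ball:
  fixes F :: "('n::finite \<Rightarrow> 'h::complex_hilbert_space bounded_op) \<Rightarrow> 'h bounded_op"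
  assumes inf: "infinite_dim TYPE('h)" and F: "approximable F"
    and M: "\<And>X. X \<in> nc_ball \<Longrightarrow> norm (F X) \<le> M" and out: "\<And>X. X \<notin> nc_ball \<Longrightarrow> F X = 0"
  shows "F \<in> H2_ball"
proof -
  from approximable_free_expansion[OF inf F]
  obtain a where "free_expansion a F \<and> (\<forall>r m M. 0 \<le> r \<longrightarrow> r < 1 \<longrightarrow>
      (\<forall>X\<in>nc_cball r. norm (F X) \<le> M) \<longrightarrow>
      (\<Sum>\<alpha> | length \<alpha> \<le> m. (cmod (a \<alpha>))\<^sup>2 * r ^ (2 * length \<alpha>)) \<le> M\<^sup>2)" ..
  then have a: "free_expansion a F"
    and bound: "\<And>r m M. 0 \<le> r \<Longrightarrow> r < 1 \<Longrightarrow> (\<And>X. X \<in> nc_cball r \<Longrightarrow> norm (F X) \<le> M) \<Longrightarrow>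
      (\<Sum>\<alpha> | length \<alpha> \<le> m. (cmod (a \<alpha>))\<^sup>2 * r ^ (2 * length \<alpha>)) \<le> M\<^sup>2"
    by simp_all
  have sphere: "(\<Sum>\<alpha> | length \<alpha> \<le> m. (cmod (a \<alpha>))\<^sup>2) \<le> M\<^sup>2" for m
  proof (rule LIMSEQ_le_const2)
    define R where "R = (\<lambda>N. 1 - 1 / real (Suc N))"
    have "R \<longlonglongrightarrow> 1 - 0"
      unfolding R_def by (intro tendsto_diff tendsto_const LIMSEQ_Suc[OF lim_inverse_n'])
    then have "(\<lambda>N. \<Sum>\<alpha> | length \<alpha> \<le> m. (cmod (a \<alpha>))\<^sup>2 * R N ^ (2 * length \<alpha>)) \<longlonglongrightarrow>
        (\<Sum>\<alpha> | length \<alpha> \<le> m. (cmod (a \<alpha>))\<^sup>2 * 1 ^ (2 * length \<alpha>))"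
      by (intro tendsto_sum tendsto_mult tendsto_power tendsto_const) simp
    then show "(\<lambda>N. \<Sum>\<alpha> | length \<alpha> \<le> m. (cmod (a \<alpha>))\<^sup>2 * R N ^ (2 * length \<alpha>)) \<longlonglongrightarrow>
        (\<Sum>\<alpha> | length \<alpha> \<le> m. (cmod (a \<alpha>))\<^sup>2)" by simp
    have "(\<Sum>\<alpha> | length \<alpha> \<le> m. (cmod (a \<alpha>))\<^sup>2 * R N ^ (2 * length \<alpha>)) \<le> M\<^sup>2" for N
    proof (rule bound)
      show "0 \<le> R N" "R N < 1" by (simp_all add: R_def)
      then show "norm (F X) \<le> M" if "X \<in> nc_cball (R N)" for X
        using M nc_cball_subset_nc_ball that by blast
    qed
    then show "\<exists>N0. \<forall>N\<ge>N0. (\<Sum>\<alpha> | length \<alpha> \<le> m. (cmod (a \<alpha>))\<^sup>2 * R N ^ (2 * length \<alpha>)) \<le> M\<^sup>2" by blast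
  qed
  have "(\<lambda>\<alpha>. (cmod (a \<alpha>))\<^sup>2) summable_on UNIV"
  proof (rule nonneg_bdd_above_summable_on)
    show "bdd_above (sum (\<lambda>\<alpha>. (cmod (a \<alpha>))\<^sup>2) ` {W. W \<subseteq> UNIV \<and> finite W})"
    proof (rule bdd_aboveI2)
      fix W :: "'n list set" assume "W \<in> {W. W \<subseteq> UNIV \<and> finite W}"
      then have W: "finite W" by simp
      have "(\<Sum>\<alpha>\<in>W. (cmod (a \<alpha>))\<^sup>2) \<le> (\<Sum>\<alpha> | length \<alpha> \<le> Max (length ` W). (cmod (a \<alpha>))\<^sup>2)"
        by (rule sum_mono2) (use W in auto)
      then show "(\<Sum>\<alpha>\<in>W. (cmod (a \<alpha>))\<^sup>2) \<le> M\<^sup>2" using sphere order_trans by blast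
    qed
  qed simp
  then show ?thesis
    unfolding H2_ball_def using a out by (auto simp: free_holomorphic_def free_coeff_eq[OF inf a])
qed

subsection \<open>The involutive automorphisms\<close>

lemma norm_vec_complex_sq: "(norm v)\<^sup>2 = (\<Sum>i\<in>UNIV. (cmod (v $ i))\<^sup>2)" for v :: "complex ^ 'n"
  by (simp add: norm_vec_def L2_set_def sum_nonneg)

lemma norm_sum_scaleC_le:
  fixes v :: "complex ^ 'n"
  shows "norm (\<Sum>i\<in>UNIV. (v $ i) *\<^sub>C (x i :: 'h::complex_hilbert_space)) \<le> norm v * sqrt (\<Sum>i\<in>UNIV. (norm (x i))\<^sup>2)"
proof -
  have "norm (\<Sum>i\<in>UNIV. (v $ i) *\<^sub>C x i) \<le> (\<Sum>i\<in>UNIV. cmod (v $ i) * norm (x i))"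
    by (rule sum_norm_le) (simp add: norm_scaleC)
  also have "\<dots> \<le> norm v * sqrt (\<Sum>i\<in>UNIV. (norm (x i))\<^sup>2)"
    using Cauchy_Schwarz_sum[of "\<lambda>i. cmod (v $ i)" "\<lambda>i. norm (x i)" UNIV]
    by (simp add: norm_vec_def L2_set_def)
  finally show ?thesis .
qed

context
  fixes \<xi> :: "complex ^ 'n::finite"
  assumes \<xi>: "norm \<xi> < 1"
begin

abbreviation \<Delta> where "\<Delta> \<equiv> defect \<xi>"

lemma defect_pos: "0 < \<Delta>" and defect_le: "\<Delta> \<le> 1" and defect_sq: "\<Delta>\<^sup>2 = 1 - (norm \<xi>)\<^sup>2"
proof -
  have "(norm \<xi>)\<^sup>2 < 1" using \<xi> by (simp add: abs_square_less_1)
  then show "0 < \<Delta>" "\<Delta> \<le> 1" "\<Delta>\<^sup>2 = 1 - (norm \<xi>)\<^sup>2" by (simp_all add: defect_def)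
qed

lemma defect_sq_complex: "(\<Sum>i\<in>UNIV. cnj (\<xi> $ i) * \<xi> $ i) = 1 - (complex_of_real \<Delta>)\<^sup>2"
proof -
  have "(\<Sum>i\<in>UNIV. cnj (\<xi> $ i) * \<xi> $ i) = complex_of_real ((norm \<xi>)\<^sup>2)"
    unfolding norm_vec_complex_sq of_real_sum
    by (intro sum.cong refl) (metis complex_norm_square mult.commute)
  also have "\<dots> = complex_of_real (1 - \<Delta>\<^sup>2)" by (simp add: defect_sq)
  finally show ?thesis by simp
qed

text \<open>Since $\xi^*\xi$ has rank one, $(I - \xi^*\xi)^{1/2} = I - \xi^*\xi / (1 + \Delta_\xi)$.\<close>

lemma defect_adj_nth:
  "defect_adj \<xi> $ i $ j = (if i = j then 1 else 0) - cnj (\<xi> $ i) * \<xi> $ j / (1 + complex_of_real \<Delta>)"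
proof -
  define k where "k = 1 / (1 + complex_of_real \<Delta>)"
  define kr where "kr = 1 / (1 + \<Delta>)"
  have kkr: "k = complex_of_real kr" by (simp add: k_def kr_def)
  have D1: "1 + complex_of_real \<Delta> \<noteq> 0"
    using defect_pos by (metis add_pos_pos less_irrefl of_real_1 of_real_add of_real_eq_0_iff zero_less_one)
  define A :: "complex ^ 'n ^ 'n" where "A = mat 1 - (\<chi> i j. cnj (\<xi> $ i) * \<xi> $ j)"
  define S :: "complex ^ 'n ^ 'n" where "S = (\<chi> i j. (if i = j then 1 else 0) - k * (cnj (\<xi> $ i) * \<xi> $ j))"
  define d where "d = (\<lambda>v :: complex ^ 'n. \<Sum>j\<in>UNIV. \<xi> $ j * v $ j)"
  have Av: "A *v v = v - (\<chi> i. cnj (\<xi> $ i) * d v)" for v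
    by (simp add: vec_eq_iff A_def matrix_vector_mult_def mat_def d_def left_diff_distrib sum_subtractf
        sum_distrib_left mult.assoc if_distrib[of "\<lambda>c. c * _"] cong: if_cong)
  have Sv: "S *v v = v - k *s (\<chi> i. cnj (\<xi> $ i) * d v)" for v
    by (simp add: vec_eq_iff S_def matrix_vector_mult_def d_def left_diff_distrib sum_subtractf
        sum_distrib_left mult.assoc if_distrib[of "\<lambda>c. c * _"] cong: if_cong)
  then have SA: "S *v v = v - k *s (v - A *v v)" for v by (simp add: Av)
  \<comment> \<open>The row \<open>\<xi>\<close> is a left eigenvector of \<open>S\<close> with
    eigenvalue \<open>\<Delta>\<close>, since \<open>k\<close> times the squared norm of
    \<open>\<xi>\<close> is \<open>1 - \<Delta>\<close>. This makes the square of \<open>S\<close>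
    computable.\<close>
  have dS: "d (S *v v) = complex_of_real \<Delta> * d v" for v
  proof -
    have "d (S *v v) = d v - k * (\<Sum>j\<in>UNIV. cnj (\<xi> $ j) * \<xi> $ j) * d v"
      by (simp add: Sv d_def right_diff_distrib sum_subtractf sum_distrib_left sum_distrib_right mult_ac)
    also have "\<dots> = complex_of_real \<Delta> * d v"
      unfolding defect_sq_complex using D1 by (simp add: k_def field_simps power2_eq_square)
    finally show ?thesis .
  qed
  have SS: "S *v (S *v v) = A *v v" for v
  proof -
    have "k * (1 + complex_of_real \<Delta>) = 1" using D1 by (simp add: k_def)
    then have "k * c * complex_of_real \<Delta> + k * c = c" for c
      by (metis distrib_left mult.assoc mult.commute mult_1_left mult_1_right add.commute)
    then have "k * (c * (complex_of_real \<Delta> * e)) + k * (c * e) = c * e" for c e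
      by (metis (no_types, lifting) mult.assoc mult.commute)
    note * = this
    have "(S *v (S *v v)) $ i = (A *v v) $ i" for i
    proof -
      have "(S *v (S *v v)) $ i =
          v $ i - k * (cnj (\<xi> $ i) * d v) - k * (cnj (\<xi> $ i) * (complex_of_real \<Delta> * d v))"
        by (simp add: Sv[of "S *v v"] dS) (simp add: Sv)
      also have "\<dots> = (A *v v) $ i"
        using *[of "cnj (\<xi> $ i)" "d v"] by (simp add: Av diff_diff_eq add.commute)
      finally show ?thesis .
    qed
    then show ?thesis by (simp add: vec_eq_iff)
  qed
  have quad: "Re (\<Sum>i\<in>UNIV. cnj (v $ i) * (S *v v) $ i) = (norm v)\<^sup>2 - kr * (cmod (d v))\<^sup>2" for v
  proof -
    have "(\<Sum>i\<in>UNIV. cnj (v $ i) * (S *v v) $ i) =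
        (\<Sum>i\<in>UNIV. v $ i * cnj (v $ i)) - k * (cnj (d v) * d v)"
      by (simp add: Sv right_diff_distrib sum_subtractf)
        (simp add: d_def sum_distrib_left sum_distrib_right mult_ac)
    also have "\<dots> = complex_of_real ((norm v)\<^sup>2 - kr * (cmod (d v))\<^sup>2)"
      unfolding norm_vec_complex_sq
      by (simp add: kkr complex_norm_square mult.commute[of "cnj _"] del: of_real_power)
    finally show ?thesis by simp
  qed
  \<comment> \<open>Strict positivity of \<open>S\<close>, with lower bound \<open>\<Delta>\<close>:
    it gives the positivity of \<open>S\<close> as a square root and later forces
    uniqueness.\<close>
  have pos: "\<Delta> * (norm v)\<^sup>2 \<le> Re (\<Sum>i\<in>UNIV. cnj (v $ i) * (S *v v) $ i)" for v
  proof -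
    have "cmod (d v) \<le> (\<Sum>i\<in>UNIV. cmod (\<xi> $ i) * cmod (v $ i))"
      unfolding d_def by (rule sum_norm_le) (simp add: norm_mult)
    also have "\<dots> \<le> norm \<xi> * norm v"
      using Cauchy_Schwarz_sum[of "\<lambda>i. cmod (\<xi> $ i)" "\<lambda>i. cmod (v $ i)" UNIV]
      by (simp add: norm_vec_def L2_set_def)
    finally have "(cmod (d v))\<^sup>2 \<le> (norm \<xi> * norm v)\<^sup>2" by (intro power_mono) auto
    then have "kr * (cmod (d v))\<^sup>2 \<le> kr * ((1 - \<Delta>\<^sup>2) * (norm v)\<^sup>2)"
      using defect_pos by (intro mult_left_mono) (simp_all add: power_mult_distrib defect_sq kr_def)
    also have "\<dots> = (1 - \<Delta>) * (norm v)\<^sup>2"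
      using defect_pos by (simp add: kr_def field_simps power2_eq_square)
    finally show ?thesis unfolding quad by (simp add: left_diff_distrib)
  qed
  have "psd_sqrt A = S"
    unfolding psd_sqrt_def
  proof (rule the_equality)
    have "S ** S = A" by (simp add: matrix_eq SS matrix_vector_mul_assoc[symmetric])
    moreover have "0 \<le> Re (\<Sum>i\<in>UNIV. cnj (v $ i) * (S *v v) $ i)" for v
      using pos[of v] defect_pos by (smt (verit) mult_nonneg_nonneg zero_le_power2)
    ultimately show "psd_matrix S \<and> S ** S = A"
      unfolding psd_matrix_def by (auto simp: S_def kkr)
  next
    fix R assume R: "psd_matrix R \<and> R ** R = A"
    then have RR: "R *v (R *v v) = A *v v" for v by (simp add: matrix_vector_mul_assoc)
    \<comment> \<open>By \<open>SA\<close>, \<open>S\<close> is an affine function of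
      \<open>A\<close>, and \<open>A\<close> is the square of \<open>R\<close>; hence
      \<open>R\<close> and \<open>S\<close> commute.\<close>
    have RS: "R *v (S *v v) = S *v (R *v v)" for v
      unfolding SA by (simp add: matrix_vector_mult_diff_distrib vector_scalar_commute[symmetric] RR[symmetric])
    have "R *v v = S *v v" for v
    proof -
      \<comment> \<open>Commutation gives \<open>(R + S) u = (A - A) v = 0\<close>; pairing with
        \<open>u\<close>, positivity of \<open>R\<close> and strict positivity of \<open>S\<close>
        leave only \<open>u = 0\<close>.\<close>
      define u where "u = R *v v - S *v v"
      have "R *v u + S *v u = 0"
        by (simp add: u_def matrix_vector_mult_diff_distrib RR SS RS)
      then have "(\<Sum>i\<in>UNIV. cnj (u $ i) * (R *v u) $ i) + (\<Sum>i\<in>UNIV. cnj (u $ i) * (S *v u) $ i) = 0"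
        by (simp add: sum.distrib[symmetric] distrib_left[symmetric] vec_eq_iff)
      then have "Re (\<Sum>i\<in>UNIV. cnj (u $ i) * (R *v u) $ i) + Re (\<Sum>i\<in>UNIV. cnj (u $ i) * (S *v u) $ i) = 0"
        by (metis plus_complex.sel(1) zero_complex.sel(1))
      moreover have "0 \<le> Re (\<Sum>i\<in>UNIV. cnj (u $ i) * (R *v u) $ i)"
        using R by (simp add: psd_matrix_def)
      ultimately have "\<Delta> * (norm u)\<^sup>2 \<le> 0" using pos[of u] by linarith
      then have "u = 0" using defect_pos by (simp add: mult_le_0_iff)
      then show ?thesis by (simp add: u_def)
    qed
    then show "R = S" by (simp add: matrix_eq)
  qed
  then show ?thesis by (simp add: defect_adj_def A_def S_def k_def)
qed

definition lincomb :: "('n \<Rightarrow> 'h::complex_hilbert_space bounded_op) \<Rightarrow> 'h bounded_op"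
  where "lincomb X = (\<Sum>i\<in>UNIV. cnj (\<xi> $ i) *\<^sub>C X i)"

text \<open>With the square root explicit, the automorphism involves only \<open>X j\<close> and the
  single operator \<open>lincomb X\<close>, so later computations never return to matrix
  entries.\<close>

lemma ball_automorphism_eq:
  "ball_automorphism \<xi> X j = (\<xi> $ j) *\<^sub>C 1 -
    complex_of_real \<Delta> *\<^sub>C (op_inv (1 - lincomb X) * (X j - (\<xi> $ j / (1 + complex_of_real \<Delta>)) *\<^sub>C lincomb X))"
proof -
  have "(\<Sum>i\<in>UNIV. (defect_adj \<xi> $ i $ j) *\<^sub>C X i) =
      (\<Sum>i\<in>UNIV. (if i = j then X j else 0)) - (\<xi> $ j / (1 + complex_of_real \<Delta>)) *\<^sub>C lincomb X"
    unfolding lincomb_def scaleC_sum_right sum_subtractf[symmetric]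
    by (intro sum.cong) (auto simp: defect_adj_nth scaleC_diff_left scaleC_scaleC mult_ac)
  then show ?thesis by (simp add: ball_automorphism_def lincomb_def scaleR_conv_scaleC)
qed

lemma norm_lincomb_adj_le:
  assumes "X \<in> nc_cball r" "0 \<le> r"
  shows "norm (op_apply (op_adj (lincomb X)) h) \<le> norm \<xi> * r * norm h"
proof -
  have "norm (op_apply (op_adj (lincomb X)) h) = norm (\<Sum>i\<in>UNIV. (\<xi> $ i) *\<^sub>C op_apply (op_adj (X i)) h)"
    by (simp add: lincomb_def op_adj_sum op_adj_scaleC op_sum_apply op_apply_simps)
  also have "\<dots> \<le> norm \<xi> * sqrt (\<Sum>i\<in>UNIV. (norm (op_apply (op_adj (X i)) h))\<^sup>2)"
    by (rule norm_sum_scaleC_le)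
  also have "\<dots> \<le> norm \<xi> * (r * norm h)"
    using assms by (intro mult_left_mono real_le_lsqrt) (auto simp: nc_cball_def power_mult_distrib)
  finally show ?thesis by (simp add: mult.assoc)
qed

lemma norm_lincomb_le:
  assumes "X \<in> nc_ball"
  shows "norm (lincomb X) \<le> norm \<xi>"
proof (rule norm_op_le_adj)
  fix h
  obtain r where r: "0 \<le> r" "r < 1" "X \<in> nc_cball r" using nc_ball_imp_nc_cball[OF assms] .
  have "norm (op_apply (op_adj (lincomb X)) h) \<le> norm \<xi> * r * norm h"
    by (rule norm_lincomb_adj_le[OF r(3,1)])
  also have "\<dots> \<le> norm \<xi> * 1 * norm h" using r by (intro mult_right_mono mult_left_mono) auto
  finally show "norm (op_apply (op_adj (lincomb X)) h) \<le> norm \<xi> * norm h" by simp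
qed simp

lemma defect_complex: "complex_of_real \<Delta> \<noteq> 0" "1 + complex_of_real \<Delta> \<noteq> 0"
proof -
  show "complex_of_real \<Delta> \<noteq> 0" using defect_pos by simp
  have "complex_of_real (1 + \<Delta>) \<noteq> 0" using defect_pos by (simp del: of_real_add)
  then show "1 + complex_of_real \<Delta> \<noteq> 0" by simp
qed

text \<open>For the image \<open>Y\<close> of \<open>X\<close>, \<open>1 - lincomb Y\<close> turns
  out to be \<open>d\<^sup>2\<close> times the inverse \<open>V\<close> of \<open>1 - Z\<close>. The
  second resolvent is therefore a multiple of \<open>1 - Z\<close>, and multiplying by it on the
  left cancels every \<open>V\<close> in \<open>Y\<close>.\<close>

lemma ball_automorphism_involution:
  assumes X: "X \<in> nc_ball"
  shows "ball_automorphism \<xi> (ball_automorphism \<xi> X) = X"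
proof
  fix j
  define d where "d = complex_of_real \<Delta>"
  have d: "d \<noteq> 0" "1 + d \<noteq> 0" using defect_complex by (simp_all add: d_def)
  define Z where "Z = lincomb X"
  define V where "V = op_inv (1 - Z)"
  have V: "V * (1 - Z) = 1" "(1 - Z) * V = 1"
    using neumann(1,2)[OF norm_lincomb_le[OF X] \<xi>] by (simp_all add: V_def Z_def)
  then have VZ: "V * Z = V - 1" by (simp add: right_diff_distrib algebra_simps)
  define c where "c = (\<lambda>j. \<xi> $ j / (1 + d))"
  have "c i * (1 + d) = \<xi> $ i" for i using d by (simp add: c_def)
  then have cd: "c i * d + c i = \<xi> $ i" for i by (simp add: distrib_left add.commute)
  define Y where "Y = ball_automorphism \<xi> X"
  have Y: "Y i = (\<xi> $ i) *\<^sub>C 1 - d *\<^sub>C (V * (X i - c i *\<^sub>C Z))" for i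
    unfolding Y_def ball_automorphism_eq Z_def V_def d_def c_def ..
  have sc: "(\<Sum>i\<in>UNIV. cnj (\<xi> $ i) * c i) = 1 - d"
  proof -
    have "(\<Sum>i\<in>UNIV. cnj (\<xi> $ i) * c i) = (1 - d\<^sup>2) / (1 + d)"
      using defect_sq_complex by (simp add: c_def d_def sum_divide_distrib[symmetric])
    also have "1 - d\<^sup>2 = (1 - d) * (1 + d)" by (simp add: power2_eq_square algebra_simps)
    finally show ?thesis using d by simp
  qed
  have "(\<Sum>i\<in>UNIV. cnj (\<xi> $ i) *\<^sub>C (V * (X i - c i *\<^sub>C Z))) =
      V * (\<Sum>i\<in>UNIV. cnj (\<xi> $ i) *\<^sub>C X i) - (\<Sum>i\<in>UNIV. cnj (\<xi> $ i) * c i) *\<^sub>C (V * Z)"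
    by (simp add: sum_distrib_left scaleC_sum_left sum_subtractf[symmetric] right_diff_distrib
        op_mult_scaleC_right scaleC_diff_right scaleC_scaleC)
  also have "\<dots> = d *\<^sub>C (V * Z)"
    unfolding sc by (simp add: Z_def lincomb_def scaleC_diff_left)
  finally have VT: "(\<Sum>i\<in>UNIV. cnj (\<xi> $ i) *\<^sub>C (V * (X i - c i *\<^sub>C Z))) = d *\<^sub>C (V * Z)" .
  have "lincomb Y = (\<Sum>i\<in>UNIV. cnj (\<xi> $ i) * \<xi> $ i) *\<^sub>C 1 -
      d *\<^sub>C (\<Sum>i\<in>UNIV. cnj (\<xi> $ i) *\<^sub>C (V * (X i - c i *\<^sub>C Z)))"
    unfolding lincomb_def Y scaleC_diff_right sum_subtractf scaleC_sum_left scaleC_sum_right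
      scaleC_scaleC by (simp add: mult.commute[of d])
  then have "lincomb Y = (1 - d\<^sup>2) *\<^sub>C 1 - d *\<^sub>C d *\<^sub>C (V * Z)"
    unfolding VT defect_sq_complex d_def .
  then have W: "lincomb Y = 1 - d\<^sup>2 *\<^sub>C V"
    by (simp add: VZ scaleC_diff_left scaleC_diff_right scaleC_scaleC power2_eq_square)
  have inv: "op_inv (1 - lincomb Y) = (1 / d\<^sup>2) *\<^sub>C (1 - Z)"
    by (rule op_inv_eqI)
      (simp_all add: W V d op_mult_scaleC_left op_mult_scaleC_right scaleC_scaleC)
  have ZY: "(1 - Z) * Y j = (\<xi> $ j) *\<^sub>C (1 - Z) - d *\<^sub>C (X j - c j *\<^sub>C Z)"
    unfolding Y right_diff_distrib[of "1 - Z"] op_mult_scaleC_right mult.assoc[symmetric] V by simp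
  have ZW: "(1 - Z) * lincomb Y = (1 - Z) - d\<^sup>2 *\<^sub>C 1"
    unfolding W right_diff_distrib[of "1 - Z"] op_mult_scaleC_right V by simp
  have "(1 - Z) * (Y j - c j *\<^sub>C lincomb Y) =
      (\<xi> $ j - c j + c j * d\<^sup>2) *\<^sub>C 1 + (c j * d + c j - \<xi> $ j) *\<^sub>C Z - d *\<^sub>C X j"
    unfolding right_diff_distrib[of "1 - Z"] op_mult_scaleC_right ZY ZW
    by (simp add: scaleC_diff_left scaleC_diff_right scaleC_add_left scaleC_scaleC mult.commute)
  also have "\<dots> = (\<xi> $ j * d) *\<^sub>C 1 - d *\<^sub>C X j"
  proof -
    have "\<xi> $ j - c j + c j * d\<^sup>2 = \<xi> $ j * d"
      unfolding cd[of j, symmetric] by (simp add: algebra_simps power2_eq_square)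
    then show ?thesis by (simp add: cd)
  qed
  finally have B: "(1 - Z) * (Y j - c j *\<^sub>C lincomb Y) = (\<xi> $ j * d) *\<^sub>C 1 - d *\<^sub>C X j" .
  have "ball_automorphism \<xi> Y j = (\<xi> $ j) *\<^sub>C 1 -
      d *\<^sub>C ((1 / d\<^sup>2) *\<^sub>C ((1 - Z) * (Y j - c j *\<^sub>C lincomb Y)))"
    unfolding ball_automorphism_eq[of Y] inv op_mult_scaleC_left by (simp add: c_def d_def)
  also have "\<dots> = X j"
    unfolding B using d by (simp add: scaleC_scaleC scaleC_diff_right power2_eq_square)
  finally show "ball_automorphism \<xi> (ball_automorphism \<xi> X) j = X j"
    unfolding Y_def .
qed

text \<open>The computation behind the identity
  $I - \Phi_\xi(X)\Phi_\xi(X)^* = \Delta_\xi (I - Z)^{-1} (I - XX^*) (I - Z^*)^{-1} \Delta_\xi$,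
  where $Z = \sum_i \overline{\xi_i} X_i$.\<close>

lemma ball_automorphism_nc_cball:
  assumes r: "0 \<le> r" "r < 1" and X: "X \<in> nc_cball r"
  shows "ball_automorphism \<xi> X \<in> nc_cball (sqrt (1 - \<Delta>\<^sup>2 * (1 - r\<^sup>2) / 4))"
  unfolding nc_cball_def
proof (intro CollectI allI)
  fix h
  define Z where "Z = lincomb X"
  define V where "V = op_inv (1 - Z)"
  have V: "V * (1 - Z) = 1"
    using neumann(1)[OF norm_lincomb_le[OF nc_cball_subset_nc_ball[OF r(2) X r(1)]] \<xi>]
    by (simp add: V_def Z_def)
  \<comment> \<open>Working with \<open>k\<close> instead of \<open>h\<close> removes the resolvent:
    \<open>h = k - z\<close>, and all remaining terms are adjoints of the \<open>X i\<close> applied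
    to \<open>k\<close>.\<close>
  define k where "k = op_apply (op_adj V) h"
  define z where "z = op_apply (op_adj Z) k"
  define x where "x = (\<lambda>i. op_apply (op_adj (X i)) k)"
  define Q where "Q = (\<Sum>i\<in>UNIV. (norm (x i))\<^sup>2)"
  define e where "e = 1 / (1 + \<Delta>)"
  define u where "u = k - e *\<^sub>R z"
  have h: "h = k - z"
  proof -
    have "op_adj (1 - Z) * op_adj V = 1" by (simp add: op_adj_mult[symmetric] V)
    then have "op_apply (op_adj (1 - Z) * op_adj V) h = h" by (simp add: op_apply_simps)
    then show ?thesis by (simp add: op_apply_simps op_adj_diff k_def z_def)
  qed
  have z: "z = (\<Sum>i\<in>UNIV. (\<xi> $ i) *\<^sub>C x i)"
    by (simp add: z_def Z_def lincomb_def x_def op_adj_sum op_adj_scaleC op_sum_apply op_apply_simps)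
  \<comment> \<open>The coefficients of \<open>z\<close> from \<open>h\<close> and from the square
    root correction are \<open>- 1\<close> and \<open>\<Delta> * e\<close>; they add up to
    \<open>- e\<close>, which is why \<open>u\<close> was defined with \<open>e\<close>.\<close>
  have De: "1 - \<Delta> * e = e" using defect_pos by (simp add: e_def field_simps)
  have Yh: "op_apply (op_adj (ball_automorphism \<xi> X j)) h = cnj (\<xi> $ j) *\<^sub>C u - \<Delta> *\<^sub>R x j" for j
  proof -
    have "op_apply (op_adj (ball_automorphism \<xi> X j)) h =
        cnj (\<xi> $ j) *\<^sub>C h - complex_of_real \<Delta> *\<^sub>C (x j - (cnj (\<xi> $ j) / (1 + complex_of_real \<Delta>)) *\<^sub>C z)"
      by (simp add: ball_automorphism_eq op_adj_diff op_adj_scaleC op_adj_mult op_apply_simps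
          Z_def[symmetric] V_def[symmetric] k_def[symmetric] x_def z_def)
    also have "\<dots> = cnj (\<xi> $ j) *\<^sub>C (k - complex_of_real (1 - \<Delta> * e) *\<^sub>C z) - \<Delta> *\<^sub>R x j"
      by (simp add: h scaleC_diff_right scaleC_scaleC scaleR_conv_scaleC e_def scaleC_diff_left
          right_diff_distrib mult_ac)
    finally show ?thesis by (simp only: De u_def scaleR_conv_scaleC)
  qed
  have "(norm (cnj (\<xi> $ j) *\<^sub>C u - \<Delta> *\<^sub>R x j))\<^sup>2 =
      (cmod (\<xi> $ j))\<^sup>2 * (norm u)\<^sup>2 - 2 * \<Delta> * Re (cinner u ((\<xi> $ j) *\<^sub>C x j)) + \<Delta>\<^sup>2 * (norm (x j))\<^sup>2" for j
  proof -
    have "inner (cnj (\<xi> $ j) *\<^sub>C u) (x j) = Re (cinner u ((\<xi> $ j) *\<^sub>C x j))"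
      by (simp add: inner_conv_cinner cinner_scaleC_left cinner_scaleC_right)
    moreover have "(norm (cnj (\<xi> $ j) *\<^sub>C u))\<^sup>2 = (cmod (\<xi> $ j))\<^sup>2 * (norm u)\<^sup>2"
      by (simp add: norm_scaleC power_mult_distrib)
    moreover have "(norm (\<Delta> *\<^sub>R x j))\<^sup>2 = \<Delta>\<^sup>2 * (norm (x j))\<^sup>2" by (simp add: power_mult_distrib)
    moreover have "(norm (cnj (\<xi> $ j) *\<^sub>C u - \<Delta> *\<^sub>R x j))\<^sup>2 = (norm (cnj (\<xi> $ j) *\<^sub>C u))\<^sup>2
        - 2 * (\<Delta> * inner (cnj (\<xi> $ j) *\<^sub>C u) (x j)) + (norm (\<Delta> *\<^sub>R x j))\<^sup>2"
      unfolding power2_norm_eq_inner by (simp add: inner_diff_left inner_diff_right inner_commute)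
    ultimately show ?thesis by simp
  qed
  then have "(\<Sum>j\<in>UNIV. (norm (op_apply (op_adj (ball_automorphism \<xi> X j)) h))\<^sup>2) =
      (\<Sum>j\<in>UNIV. (cmod (\<xi> $ j))\<^sup>2) * (norm u)\<^sup>2 - 2 * \<Delta> * (\<Sum>j\<in>UNIV. Re (cinner u ((\<xi> $ j) *\<^sub>C x j))) + \<Delta>\<^sup>2 * Q"
    by (simp add: Yh sum.distrib sum_subtractf sum_distrib_left sum_distrib_right Q_def)
  also have "(\<Sum>j\<in>UNIV. Re (cinner u ((\<xi> $ j) *\<^sub>C x j))) = inner u z"
    by (simp add: z inner_conv_cinner cinner_sum_right)
  also have "(\<Sum>j\<in>UNIV. (cmod (\<xi> $ j))\<^sup>2) = 1 - \<Delta>\<^sup>2"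
    by (simp add: norm_vec_complex_sq[symmetric] defect_sq)
  also have "(norm u)\<^sup>2 = (norm k)\<^sup>2 - 2 * e * inner k z + e\<^sup>2 * (norm z)\<^sup>2"
    unfolding power2_norm_eq_inner
    by (simp add: u_def inner_diff_left inner_diff_right inner_commute power2_eq_square algebra_simps)
  also have "inner u z = inner k z - e * (norm z)\<^sup>2"
    by (simp add: u_def inner_diff_left power2_norm_eq_inner)
  finally have lhs: "(\<Sum>j\<in>UNIV. (norm (op_apply (op_adj (ball_automorphism \<xi> X j)) h))\<^sup>2) =
      (1 - \<Delta>\<^sup>2) * ((norm k)\<^sup>2 - 2 * e * inner k z + e\<^sup>2 * (norm z)\<^sup>2) - 2 * \<Delta> * (inner k z - e * (norm z)\<^sup>2) + \<Delta>\<^sup>2 * Q" .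
  have hh: "(norm h)\<^sup>2 = (norm k)\<^sup>2 - 2 * inner k z + (norm z)\<^sup>2"
    unfolding h power2_norm_eq_inner by (simp add: inner_diff_left inner_diff_right inner_commute)
  have e1: "e * (1 + \<Delta>) = 1" using defect_pos by (simp add: e_def)
  have i1: "(1 - \<Delta>\<^sup>2) * e = 1 - \<Delta>"
  proof -
    have "(1 - \<Delta>\<^sup>2) * e = (1 - \<Delta>) * (e * (1 + \<Delta>))" by (simp add: power2_eq_square algebra_simps)
    then show ?thesis by (simp add: e1)
  qed
  have i2: "(1 - \<Delta>) * e + 2 * \<Delta> * e = 1" using e1 by (simp add: algebra_simps)
  have "(1 - \<Delta>\<^sup>2) * (a - 2 * e * b + e\<^sup>2 * c) - 2 * \<Delta> * (b - e * c) + \<Delta>\<^sup>2 * Q = a - 2 * b + c - \<Delta>\<^sup>2 * (a - Q)"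
    for a b c :: real
  proof -
    have "(1 - \<Delta>\<^sup>2) * (a - 2 * e * b + e\<^sup>2 * c) - 2 * \<Delta> * (b - e * c) + \<Delta>\<^sup>2 * Q =
        (1 - \<Delta>\<^sup>2) * a - 2 * ((1 - \<Delta>\<^sup>2) * e) * b + (((1 - \<Delta>\<^sup>2) * e) * e + 2 * \<Delta> * e) * c - 2 * \<Delta> * b + \<Delta>\<^sup>2 * Q"
      by (simp add: algebra_simps power2_eq_square)
    also have "\<dots> = a - 2 * b + c - \<Delta>\<^sup>2 * (a - Q)"
      unfolding i1 i2 by (simp add: algebra_simps)
    finally show ?thesis .
  qed
  then have eq: "(\<Sum>j\<in>UNIV. (norm (op_apply (op_adj (ball_automorphism \<xi> X j)) h))\<^sup>2) =
      (norm h)\<^sup>2 - \<Delta>\<^sup>2 * ((norm k)\<^sup>2 - Q)"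
    unfolding lhs hh .
  have "Q \<le> r\<^sup>2 * (norm k)\<^sup>2" using X by (simp add: Q_def x_def nc_cball_def)
  then have "(1 - r\<^sup>2) * (norm k)\<^sup>2 \<le> (norm k)\<^sup>2 - Q" by (simp add: left_diff_distrib)
  \<comment> \<open>From \<open>norm h \<le> norm k + norm z \<le> 2 * norm k\<close>; this is the
    origin of the factor 4 in the radius. It bounds the gain below by a multiple of the squared norm
    of \<open>h\<close> that does not depend on \<open>X\<close>.\<close>
  moreover have "(norm h)\<^sup>2 / 4 \<le> (norm k)\<^sup>2"
  proof -
    have "norm z \<le> norm \<xi> * r * norm k"
      unfolding z_def Z_def by (rule norm_lincomb_adj_le[OF X r(1)])
    also have "\<dots> \<le> 1 * 1 * norm k" using \<xi> r by (intro mult_mono) auto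
    finally have "norm h \<le> 2 * norm k" unfolding h using norm_triangle_ineq4[of k z] by simp
    then have "(norm h)\<^sup>2 \<le> (2 * norm k)\<^sup>2" by (intro power_mono) auto
    then show ?thesis by (simp add: power_mult_distrib)
  qed
  moreover have r2: "0 \<le> 1 - r\<^sup>2" using r by (simp add: abs_square_le_1)
  ultimately have "(1 - r\<^sup>2) * ((norm h)\<^sup>2 / 4) \<le> (norm k)\<^sup>2 - Q"
    using mult_left_mono order_trans by blast
  then have "\<Delta>\<^sup>2 * ((1 - r\<^sup>2) * ((norm h)\<^sup>2 / 4)) \<le> \<Delta>\<^sup>2 * ((norm k)\<^sup>2 - Q)"
    by (intro mult_left_mono) auto
  moreover have "0 \<le> 1 - \<Delta>\<^sup>2 * (1 - r\<^sup>2) / 4"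
  proof -
    have "\<Delta>\<^sup>2 * (1 - r\<^sup>2) \<le> 1 * 1"
      using defect_pos defect_le r2 by (intro mult_mono) (auto simp: abs_square_le_1)
    then show ?thesis by simp
  qed
  moreover have "(1 - \<Delta>\<^sup>2 * (1 - r\<^sup>2) / 4) * (norm h)\<^sup>2 = (norm h)\<^sup>2 - \<Delta>\<^sup>2 * ((1 - r\<^sup>2) * ((norm h)\<^sup>2 / 4))"
    by (simp add: left_diff_distrib)
  ultimately show "(\<Sum>j\<in>UNIV. (norm (op_apply (op_adj (ball_automorphism \<xi> X j)) h))\<^sup>2)
      \<le> (sqrt (1 - \<Delta>\<^sup>2 * (1 - r\<^sup>2) / 4))\<^sup>2 * (norm h)\<^sup>2"
    unfolding eq by simp
qed

lemma ball_automorphism_nc_cball_ex: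
  assumes r: "0 \<le> r" "r < 1"
  shows "\<exists>s. 0 \<le> s \<and> s < 1 \<and>
    (\<forall>X\<in>(nc_cball r :: ('n \<Rightarrow> 'h::complex_hilbert_space bounded_op) set). ball_automorphism \<xi> X \<in> nc_cball s)"
proof (intro exI conjI ballI)
  have r2: "0 < 1 - r\<^sup>2" using r by (simp add: abs_square_less_1)
  have "\<Delta>\<^sup>2 * (1 - r\<^sup>2) \<le> 1 * 1"
    using defect_pos defect_le r r2 by (intro mult_mono) (auto simp: abs_square_le_1)
  then show "0 \<le> sqrt (1 - \<Delta>\<^sup>2 * (1 - r\<^sup>2) / 4)" by simp
  show "sqrt (1 - \<Delta>\<^sup>2 * (1 - r\<^sup>2) / 4) < 1" using r2 defect_pos by simp
qed (rule ball_automorphism_nc_cball[OF r])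

lemma ball_automorphism_nc_ball:
  assumes "X \<in> nc_ball"
  shows "ball_automorphism \<xi> X \<in> nc_ball"
proof -
  obtain r where r: "0 \<le> r" "r < 1" "X \<in> nc_cball r" using nc_ball_imp_nc_cball[OF assms] .
  then show ?thesis using ball_automorphism_nc_cball_ex[OF r(1,2)] nc_cball_subset_nc_ball by blast
qed

text \<open>The Neumann series converges at the rate of the powers of \<open>norm \<xi>\<close> on
  the entire ball, so mapping ball to ball pointwise is enough control of the inner map
  \<open>\<eta>\<close>.\<close>

lemma approximable_ball_automorphism:
  assumes "\<And>i. approximable (\<lambda>X. \<eta> X i)" and ball: "\<And>X. X \<in> nc_ball \<Longrightarrow> \<eta> X \<in> nc_ball"
  shows "approximable (\<lambda>X. ball_automorphism \<xi> (\<eta> X) j)"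
proof -
  have Z: "approximable (\<lambda>X. lincomb (\<eta> X))"
    unfolding lincomb_def by (intro approximable_sum approximable_scaleC assms)
  have "approximable (\<lambda>X. op_inv (1 - lincomb (\<eta> X)))"
    by (rule approximable_neumann[OF Z norm_lincomb_le[OF ball] \<xi>]) simp_all
  then show ?thesis
    unfolding ball_automorphism_eq
    by (intro approximable_diff approximable_const approximable_scaleC approximable_mult assms Z)
qed

lemma ball_automorphism_zero: "ball_automorphism \<xi> (\<lambda>i. 0) = scalar_tuple \<xi>"
  by (rule ext) (simp add: ball_automorphism_eq lincomb_def scalar_tuple_def scaleC_zero_right)

end

lemma zero_in_nc_cball: "(\<lambda>i. 0) \<in> nc_cball r"
  by (simp add: nc_cball_def op_apply_simps)

subsection \<open>Leading coefficients of a composition\<close>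

text \<open>The coefficients of a product of two free power series: each cut of a word into prefix
  and suffix contributes.\<close>

definition word_conv :: "('n list \<Rightarrow> complex) \<Rightarrow> ('n list \<Rightarrow> complex) \<Rightarrow> 'n list \<Rightarrow> complex"
  where "word_conv a u \<gamma> = (\<Sum>l\<le>length \<gamma>. a (take l \<gamma>) * u (drop l \<gamma>))"

lemma fock_model_apply:
  fixes X :: "'n::finite \<Rightarrow> 'h::complex_hilbert_space bounded_op"
  assumes g: "fock_model m r X g" and F: "(\<lambda>k. homog a k X) sums T"
  shows "op_apply T (\<Sum>\<beta> | length \<beta> \<le> m. u \<beta> *\<^sub>C g \<beta>) = (\<Sum>\<gamma> | length \<gamma> \<le> m. word_conv a u \<gamma> *\<^sub>C g \<gamma>)"
proof -
  define W where "W = {\<alpha> :: 'n list. length \<alpha> \<le> m}"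
  have W: "finite W" by (simp add: W_def)
  have "op_apply T (\<Sum>\<beta>\<in>W. u \<beta> *\<^sub>C g \<beta>) = (\<Sum>\<beta>\<in>W. \<Sum>\<alpha>\<in>W. (a \<alpha> * u \<beta>) *\<^sub>C g (\<alpha> @ \<beta>))"
    by (simp add: op_apply_sum op_apply_scaleC fock_model_sums[OF g F] W_def scaleC_sum_right scaleC_scaleC mult.commute)
  also have "\<dots> = (\<Sum>(\<alpha>, \<beta>)\<in>W \<times> W. (a \<alpha> * u \<beta>) *\<^sub>C g (\<alpha> @ \<beta>))"
    by (subst sum.swap) (simp add: sum.cartesian_product)
  also have "\<dots> = (\<Sum>(\<alpha>, \<beta>) | length \<alpha> + length \<beta> \<le> m. (a \<alpha> * u \<beta>) *\<^sub>C g (\<alpha> @ \<beta>))"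
  proof (rule sum.mono_neutral_right)
    show "\<forall>x\<in>W \<times> W - {(\<alpha>, \<beta>). length \<alpha> + length \<beta> \<le> m}.
        (case x of (\<alpha>, \<beta>) \<Rightarrow> (a \<alpha> * u \<beta>) *\<^sub>C g (\<alpha> @ \<beta>)) = 0"
    proof
      fix x assume "x \<in> W \<times> W - {(\<alpha>, \<beta>). length \<alpha> + length \<beta> \<le> m}"
      then obtain \<alpha> \<beta> where "x = (\<alpha>, \<beta>)" "\<not> length \<alpha> + length \<beta> \<le> m" by (cases x) auto
      then show "(case x of (\<alpha>, \<beta>) \<Rightarrow> (a \<alpha> * u \<beta>) *\<^sub>C g (\<alpha> @ \<beta>)) = 0"
        using g by (simp add: fock_model_def scaleC_zero_right)
    qed
  qed (use W in \<open>auto simp: W_def\<close>)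
  \<comment> \<open>A pair of words corresponds to their concatenation together with the cutting
    point.\<close>
  also have "\<dots> = (\<Sum>(\<gamma>, l)\<in>(SIGMA \<gamma>:W. {..length \<gamma>}). (a (take l \<gamma>) * u (drop l \<gamma>)) *\<^sub>C g \<gamma>)"
    by (rule sum.reindex_bij_witness[of _ "\<lambda>(\<gamma>, l). (take l \<gamma>, drop l \<gamma>)" "\<lambda>(\<alpha>, \<beta>). (\<alpha> @ \<beta>, length \<alpha>)"])
      (auto simp: W_def)
  also have "\<dots> = (\<Sum>\<gamma>\<in>W. word_conv a u \<gamma> *\<^sub>C g \<gamma>)"
    by (simp add: sum.Sigma[OF W, symmetric] word_conv_def scaleC_sum_left)
  finally show ?thesis by (simp add: W_def)
qed

text \<open>The coefficients of the product, along a word, of the series with coefficients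
  \<open>p i\<close>; applied to \<open>\<psi>\<close>, they expand
  \<open>word_eval (\<psi> X) \<beta>\<close>.\<close>

primrec word_power :: "('n \<Rightarrow> 'n list \<Rightarrow> complex) \<Rightarrow> 'n list \<Rightarrow> 'n list \<Rightarrow> complex"
  where
    "word_power p [] = (\<lambda>\<gamma>. if \<gamma> = [] then 1 else 0)"
  | "word_power p (i # \<beta>) = word_conv (p i) (word_power p \<beta>)"

text \<open>The entry at \<open>(\<beta>, \<gamma>)\<close> of a tensor power of \<open>A\<close>.
  It has this meaning for words of equal length only, as \<open>map2\<close> silently
  truncates.\<close>

definition tensor_entry :: "('n \<Rightarrow> 'n \<Rightarrow> complex) \<Rightarrow> 'n list \<Rightarrow> 'n list \<Rightarrow> complex"
  where "tensor_entry A \<beta> \<gamma> = prod_list (map2 A \<beta> \<gamma>)"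

lemma tensor_entry_simps [simp]:
  "tensor_entry A [] [] = 1" "tensor_entry A (i # \<beta>) (j # \<gamma>) = A i j * tensor_entry A \<beta> \<gamma>"
  by (simp_all add: tensor_entry_def)

text \<open>Without constant terms each factor uses up at least one letter of
  \<open>\<gamma>\<close>. Too short a word leaves nothing, and equal lengths force exactly one
  letter per factor, so only linear coefficients occur.\<close>

lemma word_power_leading:
  assumes p: "\<And>i. p i [] = 0"
  shows "(length \<gamma> < length \<beta> \<longrightarrow> word_power p \<beta> \<gamma> = 0) \<and>
    (length \<gamma> = length \<beta> \<longrightarrow> word_power p \<beta> \<gamma> = tensor_entry (\<lambda>i j. p i [j]) \<beta> \<gamma>)"
proof (induction \<beta> arbitrary: \<gamma>)
  case (Cons i \<beta>)
  show ?case
  proof (cases \<gamma>)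
    case Nil
    then show ?thesis by (simp add: word_conv_def p)
  next
    case (Cons j \<delta>)
    let ?t = "\<lambda>l. p i (take l (j # \<delta>)) * word_power p \<beta> (drop l (j # \<delta>))"
    have "word_power p (i # \<beta>) \<gamma> = ?t 0 + (\<Sum>l\<le>length \<delta>. ?t (Suc l))"
      by (simp only: Cons word_power.simps word_conv_def list.size add_Suc_right add_0_right sum.atMost_Suc_shift)
    also have "\<dots> = (\<Sum>l\<le>length \<delta>. p i (j # take l \<delta>) * word_power p \<beta> (drop l \<delta>))"
      by (simp add: p)
    finally have *: "word_power p (i # \<beta>) \<gamma> =
        (\<Sum>l\<le>length \<delta>. p i (j # take l \<delta>) * word_power p \<beta> (drop l \<delta>))" .
    show ?thesis
    proof (intro conjI impI)
      assume "length \<gamma> < length (i # \<beta>)"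
      then have "word_power p \<beta> (drop l \<delta>) = 0" for l
        using Cons.IH[of "drop l \<delta>"] Cons by auto
      then show "word_power p (i # \<beta>) \<gamma> = 0" unfolding * by simp
    next
      assume len: "length \<gamma> = length (i # \<beta>)"
      have "(\<Sum>l\<le>length \<delta>. p i (j # take l \<delta>) * word_power p \<beta> (drop l \<delta>)) =
          (\<Sum>l\<in>{0}. p i (j # take l \<delta>) * word_power p \<beta> (drop l \<delta>))"
      proof (rule sum.mono_neutral_right)
        show "\<forall>l\<in>{..length \<delta>} - {0}. p i (j # take l \<delta>) * word_power p \<beta> (drop l \<delta>) = 0"
        proof
          fix l assume "l \<in> {..length \<delta>} - {0}"
          then have "length (drop l \<delta>) < length \<beta>" using len Cons by auto
          then show "p i (j # take l \<delta>) * word_power p \<beta> (drop l \<delta>) = 0"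
            using Cons.IH[of "drop l \<delta>"] by simp
        qed
      qed auto
      then show "word_power p (i # \<beta>) \<gamma> = tensor_entry (\<lambda>i j. p i [j]) (i # \<beta>) \<gamma>"
        using Cons.IH[of \<delta>] len Cons unfolding * by simp
    qed
  qed
qed simp

text \<open>In the model truncated at order \<open>m\<close>, the parts of \<open>h\<close> of order
  below \<open>m\<close> vanish by assumption. Those above vanish on \<open>g []\<close> because
  their words only produce letters beyond the truncation. What remains compares order
  \<open>m\<close> on both sides.\<close>

lemma leading_coeff:
  fixes \<psi> :: "('n::finite \<Rightarrow> 'h::complex_hilbert_space bounded_op) \<Rightarrow> 'n \<Rightarrow> 'h bounded_op"
  assumes inf: "infinite_dim TYPE('h)"
    and p: "\<And>i. free_expansion (p i) (\<lambda>X. \<psi> X i)" and p0: "\<And>i. p i [] = 0"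
    and ball: "\<And>X. X \<in> nc_ball \<Longrightarrow> \<psi> X \<in> nc_ball"
    and h: "free_expansion a h" and q: "free_expansion b q"
    and eq: "\<And>X. X \<in> nc_ball \<Longrightarrow> h (\<psi> X) = c *\<^sub>C h X + q X"
    and low: "\<And>\<alpha>. length \<alpha> < m \<Longrightarrow> a \<alpha> = 0" and \<gamma>: "length \<gamma> = m"
  shows "(\<Sum>\<beta> | length \<beta> = m. a \<beta> * tensor_entry (\<lambda>i j. p i [j]) \<beta> \<gamma>) = c * a \<gamma> + b \<gamma>"
proof -
  obtain X :: "'n \<Rightarrow> 'h bounded_op" and g where g: "fock_model m (1/2) X g"
    using fock_model_exists[OF inf, of "1/2"] by auto
  have X: "X \<in> nc_ball" using g by (auto simp: fock_model_def intro: nc_cball_subset_nc_ball[of "1/2"])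
  have word: "op_apply (word_eval (\<psi> X) \<beta>) (g []) = (\<Sum>\<gamma> | length \<gamma> \<le> m. word_power p \<beta> \<gamma> *\<^sub>C g \<gamma>)" for \<beta>
  proof (induction \<beta>)
    case Nil
    have "(\<Sum>\<gamma> | length \<gamma> \<le> m. (if \<gamma> = [] then 1 else 0) *\<^sub>C g \<gamma>) = g []"
      by (simp add: if_distrib[of "\<lambda>c. c *\<^sub>C _"] cong: if_cong)
    then show ?case by (simp add: op_apply_simps)
  next
    case (Cons i \<beta>)
    have s: "(\<lambda>k. homog (p i) k X) sums \<psi> X i" by (rule free_expansion_sums[OF p X])
    show ?case
      by (simp add: op_apply_simps Cons fock_model_apply[OF g s])
  qed
  have homog: "op_apply (homog a k (\<psi> X)) (g []) =
      (\<Sum>\<gamma> | length \<gamma> \<le> m. (\<Sum>\<beta> | length \<beta> = k. a \<beta> * word_power p \<beta> \<gamma>) *\<^sub>C g \<gamma>)" for k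
    by (simp add: homog_def op_sum_apply op_apply_simps word scaleC_sum_right scaleC_sum_left scaleC_scaleC)
      (rule sum.swap)
  have "op_apply (homog a k (\<psi> X)) (g []) = 0" if "k \<noteq> m" for k
  proof (cases "k < m")
    case True
    then show ?thesis unfolding homog using low by simp
  next
    case False
    with that show ?thesis unfolding homog using word_power_leading[of p, OF p0] by simp
  qed
  then have "(\<lambda>k. op_apply (homog a k (\<psi> X)) (g [])) sums (\<Sum>k\<in>{m}. op_apply (homog a k (\<psi> X)) (g []))"
    by (intro sums_finite) auto
  moreover have "(\<lambda>k. op_apply (homog a k (\<psi> X)) (g [])) sums op_apply (h (\<psi> X)) (g [])"
    by (rule sums_op_apply[OF free_expansion_sums[OF h ball[OF X]]])
  ultimately have "op_apply (h (\<psi> X)) (g []) = op_apply (homog a m (\<psi> X)) (g [])"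
    using sums_unique2 by fastforce
  moreover have "op_apply (h (\<psi> X)) (g []) = (\<Sum>\<gamma> | length \<gamma> \<le> m. (c * a \<gamma> + b \<gamma>) *\<^sub>C g \<gamma>)"
    using fock_model_sums[OF g free_expansion_sums[OF h X], of "[]"]
      fock_model_sums[OF g free_expansion_sums[OF q X], of "[]"]
    by (simp add: eq[OF X] op_apply_simps scaleC_add_left sum.distrib scaleC_sum_right scaleC_scaleC)
  ultimately have "(\<Sum>\<beta> | length \<beta> = m. a \<beta> * word_power p \<beta> \<gamma>) = c * a \<gamma> + b \<gamma>"
    unfolding homog by (intro fock_model_unique[OF g]) (use \<gamma> in auto)
  moreover have "(\<Sum>\<beta> | length \<beta> = m. a \<beta> * word_power p \<beta> \<gamma>) =
      (\<Sum>\<beta> | length \<beta> = m. a \<beta> * tensor_entry (\<lambda>i j. p i [j]) \<beta> \<gamma>)"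
    by (rule sum.cong) (use word_power_leading[of p, OF p0] \<gamma> in auto)
  ultimately show ?thesis by simp
qed

subsection \<open>Eigenvalues of tensor powers\<close>

text \<open>Stated for an indexed family, so repetitions are possible: if two members coincide,
  their difference is the relation.\<close>

lemma real_dependence:
  fixes f :: "nat \<Rightarrow> 'a::euclidean_space"
  shows "\<exists>c. (\<exists>k\<le>DIM('a). c k \<noteq> 0) \<and> (\<Sum>k\<le>DIM('a). c k *\<^sub>R f k) = 0"
proof (cases "inj_on f {..DIM('a)}")
  case True
  then have "dependent (f ` {..DIM('a)})" by (intro dependent_biggerset) (auto simp: card_image)
  then obtain u where u: "\<exists>v\<in>f ` {..DIM('a)}. u v \<noteq> 0" "(\<Sum>v\<in>f ` {..DIM('a)}. u v *\<^sub>R v) = 0"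
    by (subst (asm) dependent_finite) auto
  then show ?thesis
    using sum.reindex[OF True, of "\<lambda>v. u v *\<^sub>R v"] by (intro exI[of _ "\<lambda>k. u (f k)"]) auto
next
  case False
  then obtain i j where ij: "i \<le> DIM('a)" "j \<le> DIM('a)" "i \<noteq> j" "f i = f j"
    by (auto simp: inj_on_def)
  define c where "c = (\<lambda>k. (if k = i then 1 else 0) - (if k = j then 1 else 0 :: real))"
  have "(\<Sum>k\<le>DIM('a). c k *\<^sub>R f k) =
      (\<Sum>k\<le>DIM('a). if k = i then f i else 0) - (\<Sum>k\<le>DIM('a). if k = j then f j else 0)"
    unfolding sum_subtractf[symmetric] by (rule sum.cong) (auto simp: c_def ij(4))
  also have "\<dots> = 0" using ij by simp
  finally show ?thesis using ij by (intro exI[of _ c]) (auto simp: c_def)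
qed

text \<open>A dimension count over the reals: enough powers of \<open>A\<close> are dependent. Only
  the existence of a nonzero annihilating polynomial matters below, not its degree.\<close>

lemma matrix_annihilating_poly:
  fixes A :: "complex ^ 'n ^ 'n"
  shows "\<exists>q. q \<noteq> 0 \<and> (\<forall>i j. (\<Sum>k\<le>degree q. coeff q k * (((\<lambda>B. B ** A) ^^ k) (mat 1)) $ i $ j) = 0)"
proof -
  define f where "f = (\<lambda>k. ((\<lambda>B. B ** A) ^^ k) (mat 1))"
  let ?N = "DIM(complex ^ 'n ^ 'n)"
  obtain c where c: "\<exists>k\<le>?N. c k \<noteq> 0" "(\<Sum>k\<le>?N. c k *\<^sub>R f k) = 0"
    using real_dependence[of f] by blast
  define q where "q = (\<Sum>k\<le>?N. monom (complex_of_real (c k)) k)"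
  have q: "coeff q k = (if k \<le> ?N then complex_of_real (c k) else 0)" for k
    by (simp add: q_def coeff_sum)
  have "q \<noteq> 0" using c(1) q by (metis coeff_0 of_real_eq_0_iff)
  moreover have "(\<Sum>k\<le>degree q. coeff q k * f k $ i $ j) = 0" for i j
  proof -
    have "degree q \<le> ?N" by (rule degree_le) (simp add: q)
    then have "(\<Sum>k\<le>degree q. coeff q k * f k $ i $ j) = (\<Sum>k\<le>?N. coeff q k * f k $ i $ j)"
      by (intro sum.mono_neutral_left) (auto simp: coeff_eq_0)
    also have "\<dots> = (\<Sum>k\<le>?N. c k *\<^sub>R f k) $ i $ j"
      by (simp add: q scaleR_conv_of_real[where 'a = complex])
    finally show ?thesis unfolding c(2) by simp
  qed
  ultimately show ?thesis unfolding f_def by blast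
qed

text \<open>Split off a root \<open>z\<close>, writing \<open>q\<close> as \<open>r\<close> times a
  linear factor. Either \<open>r\<close> applied to \<open>T\<close> also kills \<open>a\<close>,
  and the degree has dropped, or the vector it produces is an eigenvector for \<open>z\<close>. All
  iterates of \<open>a\<close> stay in \<open>V\<close>.\<close>

lemma eigenvector_in_invariant_subspace:
  fixes T :: "('k \<Rightarrow> complex) \<Rightarrow> 'k \<Rightarrow> complex"
  assumes T: "\<And>N c x. T (\<lambda>s. \<Sum>k\<le>(N::nat). c k * x k s) = (\<lambda>s. \<Sum>k\<le>N. c k * T (x k) s)"
    and V: "\<And>N c x. (\<And>k. x k \<in> V) \<Longrightarrow> (\<lambda>s. \<Sum>k\<le>(N::nat). c k * x k s) \<in> V"
    and TV: "\<And>x. x \<in> V \<Longrightarrow> T x \<in> V" and a: "a \<in> V" "a \<noteq> (\<lambda>s. 0)"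
    and q: "q \<noteq> 0" "\<And>s. (\<Sum>k\<le>degree q. coeff q k * (T ^^ k) a s) = 0"
  shows "\<exists>z b. b \<in> V \<and> b \<noteq> (\<lambda>s. 0) \<and> (\<forall>s. T b s = z * b s)"
  using q
proof (induction "degree q" arbitrary: q rule: less_induct)
  case less
  have deg: "degree q \<noteq> 0"
  proof
    assume "degree q = 0"
    then have "coeff q 0 * a s = 0" for s using less.prems(2)[of s] by simp
    moreover have "coeff q 0 \<noteq> 0" using \<open>degree q = 0\<close> less.prems(1) leading_coeff_neq_0[of q] by simp
    ultimately show False using a(2) by auto
  qed
  then obtain z where "poly q z = 0" using alg_closed_imp_poly_has_root by blast
  then obtain r where r: "q = [:- z, 1:] * r" by (auto simp: poly_eq_0_iff_dvd dvd_def)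
  have r0: "r \<noteq> 0" using less.prems(1) r by auto
  have dq: "degree q = Suc (degree r)"
    unfolding r using r0 by (subst degree_mult_eq) auto
  define b where "b = (\<lambda>s. \<Sum>k\<le>degree r. coeff r k * (T ^^ k) a s)"
  have Tk: "(T ^^ k) a \<in> V" for k by (induction k) (simp_all add: a TV)
  show ?case
  proof (cases "b = (\<lambda>s. 0)")
    case True
    then have "(\<Sum>k\<le>degree r. coeff r k * (T ^^ k) a s) = 0" for s
      unfolding b_def by (rule fun_cong)
    then show ?thesis using less.hyps[of r] dq r0 by simp
  next
    case False
    have "T b s = z * b s" for s
    proof -
      have cq: "coeff q k = coeff (pCons 0 r) k - z * coeff r k" for k
        by (simp add: r)
      have "0 = (\<Sum>k\<le>Suc (degree r). coeff q k * (T ^^ k) a s)"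
        using less.prems(2)[of s] by (simp add: dq)
      also have "\<dots> = (\<Sum>k\<le>Suc (degree r). coeff (pCons 0 r) k * (T ^^ k) a s) -
          z * (\<Sum>k\<le>Suc (degree r). coeff r k * (T ^^ k) a s)"
        by (simp only: cq left_diff_distrib sum_subtractf sum_distrib_left mult.assoc)
      also have "(\<Sum>k\<le>Suc (degree r). coeff (pCons 0 r) k * (T ^^ k) a s) =
          (\<Sum>k\<le>degree r. coeff r k * T ((T ^^ k) a) s)"
        by (simp only: sum.atMost_Suc_shift) simp
      also have "\<dots> = T b s" unfolding b_def T ..
      also have "(\<Sum>k\<le>Suc (degree r). coeff r k * (T ^^ k) a s) = b s"
        by (simp add: b_def coeff_eq_0)
      finally show ?thesis by simp
    qed
    moreover have "b \<in> V" unfolding b_def by (rule V[OF Tk])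
    ultimately show ?thesis using False by blast
  qed
qed

text \<open>A square matrix and its transpose are singular together, so a left null vector of
  \<open>A - mat z\<close> yields a right one.\<close>

lemma left_eigenvalue:
  fixes A :: "complex ^ 'n ^ 'n"
  assumes x: "x i0 \<noteq> 0" and eq: "\<And>j. (\<Sum>i\<in>UNIV. x i * A $ i $ j) = z * x j"
  shows "z \<in> eigenvalues A"
proof -
  define v where "v = (\<chi> i. x i)"
  define B where "B = A - mat z"
  have v: "v \<noteq> 0" using x by (auto simp: v_def vec_eq_iff)
  have "transpose B *v v = 0"
    using eq by (simp add: vec_eq_iff B_def transpose_def matrix_vector_mult_def v_def mat_def
        left_diff_distrib sum_subtractf if_distrib[of "\<lambda>c. c * _"] mult.commute[of "A $ _ $ _"] cong: if_cong)
  then have "\<not> (\<exists>C. C ** transpose B = mat 1)" using v matrix_left_invertible_ker by blast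
  then have "\<not> (\<exists>C. C ** B = mat 1)" using left_invertible_transpose matrix_left_right_inverse by blast
  then obtain w where w: "w \<noteq> 0" "B *v w = 0" using matrix_left_invertible_ker by blast
  have "A *v w = z *s w"
    using w(2) by (simp add: vec_eq_iff B_def matrix_vector_mult_def mat_def
        left_diff_distrib sum_subtractf if_distrib[of "\<lambda>c. c * _"] cong: if_cong)
  then show ?thesis using w(1) by (auto simp: eigenvalues_def)
qed

text \<open>\<open>A\<close> acting on the first letter commutes with its tensor power, so the eigenspace for \<open>c\<close>
  contains an eigenvector of this action; its slices are left eigenvectors of \<open>A\<close> and of the
  tensor power of order one less.\<close>

lemma tensor_left_eigenvalue:
  fixes A :: "complex ^ 'n::finite ^ 'n"
  assumes "\<And>\<gamma>. length \<gamma> = m \<Longrightarrow> (\<Sum>\<beta> | length \<beta> = m. a \<beta> * tensor_entry (\<lambda>i j. A $ i $ j) \<beta> \<gamma>) = c * a \<gamma>"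
    and "length \<delta> = m" "a \<delta> \<noteq> 0"
  shows "\<exists>cs. length cs = m \<and> set cs \<subseteq> eigenvalues A \<and> prod_list cs = c"
  using assms
proof (induction m arbitrary: a c \<delta>)
  case 0
  then have "c = 1" using "0.prems"(1)[of "[]"] by simp
  then show ?case by simp
next
  case (Suc m)
  let ?M = "tensor_entry (\<lambda>i j. A $ i $ j)"
  define V where "V = {b. (\<forall>\<gamma>. length \<gamma> \<noteq> Suc m \<longrightarrow> b \<gamma> = 0) \<and>
    (\<forall>\<gamma>. length \<gamma> = Suc m \<longrightarrow> (\<Sum>\<beta> | length \<beta> = Suc m. b \<beta> * ?M \<beta> \<gamma>) = c * b \<gamma>)}"
  define T where "T = (\<lambda>b \<gamma>. case \<gamma> of [] \<Rightarrow> 0 | j # \<gamma>' \<Rightarrow> \<Sum>i\<in>UNIV. b (i # \<gamma>') * A $ i $ j)"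
  \<comment> \<open>Values of \<open>a\<close> at words of other lengths are unconstrained; cutting
    them off puts the function into \<open>V\<close> and makes it vanish at the empty word.\<close>
  define a' where "a' = (\<lambda>\<beta>. if length \<beta> = Suc m then a \<beta> else 0)"
  obtain q where q: "q \<noteq> 0"
    "\<And>i j. (\<Sum>k\<le>degree q. coeff q k * (((\<lambda>B. B ** A) ^^ k) (mat 1)) $ i $ j) = 0"
    using matrix_annihilating_poly[of A] by blast
  have Tpow: "(T ^^ k) b (j # \<gamma>) = (\<Sum>i\<in>UNIV. b (i # \<gamma>) * (((\<lambda>B. B ** A) ^^ k) (mat 1)) $ i $ j)"
    for k b j \<gamma>
  proof (induction k arbitrary: j)
    case 0
    then show ?case by (simp add: mat_def if_distrib[of "\<lambda>c. _ * c"] cong: if_cong)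
  next
    case (Suc k)
    let ?B = "((\<lambda>B. B ** A) ^^ k) (mat 1)"
    have "(T ^^ Suc k) b (j # \<gamma>) = (\<Sum>l\<in>UNIV. (\<Sum>i\<in>UNIV. b (i # \<gamma>) * ?B $ i $ l) * A $ l $ j)"
      by (simp add: T_def Suc[unfolded T_def])
    also have "\<dots> = (\<Sum>i\<in>UNIV. b (i # \<gamma>) * (?B ** A) $ i $ j)"
      unfolding matrix_matrix_mult_def
      by (simp add: sum_distrib_left sum_distrib_right mult.assoc) (rule sum.swap)
    finally show ?case by simp
  qed
  have "\<exists>z b. b \<in> V \<and> b \<noteq> (\<lambda>\<gamma>. 0) \<and> (\<forall>\<gamma>. T b \<gamma> = z * b \<gamma>)"
  proof (rule eigenvector_in_invariant_subspace[OF _ _ _ _ _ q(1)])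
    fix N :: nat and d x
    show "T (\<lambda>s. \<Sum>k\<le>N. d k * x k s) = (\<lambda>s. \<Sum>k\<le>N. d k * T (x k) s)"
    proof
      fix s
      have "(\<Sum>i\<in>UNIV. (\<Sum>k\<le>N. d k * x k (i # s')) * A $ i $ j) =
          (\<Sum>k\<le>N. d k * (\<Sum>i\<in>UNIV. x k (i # s') * A $ i $ j))" for s' j
        by (simp add: sum_distrib_left sum_distrib_right mult.assoc) (rule sum.swap)
      then show "T (\<lambda>s. \<Sum>k\<le>N. d k * x k s) s = (\<Sum>k\<le>N. d k * T (x k) s)"
        by (simp add: T_def split: list.split)
    qed
  next
    fix N :: nat and d and x :: "nat \<Rightarrow> 'n list \<Rightarrow> complex"
    assume x: "\<And>k. x k \<in> V"
    have "(\<Sum>\<beta> | length \<beta> = Suc m. (\<Sum>k\<le>N. d k * x k \<beta>) * ?M \<beta> \<gamma>) = c * (\<Sum>k\<le>N. d k * x k \<gamma>)"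
      if \<gamma>: "length \<gamma> = Suc m" for \<gamma>
    proof -
      have "(\<Sum>\<beta> | length \<beta> = Suc m. (\<Sum>k\<le>N. d k * x k \<beta>) * ?M \<beta> \<gamma>) =
          (\<Sum>k\<le>N. d k * (\<Sum>\<beta> | length \<beta> = Suc m. x k \<beta> * ?M \<beta> \<gamma>))"
        by (simp add: sum_distrib_left sum_distrib_right mult.assoc) (rule sum.swap)
      also have "\<dots> = (\<Sum>k\<le>N. d k * (c * x k \<gamma>))"
        using x \<gamma> by (simp add: V_def)
      finally show ?thesis by (simp add: sum_distrib_left mult.left_commute)
    qed
    then show "(\<lambda>s. \<Sum>k\<le>N. d k * x k s) \<in> V" using x by (simp add: V_def)
  next
    fix b assume b: "b \<in> V"
    have "(\<Sum>\<beta> | length \<beta> = Suc m. T b \<beta> * ?M \<beta> \<gamma>) = c * T b \<gamma>" if \<gamma>: "length \<gamma> = Suc m" for \<gamma>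
    proof -
      obtain j \<gamma>' where j: "\<gamma> = j # \<gamma>'" "length \<gamma>' = m" using \<gamma> by (cases \<gamma>) auto
      let ?S = "\<lambda>i l. \<Sum>\<beta> | length \<beta> = m. b (l # \<beta>) * A $ l $ i * (A $ i $ j * ?M \<beta> \<gamma>')"
      have "(\<Sum>\<beta> | length \<beta> = Suc m. T b \<beta> * ?M \<beta> \<gamma>) = (\<Sum>i\<in>UNIV. \<Sum>l\<in>UNIV. ?S i l)"
        by (simp add: sum_words_Suc T_def j sum_distrib_right) (intro sum.cong refl sum.swap)
      also have "\<dots> = (\<Sum>i\<in>UNIV. (\<Sum>\<beta> | length \<beta> = Suc m. b \<beta> * ?M \<beta> (i # \<gamma>')) * A $ i $ j)"
        by (simp add: sum_words_Suc sum_distrib_left sum_distrib_right mult_ac)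
      also have "\<dots> = (\<Sum>i\<in>UNIV. c * b (i # \<gamma>') * A $ i $ j)"
        using b j by (simp add: V_def)
      finally show ?thesis by (simp add: T_def j sum_distrib_left mult.assoc)
    qed
    moreover have "T b \<gamma> = 0" if "length \<gamma> \<noteq> Suc m" for \<gamma>
      using b that by (auto simp: V_def T_def split: list.split)
    ultimately show "T b \<in> V" by (simp add: V_def)
  next
    show "a' \<in> V" using Suc.prems(1) by (simp add: V_def a'_def)
    show "a' \<noteq> (\<lambda>s. 0)" using Suc.prems(2,3) by (metis a'_def)
    show "(\<Sum>k\<le>degree q. coeff q k * (T ^^ k) a' s) = 0" for s
    proof (cases s)
      case Nil
      have "(T ^^ k) a' [] = 0" for k by (cases k) (simp_all add: a'_def T_def)
      then show ?thesis by (simp add: Nil)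
    next
      case (Cons j \<gamma>)
      have "(\<Sum>k\<le>degree q. coeff q k * (T ^^ k) a' s) =
          (\<Sum>i\<in>UNIV. a' (i # \<gamma>) * (\<Sum>k\<le>degree q. coeff q k * (((\<lambda>B. B ** A) ^^ k) (mat 1)) $ i $ j))"
        by (simp add: Cons Tpow sum_distrib_left mult.left_commute) (rule sum.swap)
      then show ?thesis by (simp add: q(2))
    qed
  qed
  then obtain z b where b: "b \<in> V" "b \<noteq> (\<lambda>\<gamma>. 0)" and Tb: "\<And>\<gamma>. T b \<gamma> = z * b \<gamma>" by blast
  have slice: "(\<Sum>i\<in>UNIV. b (i # \<gamma>) * A $ i $ j) = z * b (j # \<gamma>)" for j \<gamma>
    using Tb[of "j # \<gamma>"] by (simp add: T_def)
  obtain \<gamma> where "b \<gamma> \<noteq> 0" using b(2) by auto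
  moreover from this have "length \<gamma> = Suc m" using b(1) by (auto simp: V_def)
  ultimately obtain i0 \<gamma>0 where g0: "b (i0 # \<gamma>0) \<noteq> 0" "length \<gamma>0 = m" by (cases \<gamma>) auto
  have z: "z \<in> eigenvalues A"
    by (rule left_eigenvalue[of "\<lambda>i. b (i # \<gamma>0)" i0]) (use g0 slice in auto)
  have eig: "z * (\<Sum>\<beta> | length \<beta> = m. b (i0 # \<beta>) * ?M \<beta> \<gamma>) = c * b (i0 # \<gamma>)" if "length \<gamma> = m" for \<gamma>
  proof -
    have "c * b (i0 # \<gamma>) = (\<Sum>\<beta> | length \<beta> = Suc m. b \<beta> * ?M \<beta> (i0 # \<gamma>))"
      using b(1) that by (simp add: V_def)
    also have "\<dots> = (\<Sum>\<beta> | length \<beta> = m. (\<Sum>i\<in>UNIV. b (i # \<beta>) * A $ i $ i0) * ?M \<beta> \<gamma>)"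
      by (simp add: sum_words_Suc sum_distrib_right mult.assoc) (rule sum.swap)
    finally show ?thesis by (simp add: slice sum_distrib_left mult.assoc)
  qed
  show ?case
  proof (cases "z = 0")
    case True
    \<comment> \<open>Nothing is learnt here about the other factors, but \<open>c\<close> is 0 as
      well, so repeating the eigenvalue 0 gives the right length and product.\<close>
    then have "c = 0" using eig[OF g0(2)] g0(1) by simp
    then show ?thesis
      using z True by (intro exI[of _ "replicate (Suc m) z"]) auto
  next
    case False
    have "\<exists>cs. length cs = m \<and> set cs \<subseteq> eigenvalues A \<and> prod_list cs = c / z"
    proof (rule Suc.IH[of "\<lambda>\<beta>. b (i0 # \<beta>)" _ \<gamma>0])
      show "(\<Sum>\<beta> | length \<beta> = m. b (i0 # \<beta>) * ?M \<beta> \<gamma>) = c / z * b (i0 # \<gamma>)" if "length \<gamma> = m" for \<gamma>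
        using eig[OF that] False by (simp add: field_simps)
    qed (use g0 in auto)
    then obtain cs where "length cs = m" "set cs \<subseteq> eigenvalues A" "prod_list cs = c / z" by blast
    then show ?thesis using z False by (intro exI[of _ "z # cs"]) auto
  qed
qed

text \<open>The vector is the tensor product of right eigenvectors of \<open>A\<close>, one for each
  entry of \<open>cs\<close>. It will act as a functional on left coefficient vectors.\<close>

lemma tensor_right_eigenvector:
  fixes A :: "complex ^ 'n::finite ^ 'n"
  assumes "set cs \<subseteq> eigenvalues A"
  shows "\<exists>w. (\<exists>\<gamma>. length \<gamma> = length cs \<and> w \<gamma> \<noteq> 0) \<and>
    (\<forall>\<beta>. length \<beta> = length cs \<longrightarrow>
      (\<Sum>\<gamma> | length \<gamma> = length cs. tensor_entry (\<lambda>i j. A $ i $ j) \<beta> \<gamma> * w \<gamma>) = prod_list cs * w \<beta>)"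
  using assms
proof (induction cs)
  case Nil
  then show ?case by (intro exI[of _ "\<lambda>_. 1"]) simp
next
  case (Cons c cs)
  let ?M = "tensor_entry (\<lambda>i j. A $ i $ j)"
  obtain w \<delta> where \<delta>: "length \<delta> = length cs" "w \<delta> \<noteq> 0"
    and w: "\<And>\<beta>. length \<beta> = length cs \<Longrightarrow>
      (\<Sum>\<gamma> | length \<gamma> = length cs. ?M \<beta> \<gamma> * w \<gamma>) = prod_list cs * w \<beta>"
    using Cons by auto
  obtain v where v: "v \<noteq> 0" "A *v v = c *s v" using Cons.prems by (auto simp: eigenvalues_def)
  obtain i where i: "v $ i \<noteq> 0" using v(1) by (auto simp: vec_eq_iff)
  have Av: "(\<Sum>j\<in>UNIV. A $ l $ j * v $ j) = c * v $ l" for l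
    using v(2) by (simp add: vec_eq_iff matrix_vector_mult_def)
  define w' where "w' = (\<lambda>\<gamma>. v $ hd \<gamma> * w (tl \<gamma>))"
  have "(\<Sum>\<gamma> | length \<gamma> = length (c # cs). ?M \<beta> \<gamma> * w' \<gamma>) = prod_list (c # cs) * w' \<beta>"
    if \<beta>: "length \<beta> = length (c # cs)" for \<beta>
  proof -
    obtain l \<beta>' where l: "\<beta> = l # \<beta>'" "length \<beta>' = length cs" using \<beta> by (auto simp: length_Suc_conv)
    have "(\<Sum>\<gamma> | length \<gamma> = length (c # cs). ?M \<beta> \<gamma> * w' \<gamma>) =
        (\<Sum>j\<in>UNIV. A $ l $ j * v $ j) * (\<Sum>\<gamma> | length \<gamma> = length cs. ?M \<beta>' \<gamma> * w \<gamma>)"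
      by (simp add: sum_words_Suc w'_def l sum_product mult_ac)
    then show ?thesis by (simp add: Av w l w'_def)
  qed
  moreover have "w' (i # \<delta>) \<noteq> 0" using i \<delta> by (simp add: w'_def)
  moreover have "length (i # \<delta>) = length (c # cs)" using \<delta>(1) by simp
  ultimately show ?case by blast
qed

section \<open>Values at the origin and the proof of the theorem\<close>

lemma homog_at_zero:
  "homog a k (\<lambda>i :: 'n::finite. 0) = (if k = 0 then a [] *\<^sub>C (1 :: 'h::complex_hilbert_space bounded_op) else 0)"
proof (cases k)
  case (Suc l)
  have "word_eval (\<lambda>i. 0) \<alpha> = (0 :: 'h bounded_op)" if "length \<alpha> = k" for \<alpha> :: "'n list"
    using that Suc by (cases \<alpha>) auto
  then show ?thesis using Suc by (simp add: homog_def scaleC_zero_right)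
qed (simp add: homog_def)

lemma free_expansion_at_zero:
  fixes F :: "('n::finite \<Rightarrow> 'h::complex_hilbert_space bounded_op) \<Rightarrow> 'h bounded_op"
  assumes inf: "infinite_dim TYPE('h)" and F: "free_expansion a F" and F0: "F (\<lambda>i. 0) = 0"
  shows "a [] = 0"
proof (rule ccontr)
  assume a: "a [] \<noteq> 0"
  have "(\<lambda>i. 0) \<in> (nc_ball :: ('n \<Rightarrow> 'h bounded_op) set)"
    by (rule nc_cball_subset_nc_ball[of 0]) (simp_all add: zero_in_nc_cball)
  then have "(\<lambda>k. homog a k (\<lambda>i. 0)) sums F (\<lambda>i. 0)" by (rule free_expansion_sums[OF F])
  moreover have "(\<lambda>k. homog a k (\<lambda>i. 0)) sums (\<Sum>k\<in>{0}. homog a k (\<lambda>i. 0 :: 'h bounded_op))"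
    by (rule sums_finite) (auto simp: homog_at_zero)
  ultimately have "a [] *\<^sub>C (1 :: 'h bounded_op) = 0"
    using F0 sums_unique2 by (fastforce simp: homog_at_zero)
  then have "op_apply (a [] *\<^sub>C (1 :: 'h bounded_op)) x = 0" for x by (simp add: op_apply_simps)
  then have "a [] *\<^sub>C x = 0" for x :: 'h by (simp add: op_apply_simps)
  then have "x = 0" for x :: 'h using a norm_scaleC[of "a []" x] by simp
  \<comment> \<open>If the identity operator were 0, the space would be trivial and spanned by the
    empty set.\<close>
  then have "\<forall>x :: 'h. \<exists>c. x = (\<Sum>b\<in>{}. c b *\<^sub>C b)" by simp
  then show False using inf unfolding infinite_dim_def by (metis finite.emptyI)
qed

lemma free_expansion_homog:
  assumes "\<And>\<alpha>. length \<alpha> \<noteq> m \<Longrightarrow> b \<alpha> = 0"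
  shows "free_expansion b (homog b m)"
  unfolding free_expansion_iff
proof (intro conjI allI impI ballI)
  fix \<rho> :: real assume "1 < \<rho>"
  show "\<forall>\<^sub>F k in sequentially. (\<Sum>\<alpha> | length \<alpha> = k. (cmod (b \<alpha>))\<^sup>2) \<le> \<rho> ^ (2 * k)"
    using eventually_gt_at_top[of m]
  proof eventually_elim
    case (elim k)
    then have "(\<Sum>\<alpha> | length \<alpha> = k. (cmod (b \<alpha>))\<^sup>2) = 0" using assms by simp
    then show ?case using \<open>1 < \<rho>\<close> by simp
  qed
next
  fix X :: "'a \<Rightarrow> 'b bounded_op"
  have "(\<lambda>k. homog b k X) sums (\<Sum>k\<in>{m}. homog b k X)"
    by (rule sums_finite) (auto simp: homog_def assms)
  then show "(\<lambda>k. homog b k X) sums homog b m X" by simp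
qed

text \<open>The value 1 is the empty product, so it becomes the case of order 0 instead of a
  separate one.\<close>

lemma insert_one_eigenvalue_products:
  "{1} \<union> eigenvalue_products A = {prod_list cs | cs. set cs \<subseteq> eigenvalues A}"
proof (intro equalityI subsetI)
  fix c assume "c \<in> {1} \<union> eigenvalue_products A"
  then show "c \<in> {prod_list cs | cs. set cs \<subseteq> eigenvalues A}"
    unfolding eigenvalue_products_def by (auto intro: exI[of _ "[]"])
next
  fix c assume "c \<in> {prod_list cs | cs. set cs \<subseteq> eigenvalues A}"
  then obtain cs where "c = prod_list cs" "set cs \<subseteq> eigenvalues A" by blast
  then show "c \<in> {1} \<union> eigenvalue_products A"
    by (cases "cs = []") (auto simp: eigenvalue_products_def)
qed

theorem theorem6p4:
  fixes \<phi> :: "('n::finite \<Rightarrow> 'h::complex_hilbert_space bounded_op) \<Rightarrow> 'n \<Rightarrow> 'h bounded_op"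
    and \<xi> :: "complex ^ 'n"
  assumes separable: "\<exists>D :: 'h set. countable D \<and> closure D = UNIV"
    and infinite_dimensional: "\<not> (\<exists>B :: 'h set. finite B \<and> (\<forall>x. \<exists>c. x = (\<Sum>b\<in>B. c b *\<^sub>C b)))"
    and self_map: "free_holomorphic_self_map \<phi>"
    and in_ball: "norm \<xi> < 1"
    and fixed_point: "\<phi> (scalar_tuple \<xi>) = scalar_tuple \<xi>"
  shows "H2_point_spectrum (composition_operator \<phi>)
      \<subseteq> {1} \<union> eigenvalue_products
          (linear_part_matrix (ball_automorphism \<xi> \<circ> \<phi> \<circ> ball_automorphism \<xi>)) \<and>
    {1} \<union> eigenvalue_products
          (linear_part_matrix (ball_automorphism \<xi> \<circ> \<phi> \<circ> ball_automorphism \<xi>))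
      \<subseteq> H2_spectrum (composition_operator \<phi>)"
proof -
  have inf: "infinite_dim TYPE('h)" using infinite_dimensional by (simp add: infinite_dim_def)
  define \<Phi> where "\<Phi> = (ball_automorphism \<xi> :: ('n \<Rightarrow> 'h bounded_op) \<Rightarrow> 'n \<Rightarrow> 'h bounded_op)"
  have \<Phi>_ball: "\<Phi> X \<in> nc_ball" if "X \<in> nc_ball" for X
    unfolding \<Phi>_def by (rule ball_automorphism_nc_ball[OF in_ball that])
  have \<Phi>_\<Phi>: "\<Phi> (\<Phi> X) = X" if "X \<in> nc_ball" for X
    unfolding \<Phi>_def by (rule ball_automorphism_involution[OF in_ball that])
  have \<Phi>_approx: "approximable (\<lambda>X. \<Phi> X i)" for i
    unfolding \<Phi>_def
    by (rule approximable_ball_automorphism[OF in_ball approximable_free_poly[OF free_poly_coord]])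
  have compose: "approximable (\<lambda>X. f (\<Phi> X))" if "approximable f" for f
    unfolding \<Phi>_def
    by (rule approximable_compose[OF that \<Phi>_approx[unfolded \<Phi>_def] ball_automorphism_nc_cball_ex[OF in_ball]])
  have \<phi>_ball: "\<phi> X \<in> nc_ball" if "X \<in> nc_ball" for X
    using self_map that by (simp add: free_holomorphic_self_map_def)
  define \<psi> where "\<psi> = \<Phi> \<circ> \<phi> \<circ> \<Phi>"
  have \<psi>_ball: "\<psi> X \<in> nc_ball" if "X \<in> nc_ball" for X
    using that by (simp add: \<psi>_def \<Phi>_ball \<phi>_ball)
  have "approximable (\<lambda>X. \<phi> X i)" for i
    unfolding free_holomorphic_iff_approximable[OF inf, symmetric]
    using self_map by (simp add: free_holomorphic_self_map_def)
  then have "approximable (\<lambda>X. \<phi> (\<Phi> X) i)" for i by (rule compose)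
  then have "approximable (\<lambda>X. \<psi> X i)" for i
    using approximable_ball_automorphism[OF in_ball, of "\<lambda>X. \<phi> (\<Phi> X)" i] \<Phi>_ball \<phi>_ball
    by (simp add: \<psi>_def \<Phi>_def)
  then have "\<exists>a. free_expansion a (\<lambda>X. \<psi> X i)" for i
    unfolding free_holomorphic_def[symmetric] free_holomorphic_iff_approximable[OF inf] .
  then obtain p where p: "\<And>i. free_expansion (p i) (\<lambda>X. \<psi> X i)" by metis
  have zero: "(\<lambda>i. 0) \<in> (nc_ball :: ('n \<Rightarrow> 'h bounded_op) set)"
    by (rule nc_cball_subset_nc_ball[of 0]) (simp_all add: zero_in_nc_cball)
  have "\<Phi> (\<lambda>i. 0) = scalar_tuple \<xi>"
    unfolding \<Phi>_def by (rule ball_automorphism_zero[OF in_ball])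
  \<comment> \<open>The automorphism sends 0 to the fixed point; being an involution, it sends the
    fixed point back to 0.\<close>
  then have "\<psi> (\<lambda>i. 0) = (\<lambda>i. 0)" using \<Phi>_\<Phi>[OF zero] by (simp add: \<psi>_def fixed_point)
  then have p0: "p i [] = 0" for i
    using free_expansion_at_zero[OF inf p] by simp
  define A where "A = linear_part_matrix \<psi>"
  have A: "A $ i $ j = p i [j]" for i j
    by (simp add: A_def linear_part_matrix_def free_coeff_eq[OF inf p])
  have lead: "(\<Sum>\<beta> | length \<beta> = m. a \<beta> * tensor_entry (\<lambda>i j. A $ i $ j) \<beta> \<gamma>) = c * a \<gamma> + b \<gamma>"
    if "free_expansion a h" "free_expansion b q" "\<And>X. X \<in> nc_ball \<Longrightarrow> h (\<psi> X) = c *\<^sub>C h X + q X"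
      "\<And>\<alpha>. length \<alpha> < m \<Longrightarrow> a \<alpha> = 0" "length \<gamma> = m" for a b h q c m \<gamma>
    unfolding A by (rule leading_coeff[OF inf p p0 \<psi>_ball that])
  \<comment> \<open>Used for both inclusions: with zero right-hand side it exhibits \<open>c\<close>
    as a product; with a right-hand side of order \<open>m\<close> it rules out coefficients of
    lower order.\<close>
  have lowest: "\<exists>cs. length cs \<le> length \<alpha> \<and> set cs \<subseteq> eigenvalues A \<and> prod_list cs = c"
    if h: "free_expansion a h" and q: "free_expansion b q"
      and eq: "\<And>X. X \<in> nc_ball \<Longrightarrow> h (\<psi> X) = c *\<^sub>C h X + q X"
      and b: "\<And>\<gamma>. length \<gamma> \<le> length \<alpha> \<Longrightarrow> b \<gamma> = 0" and \<alpha>: "a \<alpha> \<noteq> 0" for a b h q c \<alpha>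
  proof -
    define m where "m = (LEAST m. \<exists>\<alpha>. length \<alpha> = m \<and> a \<alpha> \<noteq> 0)"
    have "\<exists>\<delta>. length \<delta> = m \<and> a \<delta> \<noteq> 0"
      unfolding m_def by (rule LeastI[of _ "length \<alpha>"]) (use \<alpha> in blast)
    then obtain \<delta> where \<delta>: "length \<delta> = m" "a \<delta> \<noteq> 0" by blast
    have m: "m \<le> length \<alpha>" unfolding m_def by (rule Least_le) (use \<alpha> in blast)
    have low: "a \<beta> = 0" if "length \<beta> < m" for \<beta>
      using not_less_Least[of "length \<beta>" "\<lambda>m. \<exists>\<alpha>. length \<alpha> = m \<and> a \<alpha> \<noteq> 0"] that
      unfolding m_def by blast
    have "(\<Sum>\<beta> | length \<beta> = m. a \<beta> * tensor_entry (\<lambda>i j. A $ i $ j) \<beta> \<gamma>) = c * a \<gamma>" if "length \<gamma> = m" for \<gamma>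
      using lead[OF h q eq low that] b[of \<gamma>] that m by simp
    from tensor_left_eigenvalue[OF this \<delta>] show ?thesis using m by auto
  qed
  have "c \<in> {1} \<union> eigenvalue_products A" if "c \<in> H2_point_spectrum (composition_operator \<phi>)" for c
  proof -
    obtain f where f: "f \<in> H2_ball" "f \<noteq> (\<lambda>X. 0)" "composition_operator \<phi> f = (\<lambda>X. c *\<^sub>C f X)"
      using \<open>c \<in> H2_point_spectrum _\<close> unfolding H2_point_spectrum_def by blast
    have f_eq: "f (\<phi> X) = c *\<^sub>C f X" if "X \<in> nc_ball" for X
      using fun_cong[OF f(3), of X] that by (simp add: composition_operator_def)
    have "approximable f"
      unfolding free_holomorphic_iff_approximable[OF inf, symmetric] using f(1) by (simp add: H2_ball_def)
    then have "free_holomorphic (\<lambda>X. f (\<Phi> X))"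
      unfolding free_holomorphic_iff_approximable[OF inf] by (rule compose)
    then obtain a where a: "free_expansion a (\<lambda>X. f (\<Phi> X))" unfolding free_holomorphic_def ..
    have "\<exists>\<alpha>. a \<alpha> \<noteq> 0"
    proof (rule ccontr)
      assume "\<nexists>\<alpha>. a \<alpha> \<noteq> 0"
      then have "homog a k X = 0" for k and X :: "'n \<Rightarrow> 'h bounded_op" by (simp add: homog_def)
      then have "f (\<Phi> X) = 0" if "X \<in> nc_ball" for X
        using free_expansion_sums[OF a that] sums_unique2[OF sums_zero] by simp
      \<comment> \<open>Every point of the ball is in the range of the involution, and elements of
        the Hardy space vanish outside the ball.\<close>
      then have "f X = 0" for X
        using \<Phi>_\<Phi>[of X] \<Phi>_ball[of X] f(1) unfolding H2_ball_def
        by (cases "X \<in> nc_ball") (metis (no_types, lifting), blast)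
      then show False using f(2) by blast
    qed
    then obtain \<alpha> where \<alpha>: "a \<alpha> \<noteq> 0" by blast
    have "\<exists>cs. length cs \<le> length \<alpha> \<and> set cs \<subseteq> eigenvalues A \<and> prod_list cs = c"
    proof (rule lowest[OF a free_expansion_homog[of 0 "\<lambda>_. 0"]])
      fix X :: "'n \<Rightarrow> 'h bounded_op" assume X: "X \<in> nc_ball"
      show "f (\<Phi> (\<psi> X)) = c *\<^sub>C f (\<Phi> X) + homog (\<lambda>_. 0) 0 X"
        using X by (simp add: \<psi>_def \<Phi>_\<Phi> \<Phi>_ball \<phi>_ball f_eq homog_def)
    qed (simp_all add: \<alpha>)
    then show ?thesis unfolding insert_one_eigenvalue_products by blast
  qed
  moreover have "c \<in> H2_spectrum (composition_operator \<phi>)" if "c \<in> {1} \<union> eigenvalue_products A" for c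
  proof (rule ccontr)
    assume "c \<notin> H2_spectrum (composition_operator \<phi>)"
    then obtain S where S: "H2_bounded_operator S"
      "\<And>f. f \<in> H2_ball \<Longrightarrow> (\<lambda>X. composition_operator \<phi> (S f) X - c *\<^sub>C S f X) = f"
      unfolding H2_spectrum_def by blast
    \<comment> \<open>No shorter list of eigenvalues has product \<open>c\<close>, so a nonzero
      coefficient of order below \<open>m\<close> would contradict \<open>lowest\<close>.\<close>
    define m where "m = (LEAST m. \<exists>cs. length cs = m \<and> set cs \<subseteq> eigenvalues A \<and> prod_list cs = c)"
    obtain cs0 where cs0: "set cs0 \<subseteq> eigenvalues A" "prod_list cs0 = c"
      using \<open>c \<in> {1} \<union> _\<close> unfolding insert_one_eigenvalue_products by blast
    have "\<exists>cs. length cs = m \<and> set cs \<subseteq> eigenvalues A \<and> prod_list cs = c"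
      unfolding m_def by (rule LeastI[of _ "length cs0"]) (use cs0 in blast)
    then obtain cs where cs: "length cs = m" "set cs \<subseteq> eigenvalues A" "prod_list cs = c" by blast
    have minimal: "m \<le> length ds" if "set ds \<subseteq> eigenvalues A" "prod_list ds = c" for ds
      unfolding m_def by (rule Least_le) (use that in blast)
    obtain w \<delta> where \<delta>: "length \<delta> = m" "w \<delta> \<noteq> 0"
      and w: "\<And>\<beta>. length \<beta> = m \<Longrightarrow>
        (\<Sum>\<gamma> | length \<gamma> = m. tensor_entry (\<lambda>i j. A $ i $ j) \<beta> \<gamma> * w \<gamma>) = c * w \<beta>"
      using tensor_right_eigenvector[OF cs(2)] cs by auto
    \<comment> \<open>Conjugating makes the bilinear pairing of \<open>b\<close> with
      \<open>w\<close> the positive number given by the sum of the squared moduli of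
      \<open>w\<close>.\<close>
    define b where "b = (\<lambda>\<alpha>. if length \<alpha> = m then cnj (w \<alpha>) else 0)"
    define P where "P = (homog b m :: ('n \<Rightarrow> 'h bounded_op) \<Rightarrow> 'h bounded_op)"
    have b: "free_expansion b P" unfolding P_def by (rule free_expansion_homog) (simp add: b_def)
    have P: "P \<in> free_poly" unfolding P_def by (rule free_poly_homog)
    \<comment> \<open>After the change of variables \<open>g\<close> becomes the polynomial
      \<open>P\<close> itself, by the involution. On the original side it is merely bounded, which
      suffices for membership in \<open>H2_ball\<close>.\<close>
    define g where "g = (\<lambda>X. if X \<in> nc_ball then P (\<Phi> X) else 0)"
    have "approximable g"
      by (rule approximable_cong[OF approximable_free_poly_compose[OF P \<Phi>_approx]]) (simp add: g_def)
    moreover obtain M where "\<forall>X\<in>nc_ball. norm (P X) \<le> M" using free_poly_bounded[OF P] by blast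
    then have "norm (g X) \<le> M" if "X \<in> nc_ball" for X using that \<Phi>_ball by (simp add: g_def)
    moreover have "g X = 0" if "X \<notin> nc_ball" for X using that by (simp add: g_def)
    ultimately have g: "g \<in> H2_ball" by (rule bounded_in_H2_ball[OF inf])
    define f where "f = S g"
    have f_ball: "f \<in> H2_ball" using S(1) g unfolding H2_bounded_operator_def f_def by blast
    have f_eq: "f (\<phi> X) = c *\<^sub>C f X + P (\<Phi> X)" if "X \<in> nc_ball" for X
    proof -
      have "f (\<phi> X) - c *\<^sub>C f X = g X"
        using fun_cong[OF S(2)[OF g], of X] that by (simp add: composition_operator_def f_def)
      then show ?thesis using that by (simp add: g_def algebra_simps)
    qed
    have "approximable f"
      unfolding free_holomorphic_iff_approximable[OF inf, symmetric] using f_ball by (simp add: H2_ball_def)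
    then have "free_holomorphic (\<lambda>X. f (\<Phi> X))"
      unfolding free_holomorphic_iff_approximable[OF inf] by (rule compose)
    then obtain a where a: "free_expansion a (\<lambda>X. f (\<Phi> X))" unfolding free_holomorphic_def ..
    have h_eq: "f (\<Phi> (\<psi> X)) = c *\<^sub>C f (\<Phi> X) + P X" if "X \<in> nc_ball" for X
      using that by (simp add: \<psi>_def \<Phi>_\<Phi> \<Phi>_ball \<phi>_ball f_eq)
    have low: "a \<alpha> = 0" if "length \<alpha> < m" for \<alpha>
    proof (rule ccontr)
      assume "a \<alpha> \<noteq> 0"
      with that have "\<exists>cs. length cs \<le> length \<alpha> \<and> set cs \<subseteq> eigenvalues A \<and> prod_list cs = c"
        by (intro lowest[OF a b h_eq]) (auto simp: b_def)
      then show False using minimal that by fastforce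
    qed
    let ?M = "tensor_entry (\<lambda>i j. A $ i $ j)"
    have "(\<Sum>\<beta> | length \<beta> = m. a \<beta> * ?M \<beta> \<gamma>) = c * a \<gamma> + cnj (w \<gamma>)" if "length \<gamma> = m" for \<gamma>
      using lead[OF a b h_eq low that] that by (simp add: b_def)
    \<comment> \<open>Pairing with \<open>w\<close> moves the tensor power onto its right
      eigenvector, so both sides contain the same multiple of \<open>c\<close>. After cancelling,
      the squared moduli of \<open>w\<close> would sum to 0.\<close>
    then have "(\<Sum>\<gamma> | length \<gamma> = m. (\<Sum>\<beta> | length \<beta> = m. a \<beta> * ?M \<beta> \<gamma>) * w \<gamma>) =
        c * (\<Sum>\<gamma> | length \<gamma> = m. a \<gamma> * w \<gamma>) + (\<Sum>\<gamma> | length \<gamma> = m. cnj (w \<gamma>) * w \<gamma>)"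
      by (simp add: distrib_right sum.distrib sum_distrib_left mult.assoc)
    moreover have "(\<Sum>\<gamma> | length \<gamma> = m. (\<Sum>\<beta> | length \<beta> = m. a \<beta> * ?M \<beta> \<gamma>) * w \<gamma>) =
        (\<Sum>\<beta> | length \<beta> = m. a \<beta> * (\<Sum>\<gamma> | length \<gamma> = m. ?M \<beta> \<gamma> * w \<gamma>))"
      by (simp add: sum_distrib_left sum_distrib_right mult.assoc) (rule sum.swap)
    moreover have "\<dots> = c * (\<Sum>\<gamma> | length \<gamma> = m. a \<gamma> * w \<gamma>)"
      by (simp add: w sum_distrib_left mult.left_commute)
    ultimately have "(\<Sum>\<gamma> | length \<gamma> = m. cnj (w \<gamma>) * w \<gamma>) = 0" by simp
    moreover have "(\<Sum>\<gamma> | length \<gamma> = m. cnj (w \<gamma>) * w \<gamma>) =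
        complex_of_real (\<Sum>\<gamma> | length \<gamma> = m. (cmod (w \<gamma>))\<^sup>2)"
      unfolding of_real_sum by (intro sum.cong refl) (metis complex_norm_square mult.commute)
    ultimately have "(\<Sum>\<gamma> | length \<gamma> = m. (cmod (w \<gamma>))\<^sup>2) = 0" by (simp only: of_real_eq_0_iff)
    then have "\<forall>\<gamma>\<in>{\<gamma>. length \<gamma> = m}. (cmod (w \<gamma>))\<^sup>2 = 0"
      by (subst (asm) sum_nonneg_eq_0_iff) auto
    then show False using \<delta> by simp
  qed
  ultimately show ?thesis unfolding A_def \<psi>_def \<Phi>_def by blast
qed

end
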